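(* Let $\Omega\subset\mathbb R^d$ be a bounded, connected, open set admitting the relative isoperimetric inequality. Let $p\ge1$, let $\mathcal A\subset C^1(\overline\Omega;M_N(\mathbb R)\times\mathbb R^N)$, and let $\mathbf U\subset W^1_p(\Omega;\mathbb R^N)$ be such that (i) every $(A,\mathbf m)\in\mathcal A$ satisfies the structural assumptions (S1)--(S3) of the context with one and the same constant $\kappa=\kappa(\mathcal A)>0$; (ii) every $\mathbf u\in\mathbf U$ satisfies $\mathbf u\ge0$ (that is, all components are non-negative); (iii) there do not exist sequences $\{\mathbf u_n=(u_{1n},\dots,u_{Nn})\}\subset\mathbf U$ and $\{(A_n,\mathbf m_n)\}\subset\mathcal A$ and a nonempty index set $I\subset\{1,\dots,N\}$ such that $\{\mathbf u_n\}$ is bounded in $L^p$ and, as $n\to\infty$, $$u_{in}\to0\ \text{ in measure on }\Omega\quad\text{for all } i\in I,\qquad f_{kn}\to0\ \text{ in measure on }\Omega\quad\text{for all } k\notin I,$$ where $f_{kn}$ is the $k$-th component of $\mathbf m_n-A_n\mathbf u_n$. Let $M=M(\kappa)$ be a real number as described in the context. Then there exists a constant $C=C(\Omega,p,\kappa,\mathcal A,\mathbf U)>0$ such that for all $\mathbf u=(u_1,\dots,u_N)\in\mathbf U$ and all $(A,\mathbf m)\in\mathcal A$, with $f_i=m_i-\sum_{j=1}^N a_{ij}u_j$ and $\tilde u_i(x)=\min(u_i(x),M)$, $$\int_\Omega\sum_{i=1}^N|f_i|^p\,\mathrm dx\le C\int_\Omega\sum_{i=1}^N\tilde u_i\left(|f_i|^p+|\nabla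 f_i|^p\right)\mathrm dx .$$
   Context: Relative isoperimetric inequality: there is a constant $c_\Omega>0$ such that $P(E;\Omega)\ge c_\Omega|E|^{\frac{d-1}{d}}$ for all Lebesgue measurable $E\subset\Omega$ of locally finite perimeter with $|E|\le\frac12|\Omega|$, where $P(E;\Omega)$ is the relative perimeter of $E$ with respect to $\Omega$ (the total variation in $\Omega$ of the Gauss--Green measure of $E$) and $|\cdot|$ is Lebesgue measure. Structural assumptions on $(A,\mathbf m)$, $A=(a_{ij})$, $\mathbf m=(m_1,\dots,m_N)$, with constant $\kappa>0$ (independent of $x$), required at every $x\in\overline\Omega$: (S1) $|a_{ij}|\le \frac1\kappa$ for $i,j=1,\dots,N$, and $m_i\le\frac1\kappa$ for $i=1,\dots,N$. (S2) For every $I=\{i_1,\dots,i_r\}\subset\{1,\dots,N\}$, $i_1<\dots<i_r$, $$\begin{vmatrix} a_{i_1i_1}&\cdots&a_{i_1i_r}\\ \vdots&\ddots&\vdots\\ a_{i_ri_1}&\cdots&a_{i_ri_r}\end{vmatrix}\ge\kappa .$$ (S3) For every $I=\{i_1,\dots,i_r\}\subset\{1,\dots,N\}$, $i_1<\dots<i_r$, and every $j\notin I$, $$\begin{vmatrix} a_{i_1i_1}&\cdots&a_{i_1i_r}&m_{i_1}\\ \vdots&\ddots&\vdots&\vdots\\ a_{i_ri_1}&\cdots&a_{i_ri_r}&m_{i_r}\\ a_{ji_1}&\cdots&a_{ji_r}&m_j\end{vmatrix}\ge\kappa$$ (for $I=\varnothing$ this reads $m_j\ge\kappa$; the empty determinant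 in (S2) equals $1$). The number $M$: for scalar coefficients $(A,\mathbf m)\in M_N(\mathbb R)\times\mathbb R^N$ satisfying the inequalities (S1)--(S3) with constant $\kappa$ and for $I\subset\{1,\dots,N\}$, let $\mathbf u_I=(u_{I1},\dots,u_{IN})\in\mathbb R^N$ be the unique solution of the linear system $u_i=0$ ($i\in I$), $m_j-\sum_{k=1}^N a_{jk}u_k=0$ ($j\notin I$). By Cramer's rule the numbers $u_{Ii}$ are bounded by a constant depending only on $\kappa$ (and $N$). $M=M(\kappa)$ is an arbitrary fixed real number strictly larger than the supremum of $u_{Ii}$ over all $I\subset\{1,\dots,N\}$, all $i\in\{1,\dots,N\}$ and all such coefficients. $W^1_p(\Omega;\mathbb R^N)$ is the usual Sobolev space of functions in $L^p$ with weak gradient in $L^p$. *)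

theory Defs
  imports "HOL-Analysis.Analysis"
begin

(* The defining formula of HOL-Analysis' det, for a square array whose rows and columns are
   indexed by a finite set I.  Numbering the elements of I as i_1 < ... < i_r turns it into the
   usual r x r determinant; by index_det_image the numbering is irrelevant. *)
definition index_det :: "'i set \<Rightarrow> ('i \<Rightarrow> 'i \<Rightarrow> real) \<Rightarrow> real" where
  "index_det I B = (\<Sum>p | p permutes I. of_int (sign p) * (\<Prod>i\<in>I. B i (p i)))"

lemma index_det_UNIV: "index_det UNIV (\<lambda>i j. A $ i $ j) = det A"
  for A :: "real^'n^'n"
  by (simp add: index_det_def det_def)

lemma index_det_empty: "index_det {} B = 1"
  by (simp add: index_det_def)

lemma index_det_singleton: "index_det {j} B = B j j"
  by (simp add: index_det_def)

lemma index_det_image: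
  assumes "finite S" "inj_on f S"
  shows "index_det (f ` S) B = index_det S (\<lambda>i j. B (f i) (f j))"
proof -
  have bij: "bij_betw f S (f ` S)"
    using assms by (simp add: bij_betw_def)
  have "(\<lambda>p. map_permutation S f p) = (\<lambda>p x. if x \<in> f ` S then f (p (inv_into S f x)) else x)"
    by (simp add: map_permutation_def restrict_id_def fun_eq_iff)
  then have "bij_betw (map_permutation S f) {p. p permutes S} {p. p permutes (f ` S)}"
    using bij_betw_permutations[OF bij] by simp
  then have "index_det (f ` S) B = (\<Sum>p | p permutes S. of_int (sign (map_permutation S f p)) *
          (\<Prod>i\<in>f ` S. B i (map_permutation S f p i)))"
    unfolding index_det_def by (rule sum.reindex_bij_betw[symmetric])
  also have "\<dots> = index_det S (\<lambda>i j. B (f i) (f j))"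
    unfolding index_det_def
    using assms
    by (intro sum.cong refl)
      (auto simp: sign_map_permutation prod.reindex map_permutation_apply)
  finally show ?thesis .
qed

(* In the bordered determinant the last row carries the label j and so does the last column,
   whose entries come from m. *)
definition structural :: "real \<Rightarrow> real^'n^'n \<Rightarrow> real^'n \<Rightarrow> bool" where
  "structural \<kappa> A m \<longleftrightarrow>
     (\<forall>i j. \<bar>A $ i $ j\<bar> \<le> 1 / \<kappa>) \<and> (\<forall>i. m $ i \<le> 1 / \<kappa>) \<and>
     (\<forall>I. index_det I (\<lambda>k l. A $ k $ l) \<ge> \<kappa>) \<and>
     (\<forall>I. \<forall>j. j \<notin> I \<longrightarrow>
        index_det (insert j I) (\<lambda>k l. if l = j then m $ k else A $ k $ l) \<ge> \<kappa>)"

definition partial_solution :: "real^'n^'n \<Rightarrow> real^'n \<Rightarrow> 'n set \<Rightarrow> real^'n" where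
  "partial_solution A m I =
     (THE u. (\<forall>i\<in>I. u $ i = 0) \<and> (\<forall>j. j \<notin> I \<longrightarrow> m $ j - (\<Sum>k\<in>UNIV. A $ j $ k * u $ k) = 0))"

(* The supremum is taken in the extended reals, so no boundedness is presupposed. *)
definition admissible_bound :: "'n::finite itself \<Rightarrow> real \<Rightarrow> real \<Rightarrow> bool" where
  "admissible_bound _ \<kappa> M \<longleftrightarrow>
     Sup {ereal (partial_solution A m I $ i) | (A :: real^'n^'n) m I i. structural \<kappa> A m} < ereal M"

definition residual :: "('a \<Rightarrow> real^'n^'n) \<Rightarrow> ('a \<Rightarrow> real^'n) \<Rightarrow> ('a \<Rightarrow> real^'n) \<Rightarrow> 'a \<Rightarrow> real^'n" where
  "residual A m u x = m x - A x *v u x"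

lemma residual_nth: "residual A m u x $ i = m x $ i - (\<Sum>j\<in>UNIV. A x $ i $ j * u x $ j)"
  by (simp add: residual_def matrix_vector_mult_def)


definition C1_closure :: "'a::euclidean_space set \<Rightarrow> ('a \<Rightarrow> 'b::real_normed_vector) \<Rightarrow> bool" where
  "C1_closure \<Omega> f \<longleftrightarrow> continuous_on (closure \<Omega>) f \<and>
     (\<exists>f' :: 'a \<Rightarrow> 'a \<Rightarrow>\<^sub>L 'b. continuous_on (closure \<Omega>) f' \<and>
        (\<forall>x\<in>\<Omega>. (f has_derivative blinfun_apply (f' x)) (at x)))"

definition C1_supported :: "'a::euclidean_space set \<Rightarrow> ('a \<Rightarrow> 'b::real_normed_vector) \<Rightarrow> bool" where
  "C1_supported K T \<longleftrightarrow>
     (\<exists>T' :: 'a \<Rightarrow> 'a \<Rightarrow>\<^sub>L 'b. continuous_on UNIV T' \<and>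
        (\<forall>x. (T has_derivative blinfun_apply (T' x)) (at x))) \<and>
     (\<forall>x. x \<notin> K \<longrightarrow> T x = 0)"

definition C1_test :: "'a::euclidean_space set \<Rightarrow> ('a \<Rightarrow> 'b::real_normed_vector) \<Rightarrow> bool" where
  "C1_test \<Omega> T \<longleftrightarrow> (\<exists>K. compact K \<and> K \<subseteq> \<Omega> \<and> C1_supported K T)"


definition divergence :: "('a::euclidean_space \<Rightarrow> 'a) \<Rightarrow> 'a \<Rightarrow> real" where
  "divergence T x = (\<Sum>b\<in>Basis. frechet_derivative T (at x) b \<bullet> b)"

(* The Gauss--Green measure of E is the vector-valued measure representing this functional on
   compactly supported C^1 fields T. *)
definition gauss_green :: "'a::euclidean_space set \<Rightarrow> ('a \<Rightarrow> 'a) \<Rightarrow> real" where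
  "gauss_green E T = (\<integral>x. divergence T x \<partial>(lebesgue_on E))"

(* Total variation of the Gauss--Green measure in the open set \<Omega>. *)
definition perimeter :: "'a::euclidean_space set \<Rightarrow> 'a set \<Rightarrow> ereal" where
  "perimeter E \<Omega> =
     Sup {ereal (gauss_green E T) | T. C1_test \<Omega> T \<and> (\<forall>x. norm (T x) \<le> 1)}"

(* Local finiteness is understood inside \<Omega>: E may have infinite perimeter near points of the
   boundary of \<Omega>. *)
definition locally_finite_perimeter :: "'a::euclidean_space set \<Rightarrow> 'a set \<Rightarrow> bool" where
  "locally_finite_perimeter E \<Omega> \<longleftrightarrow>
     (\<forall>K. compact K \<and> K \<subseteq> \<Omega> \<longrightarrow>
        Sup {ereal (gauss_green E T) | T. C1_supported K T \<and> (\<forall>x. norm (T x) \<le> 1)} < \<infinity>)"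

(* Since 0 powr 0 = 0, null sets E impose no condition in dimension one either. *)
definition relative_isoperimetric :: "'a::euclidean_space set \<Rightarrow> bool" where
  "relative_isoperimetric \<Omega> \<longleftrightarrow>
     (\<exists>c>0. \<forall>E. E \<in> sets lebesgue \<and> E \<subseteq> \<Omega> \<and> locally_finite_perimeter E \<Omega> \<and>
        measure lebesgue E \<le> 1 / 2 * measure lebesgue \<Omega> \<longrightarrow>
        perimeter E \<Omega> \<ge>
          ereal (c * measure lebesgue E powr ((real DIM('a) - 1) / real DIM('a))))"


definition Lp :: "'a::euclidean_space set \<Rightarrow> real \<Rightarrow> ('a \<Rightarrow> 'b::euclidean_space) \<Rightarrow> bool" where
  "Lp \<Omega> p f \<longleftrightarrow> f \<in> borel_measurable (lebesgue_on \<Omega>) \<and>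
     integrable (lebesgue_on \<Omega>) (\<lambda>x. norm (f x) powr p)"

definition Lp_norm :: "'a::euclidean_space set \<Rightarrow> real \<Rightarrow> ('a \<Rightarrow> 'b::euclidean_space) \<Rightarrow> real" where
  "Lp_norm \<Omega> p f = (\<integral>x. norm (f x) powr p \<partial>(lebesgue_on \<Omega>)) powr (1 / p)"

definition locally_integrable :: "'a::euclidean_space set \<Rightarrow> ('a \<Rightarrow> 'b::euclidean_space) \<Rightarrow> bool" where
  "locally_integrable \<Omega> f \<longleftrightarrow> (\<forall>K. compact K \<and> K \<subseteq> \<Omega> \<longrightarrow> integrable (lebesgue_on K) f)"

definition has_weak_gradient ::
    "'a::euclidean_space set \<Rightarrow> ('a \<Rightarrow> real) \<Rightarrow> ('a \<Rightarrow> 'a) \<Rightarrow> bool" where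
  "has_weak_gradient \<Omega> f g \<longleftrightarrow> locally_integrable \<Omega> f \<and> locally_integrable \<Omega> g \<and>
     (\<forall>\<phi> :: 'a \<Rightarrow> real. C1_test \<Omega> \<phi> \<longrightarrow> (\<forall>b\<in>Basis.
        (\<integral>x. f x * frechet_derivative \<phi> (at x) b \<partial>(lebesgue_on \<Omega>)) =
        - (\<integral>x. (g x \<bullet> b) * \<phi> x \<partial>(lebesgue_on \<Omega>))))"

(* Some representative; weak gradients are unique up to null sets. *)
definition weak_grad :: "'a::euclidean_space set \<Rightarrow> ('a \<Rightarrow> real) \<Rightarrow> 'a \<Rightarrow> 'a" where
  "weak_grad \<Omega> f = (SOME g. has_weak_gradient \<Omega> f g)"

(* Membership of a representative: values outside \<Omega> and on null sets are irrelevant. *)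
definition W1p :: "'a::euclidean_space set \<Rightarrow> real \<Rightarrow> ('a \<Rightarrow> real^'n) \<Rightarrow> bool" where
  "W1p \<Omega> p u \<longleftrightarrow> Lp \<Omega> p u \<and>
     (\<forall>i. \<exists>g. has_weak_gradient \<Omega> (\<lambda>x. u x $ i) g \<and> Lp \<Omega> p g)"

definition tendsto_in_measure :: "'a measure \<Rightarrow> (nat \<Rightarrow> 'a \<Rightarrow> real) \<Rightarrow> ('a \<Rightarrow> real) \<Rightarrow> bool" where
  "tendsto_in_measure \<mu> f g \<longleftrightarrow>
     (\<forall>\<epsilon>>0. (\<lambda>n. emeasure \<mu> {x \<in> space \<mu>. \<epsilon> \<le> \<bar>f n x - g x\<bar>}) \<longlonglongrightarrow> 0)"

end

theory Submission
  imports Defs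
begin

text \<open>
  Write \<open>f = m - A u\<close> and \<open>W = \<Sum>\<^sub>i min u\<^sub>i M (|f\<^sub>i|\<^sup>p + |\<nabla>f\<^sub>i|\<^sup>p)\<close>. Where \<open>W\<close> is small, every index has
  \<open>u\<^sub>i\<close> or \<open>f\<^sub>i\<close> close to \<open>0\<close>, so \<open>u\<close> is close to one of the finitely many points \<open>u\<^sub>I\<close>
  (\<open>u\<^sub>i = 0\<close> on \<open>I\<close>, \<open>f\<^sub>j = 0\<close> off \<open>I\<close>). The structural assumptions make \<open>A\<close> a P-matrix and make the
  polyhedron \<open>u \<ge> 0, f \<ge> 0\<close> a combinatorial cube with vertices \<open>u\<^sub>I\<close>; in particular \<open>u\<^sub>k\<close> and \<open>f\<^sub>k\<close>
  never vanish together on it (\<open>feasible_strictly_complementary\<close>). By compactness of the set of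
  coefficients there is \<open>\<delta> > 0\<close> such that \<open>f \<ge> -\<delta>\<close> and \<open>|f\<^sub>k| \<le> \<delta>\<close> force \<open>u\<^sub>k \<ge> \<delta>\<close>
  (\<open>structural_uniform_complementarity\<close>).

  This is what makes the weighted gradient useful. A set on which \<open>u\<close> is close to \<open>u\<^sub>I\<close> can be described by
  \<open>|f\<^sub>j| < t\<close> off \<open>I\<close> and \<open>f\<^sub>i > t'\<close> on \<open>I\<close>; on its boundary some \<open>f\<^sub>k\<close> is at a small nonzero level
  while all \<open>f\<^sub>l \<ge> -\<delta>\<close>, hence \<open>u\<^sub>k \<ge> \<delta>\<close> and \<open>|\<nabla>f\<^sub>k| \<le> C W\<close>. Averaging over the levels, as in the coarea
  formula, gives such a set with perimeter at most \<open>C \<integral> W\<close> (\<open>exists_level_of_small_perimeter\<close>), and by the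
  relative isoperimetric inequality either the set or its complement has measure at most \<open>C \<integral> W\<close>. These sets
  cover \<open>\<Omega>\<close> up to measure \<open>C \<integral> W\<close>. So if \<open>\<integral> W\<close> is small, one regime \<open>I\<close> fills \<open>\<Omega>\<close> up to measure \<open>C \<integral> W\<close>
  (\<open>single_regime\<close>).

  If the inequality failed for every constant, there would be pairs with \<open>\<integral> W\<close> tending to \<open>0\<close>, each in a single
  regime, and along a subsequence in the same regime \<open>I\<close>. If \<open>I\<close> is empty then \<open>u\<^sub>k \<ge> \<delta>\<close> for all \<open>k\<close>
  on most of \<open>\<Omega>\<close> and the inequality holds with a fixed constant. If \<open>I\<close> is nonempty then \<open>u\<^sub>i \<rightarrow> 0\<close> in measure on
  \<open>I\<close> and \<open>f\<^sub>k \<rightarrow> 0\<close> in measure off \<open>I\<close>, which the hypothesis on sequences excludes.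

  The level sets are smoothed through the chain rule for weak gradients, which is proved by mollification.
\<close>

section \<open>P-matrices and the polyhedron of feasible points\<close>

text \<open>The system that defines the \<open>partial_solution\<close> for \<open>I\<close> has
  this matrix with \<open>J = - I\<close>. Its determinant is a principal minor of \<open>A\<close>,
  so the determinants of the structural assumptions become ordinary ones, to which row operations
  and Cramer's rule apply.\<close>

definition obstacle_matrix :: "'n set \<Rightarrow> real^'n^'n \<Rightarrow> real^'n^'n" where
  "obstacle_matrix J A = (\<chi> i. if i \<in> J then A $ i else axis i 1)"

text \<open>A permutation that moves a point outside \<open>J\<close> picks an off-diagonal zero of
  a unit row, so only the permutations of \<open>J\<close> contribute.\<close>

lemma det_unit_rows_outside:
  fixes B :: "real^'n^'n"
  shows "det (\<chi> i. if i \<in> J then B $ i else axis i 1) = index_det J (\<lambda>i j. B $ i $ j)"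
proof -
  let ?C = "\<chi> i. if i \<in> J then B $ i else axis i 1"
  have "det ?C = (\<Sum>p | p permutes UNIV. of_int (sign p) * (\<Prod>i\<in>UNIV. ?C $ i $ p i))"
    by (simp add: det_def)
  also have "\<dots> = (\<Sum>p | p permutes J. of_int (sign p) * (\<Prod>i\<in>UNIV. ?C $ i $ p i))"
  proof (rule sum.mono_neutral_right)
    show "finite {p. p permutes (UNIV :: 'n set)}"
      by (simp add: finite_permutations)
    show "{p. p permutes J} \<subseteq> {p. p permutes UNIV}"
      by (auto intro: permutes_subset)
    show "\<forall>p\<in>{p. p permutes UNIV} - {p. p permutes J}. of_int (sign p) * (\<Prod>i\<in>UNIV. ?C $ i $ p i) = 0"
    proof
      fix p assume p: "p \<in> {p. p permutes UNIV} - {p. p permutes J}"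
      then obtain i where "i \<notin> J" "p i \<noteq> i"
        unfolding permutes_def by blast
      then have "?C $ i $ p i = 0"
        by (simp add: axis_def)
      then have "\<exists>i\<in>UNIV. ?C $ i $ p i = 0" by blast
      then have "(\<Prod>i\<in>UNIV. ?C $ i $ p i) = 0"
        by (rule prod_zero[OF finite])
      then show "of_int (sign p) * (\<Prod>i\<in>UNIV. ?C $ i $ p i) = 0" by simp
    qed
  qed
  also have "\<dots> = (\<Sum>p | p permutes J. of_int (sign p) * (\<Prod>i\<in>J. B $ i $ p i))"
  proof (rule sum.cong[OF refl])
    fix p assume "p \<in> {p. p permutes J}"
    then have p: "p i = i" if "i \<notin> J" for i using that by (simp add: permutes_not_in)
    have "(\<Prod>i\<in>UNIV. ?C $ i $ p i) = (\<Prod>i\<in>J. ?C $ i $ p i) * (\<Prod>i\<in>-J. ?C $ i $ p i)"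
      by (subst prod.union_disjoint[symmetric]) auto
    also have "(\<Prod>i\<in>-J. ?C $ i $ p i) = 1"
      by (rule prod.neutral) (auto simp: p)
    finally show "of_int (sign p) * (\<Prod>i\<in>UNIV. ?C $ i $ p i) = of_int (sign p) * (\<Prod>i\<in>J. B $ i $ p i)"
      by simp
  qed
  finally show ?thesis by (simp add: index_det_def)
qed

lemma det_obstacle_matrix: "det (obstacle_matrix J A) = index_det J (\<lambda>i j. A $ i $ j)"
  unfolding obstacle_matrix_def by (rule det_unit_rows_outside)

lemma obstacle_matrix_mult:
  "(obstacle_matrix J A *v u) $ i = (if i \<in> J then (A *v u) $ i else u $ i)"
proof (cases "i \<in> J")
  case False
  then have "(obstacle_matrix J A *v u) $ i = (\<Sum>j\<in>UNIV. axis i 1 $ j * u $ j)"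
    by (simp add: obstacle_matrix_def matrix_vector_mult_def)
  also have "\<dots> = (\<Sum>j\<in>UNIV. if j = i then u $ j else 0)"
    by (rule sum.cong) (auto simp: axis_def)
  finally show ?thesis using False by simp
qed (simp add: obstacle_matrix_def matrix_vector_mult_def)

definition P_matrix :: "real^'n^'n \<Rightarrow> bool" where
  "P_matrix A \<longleftrightarrow> (\<forall>J. det (obstacle_matrix J A) > 0)"

text \<open>The determinant is affine in row \<open>k\<close>: adding \<open>d\<close> to the
  diagonal entry adds \<open>d\<close> times the principal minor without \<open>k\<close>.\<close>

lemma P_matrix_add_diagonal_entry:
  fixes A :: "real^'n^'n"
  assumes "P_matrix A" "d \<ge> 0"
  shows "P_matrix (\<chi> i. if i = k then A $ i + axis k d else A $ i)"
  unfolding P_matrix_def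
proof
  fix J :: "'n set"
  let ?A = "\<chi> i. if i = k then A $ i + axis k d else A $ i"
  show "det (obstacle_matrix J ?A) > 0"
  proof (cases "k \<in> J")
    case True
    let ?c = "\<lambda>i. if i \<in> J then A $ i else axis i 1"
    have "obstacle_matrix J ?A = (\<chi> i. if i = k then A $ k + d *s axis k 1 else ?c i)"
      using True by (auto simp: obstacle_matrix_def vec_eq_iff axis_def)
    also have "det \<dots> = det (\<chi> i. if i = k then A $ k else ?c i) + d * det (\<chi> i. if i = k then axis k 1 else ?c i)"
      by (simp add: det_row_add det_row_mul)
    also have "(\<chi> i. if i = k then A $ k else ?c i) = obstacle_matrix J A"
      using True by (auto simp: obstacle_matrix_def vec_eq_iff)
    also have "(\<chi> i. if i = k then axis k 1 else ?c i) = obstacle_matrix (J - {k}) A"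
      using True by (auto simp: obstacle_matrix_def vec_eq_iff)
    finally show ?thesis
      using assms by (metis P_matrix_def add_pos_nonneg less_imp_le mult_nonneg_nonneg)
  next
    case False
    then have "obstacle_matrix J ?A = obstacle_matrix J A"
      by (auto simp: obstacle_matrix_def vec_eq_iff)
    then show ?thesis using assms by (simp add: P_matrix_def)
  qed
qed

lemma P_matrix_add_diagonal:
  fixes A :: "real^'n^'n"
  assumes "P_matrix A" "\<And>i. d i \<ge> 0"
  shows "P_matrix (\<chi> i. A $ i + axis i (d i))"
proof -
  have "P_matrix (\<chi> i. if i \<in> S then A $ i + axis i (d i) else A $ i)" if "finite S" for S
    using that
  proof (induction S)
    case empty
    then show ?case using assms by simp
  next
    case (insert k S)
    have "(\<chi> i. if i \<in> insert k S then A $ i + axis i (d i) else A $ i) =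
      (\<chi> i. if i = k then (\<chi> i. if i \<in> S then A $ i + axis i (d i) else A $ i) $ i + axis k (d k)
              else (\<chi> i. if i \<in> S then A $ i + axis i (d i) else A $ i) $ i)"
      using insert(2) by (auto simp: vec_eq_iff)
    then show ?case using P_matrix_add_diagonal_entry[OF insert.IH assms(2)[of k], of k]
      by simp
  qed
  from this[of UNIV] show ?thesis by simp
qed

lemma obstacle_matrix_eq_0D:
  assumes "P_matrix A" "obstacle_matrix J A *v w = 0"
  shows "w = 0"
proof -
  have "det (obstacle_matrix J A) \<noteq> 0" using assms(1) by (auto simp: P_matrix_def less_le)
  then have "invertible (obstacle_matrix J A)" by (simp add: invertible_det_nz)
  then have "inj ((*v) (obstacle_matrix J A))" by (metis inj_matrix_vector_mult)
  then show ?thesis using assms(2) by (metis injD matrix_vector_mult_0_right)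
qed

text \<open>If all products \<open>w\<^sub>i (A w)\<^sub>i\<close> were nonpositive, then on the
  support of \<open>w\<close> one could write \<open>(A w)\<^sub>i = - d\<^sub>i w\<^sub>i\<close>
  with \<open>d \<ge> 0\<close>. So \<open>w\<close> would be in the kernel of a principal block of
  \<open>A + diag d\<close>, which is again a P-matrix.\<close>

lemma P_matrix_sign_condition:
  fixes A :: "real^'n^'n"
  assumes A: "P_matrix A" and w: "w \<noteq> 0"
  shows "\<exists>i. w $ i * (A *v w) $ i > 0"
proof (rule ccontr)
  assume "\<nexists>i. w $ i * (A *v w) $ i > 0"
  then have le: "w $ i * (A *v w) $ i \<le> 0" for i by (metis not_le)
  define J where "J = {i. w $ i \<noteq> 0}"
  define d where "d i = - ((A *v w) $ i / w $ i)" for i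
  have d: "d i \<ge> 0" for i
    using le[of i] by (cases "w $ i = 0") (auto simp: d_def divide_le_0_iff mult_le_0_iff)
  let ?B = "\<chi> i. A $ i + axis i (d i)"
  have B: "(?B *v w) $ i = (A *v w) $ i + d i * w $ i" for i
  proof -
    have "(?B *v w) $ i = (A *v w) $ i + (\<Sum>j\<in>UNIV. axis i (d i) $ j * w $ j)"
      by (simp add: matrix_vector_mult_def algebra_simps sum.distrib)
    also have "(\<Sum>j\<in>UNIV. axis i (d i) $ j * w $ j) = (\<Sum>j\<in>UNIV. if j = i then d i * w $ i else 0)"
      by (intro sum.cong) (auto simp: axis_def)
    finally show ?thesis by simp
  qed
  have "obstacle_matrix J ?B *v w = 0"
  proof (rule vec_eq_iff[THEN iffD2], rule allI)
    fix i
    show "(obstacle_matrix J ?B *v w) $ i = 0 $ i"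
      by (subst obstacle_matrix_mult) (auto simp: B J_def, simp add: d_def)
  qed
  with obstacle_matrix_eq_0D[OF P_matrix_add_diagonal[of A d, OF A d]] w show False by blast
qed

lemma structural_P_matrix: "structural \<kappa> A m \<Longrightarrow> \<kappa> > 0 \<Longrightarrow> P_matrix A"
  unfolding P_matrix_def det_obstacle_matrix structural_def by (meson less_le_trans)

text \<open>The value of \<open>residual\<close> at one point, as a function of the coefficients and
  of \<open>u\<close> there.\<close>

definition defect :: "real^'n^'n \<Rightarrow> real^'n \<Rightarrow> real^'n \<Rightarrow> real^'n" where
  "defect A m u = m - A *v u"

lemma residual_eq_defect: "residual A m u x = defect (A x) (m x) (u x)"
  by (simp add: residual_def defect_def)

lemma defect_diff: "defect A m u $ i - defect A m v $ i = - (A *v (u - v)) $ i"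
  by (simp add: defect_def matrix_vector_mult_diff_distrib)

lemma partial_solution_iff:
  fixes A :: "real^'n^'n"
  assumes "P_matrix A"
  shows "u = partial_solution A m I \<longleftrightarrow> (\<forall>i\<in>I. u $ i = 0) \<and> (\<forall>j. j \<notin> I \<longrightarrow> defect A m u $ j = 0)"
proof -
  let ?G = "obstacle_matrix (- I) A" and ?b = "\<chi> i. if i \<in> I then 0 else m $ i"
  have det: "det ?G \<noteq> 0" using assms by (auto simp: P_matrix_def less_le)
  define Q where "Q = (\<lambda>u. (\<forall>i\<in>I. u $ i = 0) \<and> (\<forall>j. j \<notin> I \<longrightarrow> defect A m u $ j = 0))"
  have eq: "Q u \<longleftrightarrow> ?G *v u = ?b" for u
  proof -
    have "?G *v u = ?b \<longleftrightarrow> (\<forall>i. (?G *v u) $ i = ?b $ i)"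
      by (rule vec_eq_iff)
    also have "\<dots> \<longleftrightarrow> Q u"
      unfolding obstacle_matrix_mult Q_def defect_def by force
    finally show ?thesis ..
  qed
  have "\<exists>!u. Q u"
    unfolding eq cramer[OF det] by blast
  then have "u = (THE u. Q u) \<longleftrightarrow> Q u"
    by (metis (mono_tags, lifting) the_equality)
  moreover have "(THE u. Q u) = partial_solution A m I"
    by (simp add: partial_solution_def Q_def defect_def matrix_vector_mult_def)
  ultimately show ?thesis
    by (simp add: Q_def)
qed

lemma partial_solution_eqs:
  fixes A :: "real^'n^'n"
  assumes "P_matrix A"
  shows "i \<in> I \<Longrightarrow> partial_solution A m I $ i = 0"
    and "i \<notin> I \<Longrightarrow> defect A m (partial_solution A m I) $ i = 0"
  using partial_solution_iff[OF assms] by blast+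

text \<open>The bordered determinant of the third structural assumption is the numerator in Cramer's
  rule.\<close>

lemma partial_solution_pos:
  fixes A :: "real^'n^'n"
  assumes S: "structural \<kappa> A m" and \<kappa>: "\<kappa> > 0" and k: "k \<notin> I"
  shows "partial_solution A m I $ k > 0"
proof -
  let ?u = "partial_solution A m I"
  let ?G = "obstacle_matrix (- I) A" and ?b = "\<chi> i. if i \<in> I then 0 else m $ i"
  let ?H = "\<chi> i j. if j = k then ?b $ i else ?G $ i $ j"
  have P: "P_matrix A" using structural_P_matrix S \<kappa> .
  then have det: "det ?G > 0" by (auto simp: P_matrix_def)
  have "(?G *v ?u) $ i = ?b $ i" for i
    using partial_solution_eqs[OF P, where m = m and I = I and i = i]
    unfolding obstacle_matrix_mult by (auto simp: defect_def)
  then have "?G *v ?u = ?b" by (simp only: vec_eq_iff) blast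
  then have "?u = (\<chi> k. det (\<chi> i j. if j = k then ?b $ i else ?G $ i $ j) / det ?G)"
    using cramer[of ?G] det by simp
  then have "?u $ k = det ?H / det ?G"
    by (simp add: vec_eq_iff)
  also have "?H = (\<chi> i. if i \<in> - I then (\<chi> i j. if j = k then m $ i else A $ i $ j) $ i else axis i 1)"
    using k by (auto simp: vec_eq_iff obstacle_matrix_def axis_def)
  also have "det \<dots> = index_det (- I) (\<lambda>i j. if j = k then m $ i else A $ i $ j)"
    unfolding det_unit_rows_outside by (rule arg_cong[where f = "index_det (- I)"]) (simp add: fun_eq_iff)
  finally have "?u $ k = index_det (- I) (\<lambda>i j. if j = k then m $ i else A $ i $ j) / det ?G" .
  moreover have "index_det (insert k (- I - {k})) (\<lambda>i j. if j = k then m $ i else A $ i $ j) \<ge> \<kappa>"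
    using S unfolding structural_def by blast
  moreover have "insert k (- I - {k}) = - I" using k by auto
  ultimately show ?thesis using \<kappa> det by simp
qed

text \<open>The difference between the solutions for \<open>I - {k}\<close> and \<open>I\<close> and
  its image under \<open>A\<close> have disjoint supports except at \<open>k\<close>, where the sign
  condition for P-matrices applies.\<close>

lemma partial_solution_defect_pos:
  fixes A :: "real^'n^'n"
  assumes S: "structural \<kappa> A m" and \<kappa>: "\<kappa> > 0" and k: "k \<in> I"
  shows "defect A m (partial_solution A m I) $ k > 0"
proof -
  have P: "P_matrix A" using structural_P_matrix S \<kappa> .
  let ?u = "partial_solution A m I" and ?v = "partial_solution A m (I - {k})"
  note u = partial_solution_eqs[OF P, where m = m and I = I]
    and v = partial_solution_eqs[OF P, where m = m and I = "I - {k}"]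
  let ?w = "?v - ?u"
  have vk: "?v $ k > 0" using partial_solution_pos[OF S \<kappa>] by simp
  have "?u $ k = 0" "defect A m ?v $ k = 0" using u v k by auto
  with vk have "?w $ k \<noteq> 0" by simp
  then have "?w \<noteq> 0" by (metis zero_index)
  then obtain i where i: "?w $ i * (A *v ?w) $ i > 0"
    using P_matrix_sign_condition[OF P] by blast
  have "?w $ i = 0" if "i \<in> I" "i \<noteq> k" using u v that by simp
  moreover have "(A *v ?w) $ i = 0" if "i \<notin> I" using u v that defect_diff[of A m ?v i ?u] by simp
  ultimately have "i = k" using i by force
  with i vk \<open>?u $ k = 0\<close> have "(A *v ?w) $ k > 0" by (simp add: zero_less_mult_iff)
  then show ?thesis using \<open>defect A m ?v $ k = 0\<close> defect_diff[of A m ?v k ?u] by simp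
qed

lemma complementary_imp_defect_nonneg:
  fixes A :: "real^'n^'n"
  assumes S: "structural \<kappa> A m" and \<kappa>: "\<kappa> > 0"
    and c: "\<And>i. u $ i * defect A m u $ i = 0"
  shows "defect A m u $ i \<ge> 0"
proof -
  have P: "P_matrix A" using structural_P_matrix S \<kappa> .
  let ?I = "{i. u $ i = 0}"
  have "u = partial_solution A m ?I"
    using c by (subst partial_solution_iff[OF P]) auto
  then show ?thesis
    using partial_solution_defect_pos[OF S \<kappa>, of i ?I] c[of i]
    by (cases "u $ i = 0") auto
qed

text \<open>The points \<open>partial_solution A m I\<close> are the vertices of the feasible
  polyhedron, and the edges from the vertex of \<open>I\<close> lead to the vertices of the sets
  that differ from \<open>I\<close> in one index. The functional \<open>l = u\<^sub>k +
  f\<^sub>k\<close> is positive at all of them. At a vertex where \<open>l\<close> is smallest among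
  the vertices it does not decrease along the edges, which span the cone that contains the
  polyhedron, so \<open>l\<close> is smallest there on the whole polyhedron.\<close>

lemma feasible_strictly_complementary:
  fixes A :: "real^'n^'n"
  assumes S: "structural \<kappa> A m" and \<kappa>: "\<kappa> > 0"
    and u: "\<And>i. u $ i \<ge> 0" and f: "\<And>i. defect A m u $ i \<ge> 0"
  shows "u $ k + defect A m u $ k > 0"
proof -
  have P: "P_matrix A" using structural_P_matrix S \<kappa> .
  let ?s = "partial_solution A m"
  define l where "l u = u $ k + defect A m u $ k" for u
  define I where "I = arg_min_on (\<lambda>I. l (?s I)) UNIV"
  have I: "l (?s I) \<le> l (?s J)" for J
    unfolding I_def by (rule arg_min_least) auto
  define flip where "flip i = (if i \<in> I then I - {i} else insert i I)" for i
  \<comment> \<open>the constraints active at the vertex, as coordinates of the cone of feasible points\<close>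
  define act where "act u i = (if i \<in> I then u $ i else defect A m u $ i)" for u i
  \<comment> \<open>the coordinates of u - ?s I with respect to the edges at the vertex ?s I\<close>
  define t where "t i = act u i / act (?s (flip i)) i" for i
  have vertex: "act (?s I) i = 0" for i
    using partial_solution_eqs[OF P, where m = m and I = I] by (auto simp: act_def)
  have pos: "act (?s (flip i)) i > 0" for i
    using partial_solution_pos[OF S \<kappa>, of i "flip i"] partial_solution_defect_pos[OF S \<kappa>, of i "flip i"]
    by (auto simp: act_def flip_def)
  have zero: "act (?s (flip i)) j = 0" if "j \<noteq> i" for i j
    using partial_solution_eqs[OF P, where m = m and I = "flip i"] that by (auto simp: act_def flip_def split: if_splits)
  have t: "t i \<ge> 0" for i
    unfolding t_def using pos[of i] u[of i] f[of i] by (intro divide_nonneg_pos) (auto simp: act_def)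
  define z where "z = ?s I + (\<Sum>i\<in>UNIV. t i *\<^sub>R (?s (flip i) - ?s I))"
  have z_nth: "z $ j = ?s I $ j + (\<Sum>i\<in>UNIV. t i * (?s (flip i) $ j - ?s I $ j))" for j
    by (simp add: z_def)
  have Az: "A *v z = A *v ?s I + (\<Sum>i\<in>UNIV. t i *\<^sub>R (A *v ?s (flip i) - A *v ?s I))"
    by (simp add: z_def matrix_vector_right_distrib matrix_vector_mult_diff_distrib
        linear_sum[OF matrix_vector_mul_linear] matrix_vector_mult_scaleR)
  have fz: "defect A m z $ j = defect A m (?s I) $ j +
      (\<Sum>i\<in>UNIV. t i * (defect A m (?s (flip i)) $ j - defect A m (?s I) $ j))" for j
    unfolding defect_def Az by (simp add: sum_negf[symmetric] algebra_simps)
  have "act z j = act u j" for j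
  proof -
    have "act z j = act (?s I) j + (\<Sum>i\<in>UNIV. t i * (act (?s (flip i)) j - act (?s I) j))"
      by (simp add: act_def z_nth fz)
    also have "\<dots> = (\<Sum>i\<in>UNIV. if i = j then t j * act (?s (flip j)) j else 0)"
      unfolding vertex add_0 diff_0_right by (intro sum.cong refl) (auto simp: zero)
    also have "\<dots> = act u j" using pos[of j] by (simp add: t_def)
    finally show ?thesis .
  qed
  then have act: "act z j = act u j" for j .
  have "obstacle_matrix (- I) A *v (z - u) = 0"
  proof (rule vec_eq_iff[THEN iffD2], rule allI)
    fix i
    show "(obstacle_matrix (- I) A *v (z - u)) $ i = 0 $ i"
      using act[of i] defect_diff[of A m z i u]
      by (subst obstacle_matrix_mult) (auto simp: act_def split: if_splits)
  qed
  then have "z = u" using obstacle_matrix_eq_0D[OF P] by force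
  have "l z = l (?s I) + (\<Sum>i\<in>UNIV. t i * (l (?s (flip i)) - l (?s I)))"
    by (simp add: l_def z_nth fz sum.distrib[symmetric] algebra_simps)
  moreover have "\<dots> \<ge> l (?s I)"
    using t I by (simp add: sum_nonneg)
  moreover have "l (?s I) > 0"
    using partial_solution_pos[OF S \<kappa>, of k I] partial_solution_defect_pos[OF S \<kappa>, of k I]
      partial_solution_eqs[OF P, where m = m and I = I] by (cases "k \<in> I") (auto simp: l_def)
  ultimately show ?thesis using \<open>z = u\<close> by (simp add: l_def)
qed

section \<open>Uniform estimates for structural coefficients\<close>

lemma structural_m_ge: 
  assumes "structural \<kappa> A m"
  shows "m $ j \<ge> \<kappa>"
proof -
  have "index_det (insert j {}) (\<lambda>k l. if l = j then m $ k else A $ k $ l) \<ge> \<kappa>"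
    using assms unfolding structural_def by blast
  then show ?thesis by (simp add: index_det_singleton)
qed

lemma structural_abs_m_le: "structural \<kappa> A m \<Longrightarrow> \<kappa> > 0 \<Longrightarrow> \<bar>m $ j\<bar> \<le> 1 / \<kappa>"
  using structural_m_ge[of \<kappa> A m j] by (auto simp: structural_def)

lemma continuous_on_index_det [continuous_intros]:
  assumes "\<And>k l. continuous_on S (\<lambda>x. B x k l)"
  shows "continuous_on S (\<lambda>x. index_det I (B x))"
  unfolding index_det_def using assms by (intro continuous_intros) auto

lemma compact_structural:
  assumes \<kappa>: "\<kappa> > 0"
  shows "compact {z :: (real^'n^'n) \<times> (real^'n). structural \<kappa> (fst z) (snd z)}"
  unfolding compact_eq_bounded_closed
proof
  show "closed {z :: (real^'n^'n) \<times> (real^'n). structural \<kappa> (fst z) (snd z)}"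
    unfolding structural_def
    apply (intro closed_Collect_conj closed_Collect_all closed_Collect_imp closed_Collect_le open_Collect_const
        continuous_intros continuous_on_index_det)
    subgoal for I j k l by (cases "l = j") (auto intro!: continuous_intros)
    done
  have "norm (fst z) \<le> (\<Sum>i\<in>(UNIV::'n set). \<Sum>j\<in>(UNIV::'n set). 1 / \<kappa>)"
    "norm (snd z) \<le> (\<Sum>i\<in>(UNIV::'n set). 1 / \<kappa>)"
    if "structural \<kappa> (fst z) (snd z)" for z :: "(real^'n^'n) \<times> (real^'n)"
  proof -
    have "norm (fst z) \<le> (\<Sum>i\<in>UNIV. norm (fst z $ i))" 
      unfolding norm_vec_def by (rule L2_set_le_sum) auto
    also have "\<dots> \<le> (\<Sum>i\<in>(UNIV::'n set). \<Sum>j\<in>(UNIV::'n set). 1 / \<kappa>)"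
    proof (rule sum_mono)
      fix i
      have "norm (fst z $ i) \<le> (\<Sum>j\<in>UNIV. norm (fst z $ i $ j))" 
        unfolding norm_vec_def by (rule L2_set_le_sum) auto
      also have "\<dots> \<le> (\<Sum>j\<in>(UNIV::'n set). 1 / \<kappa>)"
        using that by (intro sum_mono) (auto simp: structural_def)
      finally show "norm (fst z $ i) \<le> (\<Sum>j\<in>(UNIV::'n set). 1 / \<kappa>)" .
    qed
    finally show "norm (fst z) \<le> (\<Sum>i\<in>(UNIV::'n set). \<Sum>j\<in>(UNIV::'n set). 1 / \<kappa>)" .
    have "norm (snd z) \<le> (\<Sum>i\<in>UNIV. norm (snd z $ i))" 
      unfolding norm_vec_def by (rule L2_set_le_sum) auto
    also have "\<dots> \<le> (\<Sum>i\<in>(UNIV::'n set). 1 / \<kappa>)"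
      using structural_abs_m_le[OF that \<kappa>] by (intro sum_mono) auto
    finally show "norm (snd z) \<le> (\<Sum>i\<in>(UNIV::'n set). 1 / \<kappa>)" .
  qed
  then have "{z :: (real^'n^'n) \<times> (real^'n). structural \<kappa> (fst z) (snd z)} \<subseteq>
      cball 0 (\<Sum>i\<in>(UNIV::'n set). \<Sum>j\<in>(UNIV::'n set). 1 / \<kappa>) \<times> cball 0 (\<Sum>i\<in>(UNIV::'n set). 1 / \<kappa>)"
    by (force simp: mem_Times_iff)
  then show "bounded {z :: (real^'n^'n) \<times> (real^'n). structural \<kappa> (fst z) (snd z)}"
    by (rule bounded_subset[rotated]) (intro bounded_Times bounded_cball)
qed

lemma continuous_on_defect_nth [continuous_intros]:
  assumes "continuous_on S A" "continuous_on S m" "continuous_on S u"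
  shows "continuous_on S (\<lambda>z. defect (A z) (m z) (u z) $ i)"
  unfolding defect_def matrix_vector_mult_def vector_minus_component vec_lambda_beta
  using assms by (intro continuous_intros) auto

text \<open>The sign condition gives an index with \<open>u\<^sub>i\<close> and \<open>(A
  u)\<^sub>i\<close> both positive; compactness of the coefficients and of the unit sphere makes
  this quantitative.\<close>

lemma structural_coercive:
  assumes \<kappa>: "\<kappa> > 0"
  obtains c where "c > 0"
    "\<And>(A :: real^'n^'n) m u. structural \<kappa> A m \<Longrightarrow> (\<And>i. u $ i \<ge> 0) \<Longrightarrow>
       \<exists>i. u $ i \<ge> c * norm u \<and> (A *v u) $ i \<ge> c * norm u"
proof -
  define K where "K = {z :: (real^'n^'n) \<times> (real^'n). structural \<kappa> (fst z) (snd z)} \<times>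
     {u :: real^'n. norm u = 1 \<and> (\<forall>i. u $ i \<ge> 0)}"
  \<comment> \<open>positive as soon as one index has both u $ i and (A *v u) $ i positive; the defect with m = 0 is - (A *v u)\<close>
  define h where "h z = (\<Sum>i\<in>UNIV. max 0 (min (snd z $ i) (- defect (fst (fst z)) 0 (snd z) $ i)))"
    for z :: "((real^'n^'n) \<times> (real^'n)) \<times> (real^'n)"
  have "{u :: real^'n. norm u = 1 \<and> (\<forall>i. u $ i \<ge> 0)} = sphere 0 1 \<inter> {u. \<forall>i. u $ i \<ge> 0}"
    by auto
  moreover have "closed {u :: real^'n. \<forall>i. u $ i \<ge> 0}"
    by (intro closed_Collect_all closed_Collect_le continuous_intros)
  ultimately have K: "compact K"
    unfolding K_def by (intro compact_Times compact_structural \<kappa>) (auto intro!: compact_Int_closed)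
  have h: "continuous_on K h"
    unfolding h_def by (intro continuous_intros)
  have pos: "h z > 0" if "z \<in> K" for z
  proof -
    obtain A m u where z: "z = ((A, m), u)" by (metis surj_pair)
    have *: "structural \<kappa> A m" "norm u = 1" "\<And>i. u $ i \<ge> 0" using that by (auto simp: K_def z)
    then have "u \<noteq> 0" by auto
    then obtain i where i: "u $ i * (A *v u) $ i > 0"
      using P_matrix_sign_condition structural_P_matrix[OF *(1) \<kappa>] by blast
    then have "u $ i > 0" "(A *v u) $ i > 0" using *(3)[of i] by (auto simp: zero_less_mult_iff)
    then show ?thesis
      unfolding h_def by (intro sum_pos2[of _ i]) (auto simp: z defect_def)
  qed
  obtain h0 where h0: "h0 > 0" "\<And>z. z \<in> K \<Longrightarrow> h z \<ge> h0"
  proof (cases "K = {}")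
    case True then show ?thesis using that[of 1] by auto
  next
    case False
    then obtain z where "z \<in> K" "\<And>y. y \<in> K \<Longrightarrow> h z \<le> h y"
      using continuous_attains_inf[OF K False h] by blast
    then show ?thesis using that[of "h z"] pos by auto
  qed
  define c where "c = h0 / real CARD('n)"
  have "c > 0" using h0 by (simp add: c_def)
  have main: "\<exists>i. u $ i \<ge> c \<and> (A *v u) $ i \<ge> c"
    if "structural \<kappa> A m" "norm u = 1" "\<And>i. u $ i \<ge> 0" for A :: "real^'n^'n" and m u
  proof (rule ccontr)
    assume "\<not> ?thesis"
    then have "u $ i < c \<or> (A *v u) $ i < c" for i
      by (meson not_le)
    then have "max 0 (min (u $ i) ((A *v u) $ i)) < c" for i
      using \<open>c > 0\<close> by (simp add: min_less_iff_disj)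
    then have "h ((A, m), u) < (\<Sum>i\<in>(UNIV::'n set). c)"
      unfolding h_def by (intro sum_strict_mono) (auto simp: defect_def)
    also have "\<dots> = h0" by (simp add: c_def)
    finally show False using h0(2)[of "((A,m),u)"] that by (auto simp: K_def)
  qed
  show thesis
  proof (rule that[OF \<open>c > 0\<close>])
    fix A :: "real^'n^'n" and m u :: "real^'n"
    assume *: "structural \<kappa> A m" "\<And>i. u $ i \<ge> 0"
    show "\<exists>i. u $ i \<ge> c * norm u \<and> (A *v u) $ i \<ge> c * norm u"
    proof (cases "u = 0")
      case False
      let ?v = "(1 / norm u) *\<^sub>R u"
      have "\<exists>i. ?v $ i \<ge> c \<and> (A *v ?v) $ i \<ge> c"
        using False * by (intro main[of A m]) auto
      then show ?thesis using False by (auto simp: matrix_vector_mult_scaleR field_simps)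
    qed auto
  qed
qed

text \<open>Large \<open>u\<close> is controlled by the weight alone: some component has both
  \<open>u\<^sub>i\<close> and \<open>|f\<^sub>i|\<close> large.\<close>

lemma structural_growth:
  assumes \<kappa>: "\<kappa> > 0"
  obtains c R where "c > 0" "R \<ge> 1"
    "\<And>(A :: real^'n^'n) m u. structural \<kappa> A m \<Longrightarrow> (\<And>i. u $ i \<ge> 0) \<Longrightarrow> norm u \<ge> R \<Longrightarrow>
       \<exists>i. u $ i \<ge> 1 \<and> \<bar>defect A m u $ i\<bar> \<ge> c * norm u \<and> defect A m u $ i < -1"
proof -
  obtain c where c: "c > 0" "\<And>(A :: real^'n^'n) m u. structural \<kappa> A m \<Longrightarrow> (\<And>i. u $ i \<ge> 0) \<Longrightarrow>
       \<exists>i. u $ i \<ge> c * norm u \<and> (A *v u) $ i \<ge> c * norm u"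
    using structural_coercive[OF \<kappa>] by blast
  define R where "R = max 1 (2 * (1 / \<kappa> + 2) / c)"
  show thesis
  proof (rule that[of "c / 2" R])
    fix A :: "real^'n^'n" and m u :: "real^'n"
    assume *: "structural \<kappa> A m" "\<And>i. u $ i \<ge> 0" "norm u \<ge> R"
    obtain i where i: "u $ i \<ge> c * norm u" "(A *v u) $ i \<ge> c * norm u" using c *(1,2) by blast
    have "norm u \<ge> 2 * (1 / \<kappa> + 2) / c" using *(3) by (simp add: R_def)
    then have n: "c * norm u \<ge> 2 * (1 / \<kappa> + 2)" using c(1) by (simp add: field_simps)
    have "m $ i \<le> 1 / \<kappa>" "1 / \<kappa> > 0" using *(1) \<kappa> by (auto simp: structural_def)
    moreover define r where "r = 1 / \<kappa>"
    ultimately have "u $ i \<ge> 1 \<and> (A *v u) $ i - m $ i > 1 \<and> (A *v u) $ i - m $ i \<ge> (c * norm u) / 2"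
      using i n unfolding r_def[symmetric] distrib_left by (intro conjI) linarith+
    then show "\<exists>i. u $ i \<ge> 1 \<and> \<bar>defect A m u $ i\<bar> \<ge> c / 2 * norm u \<and> defect A m u $ i < -1"
      by (auto simp: defect_def)
  qed (use c in \<open>auto simp: R_def\<close>)
qed

lemma structural_defect_le:
  assumes S: "structural \<kappa> A m" and \<kappa>: "\<kappa> > 0"
  shows "\<bar>defect (A :: real^'n^'n) m u $ i\<bar> \<le> 1 / \<kappa> * (1 + real CARD('n) * norm u)"
proof -
  have "\<bar>(A *v u) $ i\<bar> \<le> (\<Sum>j\<in>UNIV. \<bar>A $ i $ j * u $ j\<bar>)"
    by (simp add: matrix_vector_mult_def)
  also have "\<dots> \<le> (\<Sum>j\<in>(UNIV :: 'n set). 1 / \<kappa> * norm u)"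
    unfolding abs_mult using S \<kappa> component_le_norm_cart[of u]
    by (intro sum_mono mult_mono) (auto simp: structural_def)
  finally have "\<bar>(A *v u) $ i\<bar> \<le> 1 / \<kappa> * (real CARD('n) * norm u)" by simp
  then show ?thesis
    using structural_abs_m_le[OF S \<kappa>, of i] by (simp add: defect_def algebra_simps)
qed

text \<open>A stable form of \<open>feasible_strictly_complementary\<close>: a component whose
  \<open>f\<^sub>k\<close> passes through a small level, with no \<open>f\<^sub>l\<close> very
  negative, has a weight \<open>u\<^sub>k\<close> bounded below. The type argument fixes the number
  of components.\<close>

definition complementarity_gap :: "'n::finite itself \<Rightarrow> real \<Rightarrow> real \<Rightarrow> bool" where
  "complementarity_gap _ \<kappa> \<delta> \<longleftrightarrow> (\<forall>(A :: real^'n^'n) m u k. structural \<kappa> A m \<longrightarrow> (\<forall>i. u $ i \<ge> 0) \<longrightarrow>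
     (\<forall>i. defect A m u $ i \<ge> - \<delta>) \<longrightarrow> \<bar>defect A m u $ k\<bar> \<le> \<delta> \<longrightarrow> u $ k \<ge> \<delta>)"

text \<open>Below the threshold \<open>\<eta>\<close> the point is so close to some
  \<open>partial_solution\<close> that each \<open>f\<^sub>k\<close> is either almost zero or
  clearly positive; levels between \<open>\<delta> / 2\<close> and \<open>\<delta>\<close> are not
  attained.\<close>

definition near_equilibria_threshold :: "'n::finite itself \<Rightarrow> real \<Rightarrow> real \<Rightarrow> real \<Rightarrow> bool" where
  "near_equilibria_threshold _ \<kappa> \<delta> \<eta> \<longleftrightarrow> (\<forall>(A :: real^'n^'n) m u k. structural \<kappa> A m \<longrightarrow> (\<forall>i. u $ i \<ge> 0) \<longrightarrow>
     (\<forall>i. u $ i < \<eta> \<or> \<bar>defect A m u $ i\<bar> < \<eta>) \<longrightarrow>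
     \<bar>defect A m u $ k\<bar> < \<delta> / 2 \<or> defect A m u $ k > \<delta>)"

text \<open>By coercivity the points with \<open>f \<ge> -1\<close> form a compact set. There the
  sum of the negative parts of \<open>f\<close>, of \<open>|f\<^sub>k|\<close> and of
  \<open>u\<^sub>k\<close> is positive, hence bounded below.\<close>

lemma structural_uniform_complementarity:
  assumes \<kappa>: "\<kappa> > 0"
  obtains \<delta> where "\<delta> > 0" "\<delta> \<le> 1" "complementarity_gap TYPE('n::finite) \<kappa> \<delta>"
proof -
  let ?N = "real CARD('n)"
  obtain c R where cR: "c > 0" "R \<ge> 1"
    "\<And>(A :: real^'n^'n) m u. structural \<kappa> A m \<Longrightarrow> (\<And>i. u $ i \<ge> 0) \<Longrightarrow> norm u \<ge> R \<Longrightarrow>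
       \<exists>i. u $ i \<ge> 1 \<and> \<bar>defect A m u $ i\<bar> \<ge> c * norm u \<and> defect A m u $ i < -1"
    using structural_growth[OF \<kappa>] by blast
  define K where "K = ({z :: (real^'n^'n) \<times> (real^'n). structural \<kappa> (fst z) (snd z)} \<times> cball 0 R) \<inter>
     {z. (\<forall>i. snd z $ i \<ge> 0) \<and> (\<forall>i. defect (fst (fst z)) (snd (fst z)) (snd z) $ i \<ge> -1)}"
  have "closed {z :: ((real^'n^'n) \<times> (real^'n)) \<times> (real^'n).
      (\<forall>i. snd z $ i \<ge> 0) \<and> (\<forall>i. defect (fst (fst z)) (snd (fst z)) (snd z) $ i \<ge> -1)}"
    by (intro closed_Collect_conj closed_Collect_all closed_Collect_le continuous_intros)
  then have K: "compact K"
    unfolding K_def by (intro compact_Int_closed compact_Times compact_structural \<kappa> compact_cball)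
  define h where "h k z = (\<Sum>i\<in>UNIV. max 0 (- defect (fst (fst z)) (snd (fst z)) (snd z) $ i)) +
      \<bar>defect (fst (fst z)) (snd (fst z)) (snd z) $ k\<bar> + snd z $ k"
    for z :: "((real^'n^'n) \<times> (real^'n)) \<times> (real^'n)" and k
  have h: "continuous_on K (h k)" for k
    unfolding h_def by (intro continuous_intros)
  have pos: "h k z > 0" if "z \<in> K" for z k
  proof (rule ccontr)
    assume neg: "\<not> h k z > 0"
    obtain A m u where z: "z = ((A, m), u)" by (metis surj_pair)
    have *: "structural \<kappa> A m" "\<And>i. u $ i \<ge> 0" using that by (auto simp: K_def z)
    let ?s = "\<Sum>i\<in>UNIV. max 0 (- defect A m u $ i)"
    have "?s \<ge> 0" by (intro sum_nonneg) auto
    with neg *(2)[of k] have "?s = 0" "defect A m u $ k = 0" "u $ k = 0"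
      unfolding h_def z by auto
    from this(1) have "\<forall>i\<in>UNIV. max 0 (- defect A m u $ i) = 0"
      by (subst (asm) sum_nonneg_eq_0_iff) auto
    then have "defect A m u $ i \<ge> 0" for i by (metis UNIV_I max.cobounded2 neg_le_0_iff_le)
    then show False
      using feasible_strictly_complementary[OF *(1) \<kappa> *(2), of k] \<open>defect A m u $ k = 0\<close> \<open>u $ k = 0\<close> by auto
  qed
  have "\<exists>h0>0. \<forall>z\<in>K. h k z \<ge> h0" for k
  proof (cases "K = {}")
    case True then show ?thesis by (intro exI[of _ 1]) auto
  next
    case False
    then obtain z where "z \<in> K" "\<And>y. y \<in> K \<Longrightarrow> h k z \<le> h k y"
      using continuous_attains_inf[OF K False h] by blast
    then show ?thesis using pos by (intro exI[of _ "h k z"]) auto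
  qed
  then obtain h0 where h0: "\<And>k. h0 k > 0" "\<And>k z. z \<in> K \<Longrightarrow> h k z \<ge> h0 k" by metis
  define \<delta> where "\<delta> = min 1 (Min (range h0) / (?N + 2))"
  have "Min (range h0) > 0" using h0(1) by (subst Min_gr_iff) auto
  then have \<delta>: "\<delta> > 0" "\<delta> \<le> 1" by (auto simp: \<delta>_def)
  have \<delta>h: "\<delta> * (?N + 2) \<le> h0 k" for k
  proof -
    have "\<delta> * (?N + 2) \<le> Min (range h0)"
      by (subst pos_le_divide_eq[symmetric]) (auto simp: \<delta>_def)
    also have "\<dots> \<le> h0 k" by (rule Min_le) auto
    finally show ?thesis .
  qed
  show thesis
  proof (rule that[OF \<delta>], unfold complementarity_gap_def, intro allI impI)
    fix A :: "real^'n^'n" and m u :: "real^'n" and k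
    assume S: "structural \<kappa> A m" and k: "\<bar>defect A m u $ k\<bar> \<le> \<delta>"
      and "\<forall>i. u $ i \<ge> 0" "\<forall>i. defect A m u $ i \<ge> - \<delta>"
    then have u: "\<And>i. u $ i \<ge> 0" and f: "\<And>i. defect A m u $ i \<ge> - \<delta>" by blast+
    have ge: "defect A m u $ i \<ge> - 1" for i using f[of i] \<delta> by simp
    then have "norm u \<le> R" using cR(3)[OF S u] by (meson linorder_not_le nle_le)
    then have "((A, m), u) \<in> K" using S u ge by (auto simp: K_def)
    then have "h0 k \<le> h k ((A, m), u)" by (rule h0)
    also have "(\<Sum>i\<in>UNIV. max 0 (- defect A m u $ i)) \<le> (\<Sum>i\<in>(UNIV::'n set). \<delta>)"
    proof (rule sum_mono)
      fix i show "max 0 (- defect A m u $ i) \<le> \<delta>" using f[of i] \<delta> by auto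
    qed
    then have "h k ((A, m), u) \<le> \<delta> * (?N + 1) + u $ k"
      using k by (simp add: h_def algebra_simps)
    finally show "u $ k \<ge> \<delta>" using \<delta>h[of k] by (simp add: algebra_simps)
  qed
qed

text \<open>If \<open>u\<^sub>i f\<^sub>i = 0\<close> for all \<open>i\<close>, then \<open>f \<ge>
  0\<close>, and \<open>f\<^sub>k \<le> \<delta>\<close> would force \<open>u\<^sub>k \<ge>
  \<delta>\<close>, hence \<open>f\<^sub>k = 0\<close>. So on the compact set where \<open>\<delta>
  / 2 \<le> |f\<^sub>k|\<close> and \<open>f\<^sub>k \<le> \<delta>\<close> some \<open>min
  u\<^sub>i |f\<^sub>i|\<close> is bounded below.\<close>

lemma structural_near_equilibria:
  assumes \<kappa>: "\<kappa> > 0" and \<delta>: "\<delta> > 0" "\<delta> \<le> 1"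
    and gap: "complementarity_gap TYPE('n::finite) \<kappa> \<delta>"
  obtains \<eta> where "\<eta> > 0" "near_equilibria_threshold TYPE('n) \<kappa> \<delta> \<eta>"
proof -
  let ?N = "real CARD('n)"
  obtain c R where cR: "c > 0" "R \<ge> 1"
    "\<And>(A :: real^'n^'n) m u. structural \<kappa> A m \<Longrightarrow> (\<And>i. u $ i \<ge> 0) \<Longrightarrow> norm u \<ge> R \<Longrightarrow>
       \<exists>i. u $ i \<ge> 1 \<and> \<bar>defect A m u $ i\<bar> \<ge> c * norm u \<and> defect A m u $ i < -1"
    using structural_growth[OF \<kappa>] by blast
  define f where "f z i = defect (fst (fst z)) (snd (fst z)) (snd z) $ i"
    for z :: "((real^'n^'n) \<times> (real^'n)) \<times> (real^'n)" and i
  have cf [continuous_intros]: "continuous_on S (\<lambda>z. f z i)" for S i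
    unfolding f_def by (intro continuous_intros)
  define K where "K k = ({z :: (real^'n^'n) \<times> (real^'n). structural \<kappa> (fst z) (snd z)} \<times> cball 0 R) \<inter>
     {z. (\<forall>i. snd z $ i \<ge> 0) \<and> \<delta> / 2 \<le> \<bar>f z k\<bar> \<and> f z k \<le> \<delta>}" for k
  have "closed {z. (\<forall>i. snd z $ i \<ge> 0) \<and> \<delta> / 2 \<le> \<bar>f z k\<bar> \<and> f z k \<le> \<delta>}" for k
    by (intro closed_Collect_conj closed_Collect_all closed_Collect_le continuous_intros)
  then have K: "compact (K k)" for k
    unfolding K_def by (intro compact_Int_closed compact_Times compact_structural \<kappa> compact_cball)
  define h where "h z = (\<Sum>i\<in>UNIV. min (snd z $ i) \<bar>f z i\<bar>)" for z
  have h: "continuous_on S h" for S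
    unfolding h_def by (intro continuous_intros)
  have pos: "h z > 0" if "z \<in> K k" for z k
  proof (rule ccontr)
    assume neg: "\<not> h z > 0"
    obtain A m u where z: "z = ((A, m), u)" by (metis surj_pair)
    have *: "structural \<kappa> A m" "\<And>i. u $ i \<ge> 0" "\<delta> / 2 \<le> \<bar>defect A m u $ k\<bar>" "defect A m u $ k \<le> \<delta>"
      using that by (auto simp: K_def z f_def)
    have "h z = 0"
      using neg *(2) by (metis (no_types, lifting) abs_ge_zero fst_conv h_def less_eq_real_def min.boundedI sndI sum_nonneg z)
    then have "\<forall>i\<in>UNIV. min (u $ i) \<bar>defect A m u $ i\<bar> = 0"
      using *(2) unfolding h_def z f_def by (subst (asm) sum_nonneg_eq_0_iff) auto
    then have c0: "u $ i * defect A m u $ i = 0" for i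
      by (metis UNIV_I abs_eq_0 min_def mult_eq_0_iff)
    have nn: "defect A m u $ i \<ge> 0" for i
      using complementary_imp_defect_nonneg[OF *(1) \<kappa> c0] .
    have "\<forall>i. defect A m u $ i \<ge> - \<delta>" "\<bar>defect A m u $ k\<bar> \<le> \<delta>"
      using nn *(4) \<delta> by (auto intro: order_trans[of _ 0])
    then have "u $ k \<ge> \<delta>"
      using gap *(1,2) unfolding complementarity_gap_def by blast
    with c0[of k] *(3) \<delta> show False by auto
  qed
  have "\<exists>h0>0. \<forall>z\<in>K k. h z \<ge> h0" for k
  proof (cases "K k = {}")
    case True then show ?thesis by (intro exI[of _ 1]) auto
  next
    case False
    then obtain z where "z \<in> K k" "\<And>y. y \<in> K k \<Longrightarrow> h z \<le> h y"
      using continuous_attains_inf[OF K False h] by blast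
    then show ?thesis using pos by (intro exI[of _ "h z"]) auto
  qed
  then obtain h0 where h0: "\<And>k. h0 k > 0" "\<And>k z. z \<in> K k \<Longrightarrow> h z \<ge> h0 k" by metis
  define \<eta> where "\<eta> = min 1 (Min (range h0) / ?N)"
  have "Min (range h0) > 0" using h0(1) by (subst Min_gr_iff) auto
  then have \<eta>: "\<eta> > 0" "\<eta> \<le> 1" by (auto simp: \<eta>_def)
  have \<eta>h: "\<eta> * ?N \<le> h0 k" for k
  proof -
    have "\<eta> * ?N \<le> Min (range h0)"
      by (subst pos_le_divide_eq[symmetric]) (auto simp: \<eta>_def)
    also have "\<dots> \<le> h0 k" by (rule Min_le) auto
    finally show ?thesis .
  qed
  show thesis
  proof (rule that[OF \<eta>(1)], unfold near_equilibria_threshold_def, intro allI impI, rule ccontr)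
    fix A :: "real^'n^'n" and m u :: "real^'n" and k
    assume S: "structural \<kappa> A m" and neg: "\<not> (\<bar>defect A m u $ k\<bar> < \<delta> / 2 \<or> defect A m u $ k > \<delta>)"
      and "\<forall>i. u $ i \<ge> 0" "\<forall>i. u $ i < \<eta> \<or> \<bar>defect A m u $ i\<bar> < \<eta>"
    then have u: "\<And>i. u $ i \<ge> 0" and f: "\<And>i. u $ i < \<eta> \<or> \<bar>defect A m u $ i\<bar> < \<eta>" by blast+
    have "norm u \<le> R"
    proof (rule ccontr)
      assume "\<not> norm u \<le> R"
      then obtain i where "u $ i \<ge> 1" "defect A m u $ i < -1" using cR(3)[OF S u] by force
      then show False using f[of i] \<eta> by auto
    qed
    then have "((A, m), u) \<in> K k" using S u neg by (auto simp: K_def f_def)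
    then have "h0 k \<le> h ((A, m), u)" by (rule h0)
    also have "\<dots> < (\<Sum>i\<in>(UNIV::'n set). \<eta>)"
      unfolding h_def f_def using f by (intro sum_strict_mono) (auto simp: min_less_iff_disj)
    also have "\<dots> = \<eta> * ?N" by simp
    finally show False using \<eta>h[of k] by simp
  qed
qed

section \<open>Mollification\<close>

lemma nn_integral_lborel_translate:
  fixes f :: "'a::euclidean_space \<Rightarrow> ennreal"
  assumes [measurable]: "f \<in> borel_measurable borel"
  shows "(\<integral>\<^sup>+x. f (x + y) \<partial>lborel) = (\<integral>\<^sup>+x. f x \<partial>lborel)"
proof -
  have "(\<integral>\<^sup>+x. f x \<partial>lborel) = (\<integral>\<^sup>+x. f x \<partial>(distr lborel borel ((+) y)))"
    by (simp add: lborel_distr_plus)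
  also have "\<dots> = (\<integral>\<^sup>+x. f (y + x) \<partial>lborel)"
    by (rule nn_integral_distr) auto
  finally show ?thesis by (simp add: add.commute)
qed

lemma compact_open_approximation:
  fixes A :: "'a::euclidean_space set"
  assumes A: "A \<in> sets borel" "emeasure lborel A < \<infinity>" and e: "(e::real) > 0"
  obtains K U where "compact K" "open U" "K \<subseteq> A" "A \<subseteq> U" "emeasure lborel (U - K) < ennreal e"
proof -
  have AL: "A \<in> sets lebesgue" using A by simp
  obtain U where U: "open U" "A \<subseteq> U" "U - A \<in> lmeasurable" "emeasure lebesgue (U - A) < ennreal (e / 3)"
    using sets_lebesgue_outer_open[OF AL, of "e / 3"] e by auto
  obtain T where T: "closed T" "T \<subseteq> A" "A - T \<in> lmeasurable" "emeasure lebesgue (A - T) < ennreal (e / 3)"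
    using sets_lebesgue_inner_closed[OF AL, of "e / 3"] e by auto
  have TB: "T - cball 0 (real n) \<in> sets lborel" for n using T by auto
  have "(\<lambda>n. emeasure lborel (T - cball 0 (real n))) \<longlonglongrightarrow> emeasure lborel (\<Inter>n. T - cball 0 (real n))"
  proof (rule Lim_emeasure_decseq)
    show "decseq (\<lambda>n. T - cball 0 (real n))"
      by (auto simp: decseq_def)
    have "emeasure lborel (T - cball 0 (real n)) \<le> emeasure lborel A" for n
      using T A by (intro emeasure_mono) auto
    then show "emeasure lborel (T - cball 0 (real n)) \<noteq> \<infinity>" for n
      using A(2) by (metis infinity_ennreal_def not_le)
  qed (use TB in auto)
  also have "(\<Inter>n. T - cball 0 (real n)) = {}"
    using real_arch_simple by (force simp: dist_norm)
  finally have "(\<lambda>n. emeasure lborel (T - cball 0 (real n))) \<longlonglongrightarrow> 0" by simp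
  then have "\<forall>\<^sub>F n in sequentially. emeasure lborel (T - cball 0 (real n)) < ennreal (e / 3)"
    using e by (intro order_tendstoD(2)) auto
  then obtain n where n: "emeasure lborel (T - cball 0 (real n)) < ennreal (e / 3)"
    by (auto simp: eventually_sequentially)
  let ?K = "T \<inter> cball 0 (real n)"
  show thesis
  proof (rule that[of ?K U])
    have "U - ?K \<subseteq> (U - A) \<union> (A - T) \<union> (T - cball 0 (real n))" by auto
    then have "emeasure lborel (U - ?K) \<le> emeasure lborel ((U - A) \<union> (A - T) \<union> (T - cball 0 (real n)))"
      using U T A TB by (intro emeasure_mono) auto
    also have "\<dots> \<le> emeasure lborel (U - A) + emeasure lborel (A - T) + emeasure lborel (T - cball 0 (real n))"
      using U T A TB by (intro order_trans[OF emeasure_subadditive] add_mono emeasure_subadditive) auto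
    also have "\<dots> < ennreal (e / 3) + ennreal (e / 3) + ennreal (e / 3)"
      using U T A n by (intro add_strict_mono) (auto simp: emeasure_completion)
    also have "\<dots> = ennreal e" using e by (simp flip: ennreal_plus)
    finally show "emeasure lborel (U - ?K) < ennreal e" .
  qed (use U T in \<open>auto intro!: closed_Int_compact\<close>)
qed

text \<open>For an indicator function, a compact set inside and an open set outside, with a
  difference of small measure, have positive distance; shifts by less than this distance change the
  indicator only on the difference set and its shift. Linearity and density do the rest.\<close>

lemma L1_translation_continuity:
  fixes F :: "'a::euclidean_space \<Rightarrow> 'b::{banach, second_countable_topology}"
  assumes "integrable lborel F" "(e::real) > 0"
  shows "\<exists>d>0. \<forall>y. norm y < d \<longrightarrow> (\<integral>\<^sup>+x. norm (F (x + y) - F x) \<partial>lborel) < ennreal e"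
  using assms
proof (induction arbitrary: e rule: integrable_induct)
  case (base A c)
  define e' where "e' = e / (norm c + 1) / 2"
  have e': "e' > 0" using base by (auto simp: e'_def intro!: divide_pos_pos add_nonneg_pos)
  \<comment> \<open>the factor 2 (norm c + 1) makes room for both shifts and avoids dividing by 0\<close>
  obtain K U where KU: "compact K" "open U" "K \<subseteq> A" "A \<subseteq> U" "emeasure lborel (U - K) < ennreal e'"
    using compact_open_approximation[of A e'] base e' by auto
  obtain d where d: "d > 0" "(\<Union>x\<in>K. ball x d) \<subseteq> U"
    using compact_subset_open_imp_ball_epsilon_subset[of K U] KU by auto
  show ?case
  proof (intro exI conjI allI impI)
    fix y :: 'a assume y: "norm y < d"
    have [measurable]: "U - K \<in> sets borel" using KU by (intro sets.Diff borel_open borel_closed compact_imp_closed)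
    have 1: "x + y \<in> U" if "x \<in> K" for x using d y that by (force simp: dist_norm)
    have 2: "x \<in> U" if "x + y \<in> K" for x using d y that by (force simp: dist_norm)
    have "ennreal (norm (indicat_real A (x + y) *\<^sub>R c - indicat_real A x *\<^sub>R c))
        \<le> ennreal (norm c) * (indicator (U - K) (x + y) + indicator (U - K) x)" for x
      using 1[of x] 2[of x] KU mult_left_mono[of 1 2 "ennreal (norm c)"] by (auto simp: indicator_def)
    then have "(\<integral>\<^sup>+x. norm (indicat_real A (x + y) *\<^sub>R c - indicat_real A x *\<^sub>R c) \<partial>lborel)
       \<le> (\<integral>\<^sup>+x. ennreal (norm c) * (indicator (U - K) (x + y) + indicator (U - K) x) \<partial>lborel)"
      by (intro nn_integral_mono)
    also have "\<dots> = ennreal (norm c) * ((\<integral>\<^sup>+x. indicator (U - K) (x + y) \<partial>lborel) + (\<integral>\<^sup>+x. indicator (U - K) x \<partial>lborel))"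
      by (simp add: nn_integral_cmult nn_integral_add)
    also have "\<dots> = ennreal (norm c) * (emeasure lborel (U - K) + emeasure lborel (U - K))"
      by (subst nn_integral_lborel_translate) auto
    also have "\<dots> \<le> ennreal (norm c) * (ennreal e' + ennreal e')"
      using KU by (intro mult_left_mono add_mono) auto
    also have "\<dots> = ennreal (norm c * (2 * e'))"
      using e' by (simp flip: ennreal_plus ennreal_mult)
    also have "\<dots> < ennreal e"
    proof (rule ennreal_lessI)
      have "2 * (a / 2) = a" for a :: real by simp
      then have "2 * e' = e / (norm c + 1)" unfolding e'_def .
      then have "norm c * (2 * e') = e * (norm c / (norm c + 1))" by simp
      also have "\<dots> < e * 1" using base
        by (intro mult_strict_left_mono divide_less_eq_1_pos[THEN iffD2]) (auto intro: add_nonneg_pos)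
      finally show "norm c * (2 * e') < e" by simp
    qed (use base in auto)
    finally show "(\<integral>\<^sup>+x. norm (indicat_real A (x + y) *\<^sub>R c - indicat_real A x *\<^sub>R c) \<partial>lborel) < ennreal e" .
  qed (use d in auto)
next
  case (add f g)
  have [measurable]: "f \<in> borel_measurable borel" "g \<in> borel_measurable borel"
    using add.hyps by (auto dest: borel_measurable_integrable)
  obtain d1 where d1: "d1 > 0" "\<And>y. norm y < d1 \<Longrightarrow> (\<integral>\<^sup>+x. norm (f (x + y) - f x) \<partial>lborel) < ennreal (e/2)"
    using add.IH(1)[of "e / 2"] add.prems by auto
  obtain d2 where d2: "d2 > 0" "\<And>y. norm y < d2 \<Longrightarrow> (\<integral>\<^sup>+x. norm (g (x + y) - g x) \<partial>lborel) < ennreal (e/2)"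
    using add.IH(2)[of "e / 2"] add.prems by auto
  show ?case
  proof (intro exI[of _ "min d1 d2"] conjI allI impI)
    fix y :: 'a assume y: "norm y < min d1 d2"
    have "(\<integral>\<^sup>+x. norm (f (x + y) + g (x + y) - (f x + g x)) \<partial>lborel)
       \<le> (\<integral>\<^sup>+x. ennreal (norm (f (x + y) - f x)) + ennreal (norm (g (x + y) - g x)) \<partial>lborel)"
      by (intro nn_integral_mono) (auto simp flip: ennreal_plus simp: norm_diff_triangle_ineq algebra_simps)
    also have "\<dots> = (\<integral>\<^sup>+x. norm (f (x + y) - f x) \<partial>lborel) + (\<integral>\<^sup>+x. norm (g (x + y) - g x) \<partial>lborel)"
      by (rule nn_integral_add) auto
    also have "\<dots> < ennreal (e/2) + ennreal (e/2)"
      using d1 d2 y by (intro add_strict_mono) auto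
    also have "\<dots> = ennreal e" using add.prems by (simp flip: ennreal_plus)
    finally show "(\<integral>\<^sup>+x. norm (f (x + y) + g (x + y) - (f x + g x)) \<partial>lborel) < ennreal e" .
  qed (use d1 d2 in auto)
next
  case (lim f s)
  have [measurable]: "f \<in> borel_measurable borel" "s i \<in> borel_measurable borel" for i
    using lim.hyps by (auto dest: borel_measurable_integrable)
  have "(\<lambda>i. \<integral>\<^sup>+x. norm (f x - s i x) \<partial>lborel) \<longlonglongrightarrow> 0"
  proof (rule nn_integral_dominated_convergence_norm)
    show "AE x in lborel. norm (s i x) \<le> 2 * norm (f x)" for i using lim.hyps by auto
    show "(\<integral>\<^sup>+ x. ennreal (2 * norm (f x)) \<partial>lborel) < \<infinity>"
      using lim.hyps by (simp add: ennreal_mult nn_integral_cmult ennreal_mult_less_top integrable_iff_bounded)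
  qed (use lim.hyps in auto)
  then have "\<forall>\<^sub>F i in sequentially. (\<integral>\<^sup>+x. norm (f x - s i x) \<partial>lborel) < ennreal (e / 3)"
    using lim.prems by (intro order_tendstoD(2)) auto
  then obtain i where i: "(\<integral>\<^sup>+x. norm (f x - s i x) \<partial>lborel) < ennreal (e / 3)"
    by (auto simp: eventually_sequentially)
  obtain d where d: "d > 0" "\<And>y. norm y < d \<Longrightarrow> (\<integral>\<^sup>+x. norm (s i (x + y) - s i x) \<partial>lborel) < ennreal (e/3)"
    using lim.IH[of "e / 3" i] lim.prems by auto
  show ?case
  proof (intro exI[of _ d] conjI allI impI)
    fix y :: 'a assume y: "norm y < d"
    have "norm (f (x + y) - f x) \<le> norm (f (x + y) - s i (x + y)) + norm (s i (x + y) - s i x) + norm (f x - s i x)" for x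
      by (smt (verit) norm_diff_triangle_le norm_minus_commute)
    then have "(\<integral>\<^sup>+x. norm (f (x + y) - f x) \<partial>lborel)
       \<le> (\<integral>\<^sup>+x. ennreal (norm (f (x + y) - s i (x + y))) + ennreal (norm (s i (x + y) - s i x)) + ennreal (norm (f x - s i x)) \<partial>lborel)"
      by (intro nn_integral_mono) (auto simp flip: ennreal_plus)
    also have "\<dots> = (\<integral>\<^sup>+x. norm (f (x + y) - s i (x + y)) \<partial>lborel) + (\<integral>\<^sup>+x. norm (s i (x + y) - s i x) \<partial>lborel) + (\<integral>\<^sup>+x. norm (f x - s i x) \<partial>lborel)"
      by (simp add: nn_integral_add)
    also have "(\<integral>\<^sup>+x. norm (f (x + y) - s i (x + y)) \<partial>lborel) = (\<integral>\<^sup>+x. norm (f x - s i x) \<partial>lborel)"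
      by (rule nn_integral_lborel_translate) auto
    also have "(\<integral>\<^sup>+x. norm (f x - s i x) \<partial>lborel) + (\<integral>\<^sup>+x. norm (s i (x + y) - s i x) \<partial>lborel) + (\<integral>\<^sup>+x. norm (f x - s i x) \<partial>lborel)
       < ennreal (e/3) + ennreal (e/3) + ennreal (e/3)"
      using i d y by (intro add_strict_mono) auto
    also have "\<dots> = ennreal e" using lim.prems by (simp flip: ennreal_plus)
    finally show "(\<integral>\<^sup>+x. norm (f (x + y) - f x) \<partial>lborel) < ennreal e" .
  qed (use d in auto)
qed

text \<open>The constants \<open>B\<close> and \<open>C\<close> bound the kernel with its gradient
  and the second-order remainder. The remainder bound, integrated against an integrable function,
  gives the derivative of the mollified function directly.\<close>

definition mollifier :: "real \<Rightarrow> ('a::euclidean_space \<Rightarrow> real) \<Rightarrow> ('a \<Rightarrow> 'a) \<Rightarrow> real \<Rightarrow> real \<Rightarrow> bool" where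
  "mollifier e \<eta> \<eta>' B C \<longleftrightarrow> continuous_on UNIV \<eta> \<and> continuous_on UNIV \<eta>' \<and> (\<forall>z. \<eta> z \<ge> 0) \<and>
     (\<forall>z. \<bar>\<eta> z\<bar> \<le> B) \<and> (\<forall>z. norm (\<eta>' z) \<le> B) \<and>
     (\<forall>x. (\<eta> has_derivative (\<lambda>h. \<eta>' x \<bullet> h)) (at x)) \<and>
     (\<forall>x h. norm h \<le> 1 \<longrightarrow> \<bar>\<eta> (x + h) - \<eta> x - \<eta>' x \<bullet> h\<bar> \<le> C * (norm h)\<^sup>2) \<and>
     (\<forall>z. norm z \<ge> e \<longrightarrow> \<eta> z = 0) \<and> (\<forall>z. norm z \<ge> e \<longrightarrow> \<eta>' z = 0) \<and>
     integrable lborel \<eta> \<and> (\<integral>z. \<eta> z \<partial>lborel) = 1"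

lemma mollifierD:
  assumes "mollifier e \<eta> \<eta>' B C"
  shows "continuous_on UNIV \<eta>" "continuous_on UNIV \<eta>'" "\<And>z. \<eta> z \<ge> 0"
    "\<And>z. \<bar>\<eta> z\<bar> \<le> B" "\<And>z. norm (\<eta>' z) \<le> B"
    "\<And>x. (\<eta> has_derivative (\<lambda>h. \<eta>' x \<bullet> h)) (at x)"
    "\<And>x h. norm h \<le> 1 \<Longrightarrow> \<bar>\<eta> (x + h) - \<eta> x - \<eta>' x \<bullet> h\<bar> \<le> C * (norm h)\<^sup>2"
    "\<And>z. norm z \<ge> e \<Longrightarrow> \<eta> z = 0" "\<And>z. norm z \<ge> e \<Longrightarrow> \<eta>' z = 0"
    "integrable lborel \<eta>" "(\<integral>z. \<eta> z \<partial>lborel) = 1"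
  using assms unfolding mollifier_def by blast+

definition mollify :: "('a::euclidean_space \<Rightarrow> real) \<Rightarrow> ('a \<Rightarrow> 'b::euclidean_space) \<Rightarrow> 'a \<Rightarrow> 'b" where
  "mollify \<eta> F x = (\<integral>y. \<eta> (y - x) *\<^sub>R F y \<partial>lebesgue)"

lemma lborel_integrable_translate:
  fixes f :: "'a::euclidean_space \<Rightarrow> 'b::{banach, second_countable_topology}"
  assumes "integrable lborel f"
  shows "integrable lborel (\<lambda>x. f (x + y))" "(\<integral>x. f (x + y) \<partial>lborel) = (\<integral>x. f x \<partial>lborel)"
proof -
  have *: "integrable (distr lborel borel ((+) y)) f" using assms by (simp add: lborel_distr_plus)
  have "integrable lborel (\<lambda>x. f (y + x))"
    using * by (rule integrable_distr[rotated]) auto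
  then show "integrable lborel (\<lambda>x. f (x + y))" by (simp add: add.commute)
  have [measurable]: "f \<in> borel_measurable borel" using assms by (auto dest: borel_measurable_integrable)
  have "(\<integral>x. f x \<partial>lborel) = (\<integral>x. f x \<partial>(distr lborel borel ((+) y)))" by (simp add: lborel_distr_plus)
  also have "\<dots> = (\<integral>x. f (y + x) \<partial>lborel)" by (rule integral_distr) auto
  finally show "(\<integral>x. f (x + y) \<partial>lborel) = (\<integral>x. f x \<partial>lborel)" by (simp add: add.commute)
qed

text \<open>The mollified function is an average of translates of \<open>F\<close>, so its distance
  from \<open>F\<close> is at most the largest distance of a translate.\<close>

lemma mollify_L1_bound:
  fixes F :: "'a::euclidean_space \<Rightarrow> 'b::euclidean_space"
  assumes F: "integrable lborel F"
    and mol: "mollifier d \<eta> \<eta>' B C"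
    and tr: "\<And>y. norm y < d \<Longrightarrow> (\<integral>\<^sup>+x. norm (F (x + y) - F x) \<partial>lborel) \<le> e"
  shows "(\<integral>\<^sup>+x. norm (mollify \<eta> F x - F x) \<partial>lborel) \<le> e"
proof -
  note nonneg = mollifierD(3)[OF mol] and bd = mollifierD(4)[OF mol]
    and supp = mollifierD(8)[OF mol] and one = mollifierD(10,11)[OF mol]
  have [measurable]: "\<eta> \<in> borel_measurable borel"
    by (rule borel_measurable_continuous_onI[OF mollifierD(1)[OF mol]])
  have Fm[measurable]: "F \<in> borel_measurable borel" using F by (auto dest: borel_measurable_integrable)
  have int: "integrable lborel (\<lambda>z. \<eta> z *\<^sub>R F (z + x))" for x
  proof (rule Bochner_Integration.integrable_bound)
    show "integrable lborel (\<lambda>z. B *\<^sub>R F (z + x))" using lborel_integrable_translate[OF F] by simp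
    have "\<eta> z * norm (F (z + x)) \<le> \<bar>B\<bar> * norm (F (z + x))" for z
      using bd[of z] nonneg[of z] by (intro mult_right_mono) auto
    then show "AE z in lborel. norm (\<eta> z *\<^sub>R F (z + x)) \<le> norm (B *\<^sub>R F (z + x))" using nonneg by simp
  qed simp
  have eq: "mollify \<eta> F x - F x = (\<integral>z. \<eta> z *\<^sub>R (F (z + x) - F x) \<partial>lborel)" for x
  proof -
    have "mollify \<eta> F x = (\<integral>y. \<eta> (y - x) *\<^sub>R F y \<partial>lborel)"
      unfolding mollify_def by (rule integral_completion) simp
    also have "\<dots> = (\<integral>z. \<eta> ((z + x) - x) *\<^sub>R F (z + x) \<partial>lborel)"
      using lborel_integrable_translate[OF int[of x], of "- x"]
      by (subst lborel_integrable_translate(2)[of _ x]) auto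
    finally have "mollify \<eta> F x = (\<integral>z. \<eta> z *\<^sub>R F (z + x) \<partial>lborel)" by simp
    moreover have "F x = (\<integral>z. \<eta> z *\<^sub>R F x \<partial>lborel)" using one by simp
    ultimately show ?thesis
      using int[of x] one by (simp add: scaleR_diff_right Bochner_Integration.integral_diff)
  qed
  have "(\<integral>\<^sup>+x. norm (mollify \<eta> F x - F x) \<partial>lborel)
      \<le> (\<integral>\<^sup>+x. (\<integral>\<^sup>+z. ennreal (\<eta> z) * norm (F (z + x) - F x) \<partial>lborel) \<partial>lborel)"
  proof (rule nn_integral_mono)
    fix x
    have "integrable lborel (\<lambda>z. \<eta> z *\<^sub>R (F (z + x) - F x))"
      using int[of x] one by (simp add: scaleR_diff_right)
    then have "ennreal (norm (mollify \<eta> F x - F x)) \<le> (\<integral>\<^sup>+z. norm (\<eta> z *\<^sub>R (F (z + x) - F x)) \<partial>lborel)"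
      unfolding eq by (rule integral_norm_bound_ennreal)
    also have "\<dots> = (\<integral>\<^sup>+z. ennreal (\<eta> z) * norm (F (z + x) - F x) \<partial>lborel)"
      using nonneg by (simp add: ennreal_mult)
    finally show "ennreal (norm (mollify \<eta> F x - F x)) \<le> (\<integral>\<^sup>+z. ennreal (\<eta> z) * norm (F (z + x) - F x) \<partial>lborel)" .
  qed
  also have "\<dots> = (\<integral>\<^sup>+z. (\<integral>\<^sup>+x. ennreal (\<eta> z) * norm (F (z + x) - F x) \<partial>lborel) \<partial>lborel)"
    by (rule lborel_pair.Fubini') simp
  also have "\<dots> = (\<integral>\<^sup>+z. ennreal (\<eta> z) * (\<integral>\<^sup>+x. norm (F (x + z) - F x) \<partial>lborel) \<partial>lborel)"
    by (simp add: nn_integral_cmult add.commute)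
  also have "\<dots> \<le> (\<integral>\<^sup>+z. ennreal (\<eta> z) * e \<partial>lborel)"
  proof (rule nn_integral_mono)
    fix z show "ennreal (\<eta> z) * (\<integral>\<^sup>+x. norm (F (x + z) - F x) \<partial>lborel) \<le> ennreal (\<eta> z) * e"
      using supp[of z] tr[of z] by (cases "norm z < d") (auto intro: mult_left_mono)
  qed
  also have "\<dots> = (\<integral>\<^sup>+z. ennreal (\<eta> z) \<partial>lborel) * e"
    by (rule nn_integral_multc) simp
  also have "(\<integral>\<^sup>+z. ennreal (\<eta> z) \<partial>lborel) = 1"
    using nn_integral_eq_integral[OF one(1)] nonneg one(2) by simp
  finally show ?thesis by simp
qed

lemma lebesgue_ex_borel:
  fixes F :: "'a::euclidean_space \<Rightarrow> 'b::euclidean_space"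
  assumes "F \<in> borel_measurable lebesgue"
  obtains F0 where "F0 \<in> borel_measurable borel" "AE x in lebesgue. F x = F0 x"
proof -
  have "\<exists>g. g \<in> borel_measurable lborel \<and> (AE x in lborel. F x \<bullet> b = g x)" for b
    using completion_ex_borel_measurable_real[of "\<lambda>x. F x \<bullet> b" lborel] assms by auto
  then obtain g where g: "\<And>b. g b \<in> borel_measurable lborel" "\<And>b. AE x in lborel. F x \<bullet> b = g b x"
    by metis
  show thesis
  proof (rule that[of "\<lambda>x. \<Sum>b\<in>Basis. g b x *\<^sub>R b"])
    show "(\<lambda>x. \<Sum>b\<in>Basis. g b x *\<^sub>R b) \<in> borel_measurable borel" using g(1) by simp
    have "AE x in lborel. \<forall>b\<in>Basis. F x \<bullet> b = g b x"
      using g(2) by (intro AE_finite_allI) auto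
    then have "AE x in lborel. F x = (\<Sum>b\<in>Basis. g b x *\<^sub>R b)"
      by eventually_elim (metis (mono_tags, lifting) euclidean_representation sum.cong)
    then show "AE x in lebesgue. F x = (\<Sum>b\<in>Basis. g b x *\<^sub>R b)" by (rule AE_completion)
  qed
qed

lemma mollify_tendsto_L1:
  fixes F :: "'a::euclidean_space \<Rightarrow> 'b::euclidean_space"
  assumes F: "integrable lebesgue F"
    and mol: "\<And>n. mollifier (d n) (\<eta> n) (\<eta>' n) (B n) (C n)" and d: "d \<longlonglongrightarrow> 0"
  shows "(\<lambda>n. \<integral>\<^sup>+x. norm (mollify (\<eta> n) F x - F x) \<partial>lebesgue) \<longlonglongrightarrow> 0"
proof -
  have \<eta>[measurable]: "\<eta> n \<in> borel_measurable borel" for n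
    by (rule borel_measurable_continuous_onI[OF mollifierD(1)[OF mol]])
  obtain F0 where F0[measurable]: "F0 \<in> borel_measurable borel" and ae: "AE x in lebesgue. F x = F0 x"
    using lebesgue_ex_borel borel_measurable_integrable[OF F] by blast
  have [measurable]: "F \<in> borel_measurable lebesgue" using F by auto
  have "integrable lebesgue F0"
    using F ae integrable_cong_AE[of F lebesgue F0] by (simp add: measurable_completion)
  then have F0i: "integrable lborel F0" by (simp add: integrable_completion)
  have eq: "mollify \<theta> F = mollify \<theta> F0" if [measurable]: "\<theta> \<in> borel_measurable borel" for \<theta>
  proof
    fix x
    have [measurable]: "(\<lambda>y. \<theta> (y - x)) \<in> borel_measurable lebesgue" "F0 \<in> borel_measurable lebesgue"
      by (auto intro!: measurable_completion)
    show "mollify \<theta> F x = mollify \<theta> F0 x"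
      unfolding mollify_def using ae by (intro integral_cong_AE) auto
  qed
  have "(\<integral>\<^sup>+x. norm (mollify (\<eta> n) F x - F x) \<partial>lebesgue) = (\<integral>\<^sup>+x. norm (mollify (\<eta> n) F0 x - F0 x) \<partial>lborel)" for n
  proof -
    have "(\<integral>\<^sup>+x. norm (mollify (\<eta> n) F x - F x) \<partial>lebesgue) = (\<integral>\<^sup>+x. norm (mollify (\<eta> n) F0 x - F0 x) \<partial>lebesgue)"
      unfolding eq[OF \<eta>] using ae by (intro nn_integral_cong_AE) auto
    then show ?thesis by (simp add: nn_integral_completion)
  qed
  moreover have "(\<lambda>n. \<integral>\<^sup>+x. norm (mollify (\<eta> n) F0 x - F0 x) \<partial>lborel) \<longlonglongrightarrow> 0"
  proof (rule order_tendstoI)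
    fix a :: ennreal assume "0 < a"
    then obtain e :: real where e: "e > 0" "ennreal e < a"
      by (metis dense ennreal_cases ennreal_less_zero_iff infinity_ennreal_def less_top not_less_zero order.strict_trans top.not_eq_extremum)
    obtain r where r: "r > 0" "\<And>y. norm y < r \<Longrightarrow> (\<integral>\<^sup>+x. norm (F0 (x + y) - F0 x) \<partial>lborel) < ennreal e"
      using L1_translation_continuity[OF F0i e(1)] by blast
    have "\<forall>\<^sub>F n in sequentially. d n < r" using order_tendstoD(2)[OF d r(1)] .
    then show "\<forall>\<^sub>F n in sequentially. (\<integral>\<^sup>+x. norm (mollify (\<eta> n) F0 x - F0 x) \<partial>lborel) < a"
    proof eventually_elim
      case (elim n)
      have "(\<integral>\<^sup>+x. norm (mollify (\<eta> n) F0 x - F0 x) \<partial>lborel) \<le> ennreal e"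
        by (rule mollify_L1_bound[OF F0i mol]) (use r elim in \<open>auto intro!: less_imp_le\<close>)
      then show ?case using e by simp
    qed
  qed auto
  ultimately show ?thesis by simp
qed

lemma has_derivative_quadratic_remainder:
  fixes f :: "'a::real_normed_vector \<Rightarrow> 'b::real_normed_vector"
  assumes "bounded_linear D" and "\<And>h. norm h \<le> 1 \<Longrightarrow> norm (f (x + h) - f x - D h) \<le> C * (norm h)\<^sup>2"
  shows "(f has_derivative D) (at x)"
proof -
  have C: "C * (norm h)\<^sup>2 / norm h = C * norm h" for h :: 'a by (simp add: power2_eq_square)
  have "((\<lambda>h. norm (f (x + h) - f x - D h) / norm h) \<longlongrightarrow> 0) (at 0)"
  proof (rule tendsto_sandwich[of "\<lambda>_. 0" _ _ "\<lambda>h. C * norm h"])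
    have "\<forall>\<^sub>F h in at (0::'a). norm h < 1"
      unfolding eventually_at by (intro exI[of _ 1]) auto
    then show "\<forall>\<^sub>F h in at 0. norm (f (x + h) - f x - D h) / norm h \<le> C * norm h"
    proof eventually_elim
      case (elim h)
      then have "norm (f (x + h) - f x - D h) / norm h \<le> C * (norm h)\<^sup>2 / norm h"
        by (intro divide_right_mono assms(2)) auto
      then show ?case by (simp add: C)
    qed
    show "((\<lambda>h. C * norm h) \<longlongrightarrow> 0) (at 0)" by (auto intro!: tendsto_eq_intros)
  qed auto
  then show ?thesis using assms(1) by (simp add: has_derivative_at)
qed

lemma pos_part_square_remainder:
  fixes s t :: real
  shows "\<bar>(max 0 (s + t))\<^sup>2 - (max 0 s)\<^sup>2 - 2 * max 0 s * t\<bar> \<le> t\<^sup>2"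
proof (cases "s \<le> 0")
  case True
  then have "max 0 (s + t) \<le> \<bar>t\<bar>" by auto
  then have "(max 0 (s + t))\<^sup>2 \<le> \<bar>t\<bar>\<^sup>2" by (intro power_mono) auto
  then show ?thesis using True by simp
next
  case s: False
  show ?thesis
  proof (cases "s + t \<ge> 0")
    case True
    then show ?thesis using s by (simp add: power2_eq_square algebra_simps)
  next
    case False
    have "t\<^sup>2 - (- s\<^sup>2 - 2 * s * t) = (s + t)\<^sup>2" "(- s\<^sup>2 - 2 * s * t) = - s * (s + t) - s * t"
      by (simp_all add: power2_eq_square algebra_simps)
    moreover have "- s * (s + t) \<ge> 0" "- s * t \<ge> 0" using False s by (auto simp: mult_nonneg_nonpos)
    ultimately show ?thesis using False s by (simp add: abs_le_iff) (smt (verit) zero_le_power2 minus_mult_left)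
  qed
qed

text \<open>The squared positive part is continuously differentiable with Lipschitz gradient, which
  is all the smoothness that a kernel for \<open>C\<^sup>1\<close> test functions needs.\<close>

definition bump :: "real \<Rightarrow> 'a::euclidean_space \<Rightarrow> real" where
  "bump e x = (max 0 (e\<^sup>2 - x \<bullet> x))\<^sup>2"

definition bump_grad :: "real \<Rightarrow> 'a::euclidean_space \<Rightarrow> 'a" where
  "bump_grad e x = - (4 * max 0 (e\<^sup>2 - x \<bullet> x)) *\<^sub>R x"

lemma bump_remainder:
  fixes x h :: "'a::euclidean_space"
  assumes e: "e > 0" and h: "norm h \<le> 1"
  shows "\<bar>bump e (x + h) - bump e x - bump_grad e x \<bullet> h\<bar> \<le> ((2 * e + 3)\<^sup>2 + 2 * e\<^sup>2) * (norm h)\<^sup>2"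
proof (cases "norm x \<le> e + 1")
  case True
  define s where "s = e\<^sup>2 - x \<bullet> x"
  define t where "t = - 2 * (x \<bullet> h) - h \<bullet> h"
  have st: "e\<^sup>2 - (x + h) \<bullet> (x + h) = s + t"
    by (simp add: s_def t_def inner_add inner_commute algebra_simps)
  note 1 = pos_part_square_remainder[of s t]
  have t: "\<bar>t\<bar> \<le> (2 * e + 3) * norm h"
  proof -
    have "\<bar>t\<bar> \<le> 2 * (norm x * norm h) + norm h * norm h"
      using Cauchy_Schwarz_ineq2[of x h] Cauchy_Schwarz_ineq2[of h h] inner_ge_zero[of h]
      unfolding t_def by linarith
    also have "\<dots> \<le> 2 * ((e + 1) * norm h) + 1 * norm h"
      using True h by (intro add_mono mult_left_mono mult_right_mono) auto
    finally show ?thesis by (simp add: algebra_simps)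
  qed
  then have "t\<^sup>2 \<le> ((2 * e + 3) * norm h)\<^sup>2"
    by (metis abs_ge_zero power2_abs power_mono)
  then have t2: "t\<^sup>2 \<le> (2 * e + 3)\<^sup>2 * (norm h)\<^sup>2" by (simp add: power_mult_distrib)
  have "max 0 s \<le> e\<^sup>2" by (simp add: s_def)
  then have s2: "2 * max 0 s * (h \<bullet> h) \<le> 2 * e\<^sup>2 * (norm h)\<^sup>2"
    unfolding power2_norm_eq_inner by (intro mult_right_mono) auto
  have "bump e (x + h) - bump e x - bump_grad e x \<bullet> h
    = ((max 0 (s + t))\<^sup>2 - (max 0 s)\<^sup>2 - 2 * max 0 s * t) - 2 * max 0 s * (h \<bullet> h)"
    unfolding bump_def bump_grad_def st s_def[symmetric] by (simp add: t_def algebra_simps)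
  moreover have "2 * max 0 s * (h \<bullet> h) \<ge> 0" by auto
  ultimately show ?thesis using 1 t2 s2 unfolding distrib_right by linarith
next
  case False
  have sq: "e\<^sup>2 \<le> y \<bullet> y" if "norm y \<ge> e" for y :: 'a
    using that e unfolding power2_norm_eq_inner[symmetric] by (intro power_mono) auto
  have "norm (x + h) \<ge> e" using False h norm_triangle_ineq2[of x "- h"] by simp
  then show ?thesis using False sq[of x] sq[of "x + h"] by (simp add: bump_def bump_grad_def)
qed

lemma bump_has_derivative: "e > 0 \<Longrightarrow> (bump e has_derivative (\<lambda>h. bump_grad e x \<bullet> h)) (at x)"
  by (rule has_derivative_quadratic_remainder[OF bounded_linear_inner_right]) (simp, rule bump_remainder)

lemma continuous_on_bump [continuous_intros]: "continuous_on S (bump e)"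
  unfolding bump_def by (intro continuous_intros)

lemma continuous_on_bump_grad [continuous_intros]: "continuous_on S (bump_grad e)"
  unfolding bump_grad_def by (intro continuous_intros)

lemma bump_zero:
  assumes "norm x \<ge> e" "e > 0"
  shows "bump e x = 0" "bump_grad e x = 0"
proof -
  have "e\<^sup>2 \<le> x \<bullet> x"
    using assms unfolding power2_norm_eq_inner[symmetric] by (intro power_mono) auto
  then show "bump e x = 0" "bump_grad e x = 0" by (auto simp: bump_def bump_grad_def)
qed

lemma bump_bounds: "0 \<le> bump e x" "bump e x \<le> (e\<^sup>2)\<^sup>2"
proof -
  have "max 0 (e\<^sup>2 - x \<bullet> x) \<le> e\<^sup>2" by simp
  then show "0 \<le> bump e x" "bump e x \<le> (e\<^sup>2)\<^sup>2"
    unfolding bump_def by (simp, intro power_mono) auto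
qed

lemma bump_grad_bound:
  assumes "e > 0" shows "norm (bump_grad e x) \<le> 4 * e\<^sup>2 * e"
proof (cases "norm x \<le> e")
  case True
  have "norm (bump_grad e x) = 4 * max 0 (e\<^sup>2 - x \<bullet> x) * norm x" by (simp add: bump_grad_def)
  also have "\<dots> \<le> 4 * e\<^sup>2 * e" using True assms by (intro mult_mono) auto
  finally show ?thesis .
qed (use assms bump_zero(2)[of e x] in auto)

lemma bump_integral:
  assumes e: "e > 0"
  shows "integrable lborel (bump e :: 'a::euclidean_space \<Rightarrow> real)" "(\<integral>x. bump e (x::'a) \<partial>lborel) > 0"
proof -
  have m[measurable]: "(bump e :: 'a \<Rightarrow> real) \<in> borel_measurable borel"
    by (intro borel_measurable_continuous_onI continuous_intros)
  have "integrable lborel (\<lambda>x::'a. indicator (cball 0 e) x *\<^sub>R bump e x)"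
    by (intro borel_integrable_compact continuous_intros) auto
  moreover have "(\<lambda>x::'a. indicator (cball 0 e) x *\<^sub>R bump e x) = bump e"
    using bump_zero[OF _ e] by (force simp: indicator_def)
  ultimately show i: "integrable lborel (bump e :: 'a \<Rightarrow> real)" by simp
  let ?b = "(3 / 4 * e\<^sup>2)\<^sup>2"
  have le: "indicator (ball 0 (e / 2)) x *\<^sub>R ?b \<le> bump e x" for x :: 'a
  proof (cases "x \<in> ball 0 (e / 2)")
    case True
    then have "x \<bullet> x \<le> (e / 2)\<^sup>2"
      unfolding power2_norm_eq_inner[symmetric] by (intro power_mono) auto
    then have "3 / 4 * e\<^sup>2 \<le> e\<^sup>2 - x \<bullet> x" by (simp add: power2_eq_square)
    then have "3 / 4 * e\<^sup>2 \<le> max 0 (e\<^sup>2 - x \<bullet> x)"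
      using max.cobounded2[of "e\<^sup>2 - x \<bullet> x" 0] by linarith
    then have "?b \<le> bump e x" unfolding bump_def by (intro power_mono) auto
    then show ?thesis using True by simp
  qed (simp add: bump_bounds)
  have "0 < measure lborel (ball (0::'a) (e / 2)) * ?b"
    using e content_ball_pos[of "e / 2" "0::'a"] by auto
  also have "\<dots> = (\<integral>x. indicator (ball (0::'a) (e / 2)) x *\<^sub>R ?b \<partial>lborel)"
    using emeasure_bounded_finite[OF bounded_ball[of "0::'a" "e / 2"]] by simp
  also have "\<dots> \<le> (\<integral>x. bump e (x::'a) \<partial>lborel)"
    using i le emeasure_bounded_finite[OF bounded_ball[of "0::'a" "e / 2"]]
    by (intro integral_mono integrable_scaleR_left integrable_real_indicator) auto
  finally show "(\<integral>x. bump e (x::'a) \<partial>lborel) > 0" .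
qed

lemma mollify_has_derivative:
  fixes F :: "'a::euclidean_space \<Rightarrow> 'b::euclidean_space"
  assumes F: "integrable lebesgue F"
    and mol: "mollifier e \<eta> \<eta>' B C"
  shows "(mollify \<eta> F has_derivative (\<lambda>h. - (\<integral>y. (\<eta>' (y - x) \<bullet> h) *\<^sub>R F y \<partial>lebesgue))) (at x)"
    and "norm (\<integral>y. (\<eta>' (y - x) \<bullet> h) *\<^sub>R F y \<partial>lebesgue) \<le> B * (\<integral>y. norm (F y) \<partial>lebesgue) * norm h"
proof -
  note c = mollifierD(1,2)[OF mol] and bd = mollifierD(4,5)[OF mol] and rem = mollifierD(7)[OF mol]
  have Fm[measurable]: "F \<in> borel_measurable lebesgue" using F by auto
  have [measurable]: "(\<lambda>y. \<eta> (y - x)) \<in> borel_measurable lebesgue" for x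
    by (rule measurable_completion, simp) (intro borel_measurable_continuous_onI continuous_on_compose2[OF c(1)] continuous_intros, auto)
  have m2[measurable]: "(\<lambda>y. \<eta>' (y - x)) \<in> borel_measurable lebesgue" for x
    by (rule measurable_completion, simp) (intro borel_measurable_continuous_onI continuous_on_compose2[OF c(2)] continuous_intros, auto)
  have nF: "integrable lebesgue (\<lambda>y. norm (F y))" using F by simp
  have i1: "integrable lebesgue (\<lambda>y. \<eta> (y - x) *\<^sub>R F y)" for x
    using bd(1) by (intro Bochner_Integration.integrable_bound[OF integrable_mult_right[OF nF, of B]])
      (auto intro!: mult_right_mono order_trans[OF _ abs_ge_self] AE_I2)
  have ip: "\<bar>\<eta>' z \<bullet> h\<bar> \<le> B * norm h" for z h
    using Cauchy_Schwarz_ineq2[of "\<eta>' z" h] mult_right_mono[OF bd(2)[of z], of "norm h"] by simp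
  have i2: "integrable lebesgue (\<lambda>y. (\<eta>' (y - x) \<bullet> h) *\<^sub>R F y)" for x h
    using order_trans[OF ip abs_ge_self]
    by (intro Bochner_Integration.integrable_bound[OF integrable_mult_right[OF nF, of "B * norm h"]])
      (auto intro!: mult_right_mono AE_I2 simp: abs_mult)
  have bd2: "norm (\<integral>y. (\<eta>' (y - x) \<bullet> h) *\<^sub>R F y \<partial>lebesgue) \<le> B * (\<integral>y. norm (F y) \<partial>lebesgue) * norm h" for x h
  proof -
    have "norm (\<integral>y. (\<eta>' (y - x) \<bullet> h) *\<^sub>R F y \<partial>lebesgue) \<le> (\<integral>y. (B * norm h) * norm (F y) \<partial>lebesgue)"
    proof (rule order_trans[OF integral_norm_bound integral_mono])
      show "norm ((\<eta>' (y - x) \<bullet> h) *\<^sub>R F y) \<le> B * norm h * norm (F y)" for y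
        using mult_right_mono[OF ip norm_ge_zero] by simp
    qed (use integrable_norm[OF i2] nF in \<open>simp_all del: norm_scaleR\<close>)
    then show ?thesis by (simp add: mult_ac)
  qed
  show "norm (\<integral>y. (\<eta>' (y - x) \<bullet> h) *\<^sub>R F y \<partial>lebesgue) \<le> B * (\<integral>y. norm (F y) \<partial>lebesgue) * norm h"
    by (rule bd2)
  show "(mollify \<eta> F has_derivative (\<lambda>h. - (\<integral>y. (\<eta>' (y - x) \<bullet> h) *\<^sub>R F y \<partial>lebesgue))) (at x)"
  proof (rule has_derivative_quadratic_remainder[where C = "C * (\<integral>y. norm (F y) \<partial>lebesgue)"])
    show "bounded_linear (\<lambda>h. - (\<integral>y. (\<eta>' (y - x) \<bullet> h) *\<^sub>R F y \<partial>lebesgue))"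
      using i2 bd2[of x]
      by (intro bounded_linear_intro[where K = "B * (\<integral>y. norm (F y) \<partial>lebesgue)"])
        (auto simp: inner_add_right scaleR_left.add mult_ac simp flip: scaleR_scaleR)
  next
    fix h :: 'a assume h: "norm h \<le> 1"
    have "mollify \<eta> F (x + h) - mollify \<eta> F x - - (\<integral>y. (\<eta>' (y - x) \<bullet> h) *\<^sub>R F y \<partial>lebesgue)
       = (\<integral>y. \<eta> (y - (x + h)) *\<^sub>R F y - \<eta> (y - x) *\<^sub>R F y + (\<eta>' (y - x) \<bullet> h) *\<^sub>R F y \<partial>lebesgue)"
      unfolding mollify_def using i1 i2 by simp
    also have "\<dots> = (\<integral>y. (\<eta> ((y - x) + - h) - \<eta> (y - x) - \<eta>' (y - x) \<bullet> - h) *\<^sub>R F y \<partial>lebesgue)"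
      by (simp add: algebra_simps)
    also have "norm \<dots> \<le> (\<integral>y. (C * (norm h)\<^sup>2) * norm (F y) \<partial>lebesgue)"
    proof (rule order_trans[OF integral_norm_bound integral_mono])
      have "(\<lambda>y. (\<eta> ((y - x) + - h) - \<eta> (y - x) - \<eta>' (y - x) \<bullet> - h) *\<^sub>R F y)
        = (\<lambda>y. \<eta> (y - (x + h)) *\<^sub>R F y - \<eta> (y - x) *\<^sub>R F y + (\<eta>' (y - x) \<bullet> h) *\<^sub>R F y)"
        by (auto simp: algebra_simps)
      then show "integrable lebesgue (\<lambda>y. norm ((\<eta> ((y - x) + - h) - \<eta> (y - x) - \<eta>' (y - x) \<bullet> - h) *\<^sub>R F y))"
        using i1 i2 by (simp del: norm_scaleR)
      show "norm ((\<eta> ((y - x) + - h) - \<eta> (y - x) - \<eta>' (y - x) \<bullet> - h) *\<^sub>R F y) \<le> (C * (norm h)\<^sup>2) * norm (F y)" for y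
        using rem[of "- h" "y - x"] h by (auto intro!: mult_right_mono)
    qed (use nF in auto)
    finally show "norm (mollify \<eta> F (x + h) - mollify \<eta> F x - - (\<integral>y. (\<eta>' (y - x) \<bullet> h) *\<^sub>R F y \<partial>lebesgue))
      \<le> C * (\<integral>y. norm (F y) \<partial>lebesgue) * (norm h)\<^sup>2" by (simp add: mult_ac)
  qed
qed

lemma mollifier_exists:
  assumes e: "e > 0"
  shows "\<exists>(\<eta> :: 'a::euclidean_space \<Rightarrow> real) \<eta>' B C. mollifier e \<eta> \<eta>' B C"
proof -
  define I where "I = (\<integral>x. bump e (x::'a) \<partial>lborel)"
  have I: "I > 0" unfolding I_def by (rule bump_integral[OF e])
  define \<eta> where "\<eta> x = bump e x / I" for x :: 'a
  define \<eta>' where "\<eta>' x = (1 / I) *\<^sub>R bump_grad e x" for x :: 'a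
  define B where "B = ((e\<^sup>2)\<^sup>2 + 4 * e\<^sup>2 * e) / I"
  define C where "C = ((2 * e + 3)\<^sup>2 + 2 * e\<^sup>2) / I"
  have "mollifier e \<eta> \<eta>' B C"
    unfolding mollifier_def
  proof (intro conjI allI impI)
    show "continuous_on UNIV \<eta>" "continuous_on UNIV \<eta>'"
      unfolding \<eta>_def \<eta>'_def using I by (auto intro!: continuous_intros)
    show "\<eta> z \<ge> 0" for z using I bump_bounds(1)[of e z] by (simp add: \<eta>_def)
    show "\<bar>\<eta> z\<bar> \<le> B" for z
      using I e bump_bounds[of e z] unfolding \<eta>_def B_def by (simp add: divide_right_mono add_increasing2)
    have "norm (\<eta>' z) = norm (bump_grad e z) / I" for z using I by (simp add: \<eta>'_def)
    then show "norm (\<eta>' z) \<le> B" for z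
      using I e bump_grad_bound[OF e, of z] unfolding B_def by (simp add: divide_right_mono add_increasing)
    have "(\<eta> has_derivative (\<lambda>h. (bump_grad e x \<bullet> h) / I)) (at x)" for x
      unfolding \<eta>_def 
      by (rule bounded_linear.has_derivative[OF bounded_linear_divide bump_has_derivative[OF e]])
    then show "(\<eta> has_derivative (\<lambda>h. \<eta>' x \<bullet> h)) (at x)" for x
      by (simp add: \<eta>'_def)
    show "\<bar>\<eta> (x + h) - \<eta> x - \<eta>' x \<bullet> h\<bar> \<le> C * (norm h)\<^sup>2" if "norm h \<le> 1" for x h
    proof -
      have "\<bar>\<eta> (x + h) - \<eta> x - \<eta>' x \<bullet> h\<bar> = \<bar>bump e (x + h) - bump e x - bump_grad e x \<bullet> h\<bar> / I"
        using I by (simp add: \<eta>_def \<eta>'_def diff_divide_distrib[symmetric])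
      also have "\<dots> \<le> (((2 * e + 3)\<^sup>2 + 2 * e\<^sup>2) * (norm h)\<^sup>2) / I"
        using I by (intro divide_right_mono bump_remainder[OF e that]) auto
      finally show ?thesis by (simp add: C_def)
    qed
    show "\<eta> z = 0" "\<eta>' z = 0" if "norm z \<ge> e" for z
      using bump_zero[OF that e] by (auto simp: \<eta>_def \<eta>'_def)
    show "integrable lborel \<eta>" "(\<integral>z. \<eta> z \<partial>lborel) = 1"
      using bump_integral[OF e, where 'a = 'a] I by (auto simp: \<eta>_def[abs_def] I_def)
  qed
  then show ?thesis by blast
qed

section \<open>The calculus of weak gradients\<close>

text \<open>The difference quotients integrate to zero by translation invariance, and the Lipschitz
  bound dominates them.\<close>

lemma integral_derivative_eq_0:
  fixes g :: "'a::euclidean_space \<Rightarrow> real"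
  assumes der: "\<And>x. (g has_derivative g' x) (at x)"
    and bd: "\<And>x h. \<bar>g' x h\<bar> \<le> B * norm h"
    and K: "compact K" "\<And>x. x \<notin> K \<Longrightarrow> g x = 0"
  shows "integrable lborel (\<lambda>x. g' x b)" "(\<integral>x. g' x b \<partial>lborel) = 0"
proof -
  have cont: "continuous_on UNIV g"
    using der by (meson has_derivative_continuous continuous_at_imp_continuous_on)
  then have [measurable]: "g \<in> borel_measurable borel" by (rule borel_measurable_continuous_onI)
  obtain R where R: "K \<subseteq> cball 0 R" 
    using compact_imp_bounded[OF K(1)] unfolding bounded_iff subset_iff mem_cball_0 by blast
  have "integrable lborel (\<lambda>x. indicator K x *\<^sub>R g x)"
    using K(1) cont by (intro borel_integrable_compact) (auto intro: continuous_on_subset)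
  moreover have "(\<lambda>x. indicator K x *\<^sub>R g x) = g" using K(2) by (force simp: indicator_def)
  ultimately have ig: "integrable lborel g" by simp
  define t where "t n = inverse (real (Suc n))" for n
  have t: "t n > 0" "t n \<le> 1" for n by (auto simp: t_def field_simps)
  define s where "s n x = (g (x + t n *\<^sub>R b) - g x) / t n" for n x
  have s0: "(\<integral>x. s n x \<partial>lborel) = 0" for n
    unfolding s_def using lborel_integrable_translate[OF ig] ig by simp
  obtain b0 :: 'a where "b0 \<in> Basis" using nonempty_Basis by blast
  then have "B \<ge> 0" using bd[of 0 b0] by simp
  then have "onorm (g' x) \<le> B" for x using bd by (intro onorm_bound) auto
  then have lip: "\<bar>g x - g y\<bar> \<le> B * norm (x - y)" for x y
    using differentiable_bound[of UNIV g g' B x y] der by auto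
  have sB: "norm (s n x) \<le> indicator (cball 0 (R + norm b)) x *\<^sub>R (B * norm b)" for n x
  proof (cases "x \<in> cball 0 (R + norm b)")
    case True
    have "\<bar>s n x\<bar> = \<bar>g (x + t n *\<^sub>R b) - g x\<bar> / t n" using t[of n] by (simp add: s_def)
    also have "\<dots> \<le> (B * norm (t n *\<^sub>R b)) / t n"
      using lip[of "x + t n *\<^sub>R b" x] t(1)[of n] by (intro divide_right_mono) auto
    also have "\<dots> = B * norm b" using t(1)[of n] by simp
    finally show ?thesis using True by simp
  next
    case False
    have "norm (t n *\<^sub>R b) \<le> norm b" using t[of n] by (simp add: mult_left_le_one_le)
    then have "norm (x + t n *\<^sub>R b) > R" using False norm_triangle_ineq4[of "x + t n *\<^sub>R b" "t n *\<^sub>R b"] by simp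
    moreover have "norm x > R" using False norm_ge_zero[of b] unfolding mem_cball_0 by linarith
    ultimately have "x \<notin> K" "x + t n *\<^sub>R b \<notin> K" using R by (meson mem_cball_0 not_le subsetD)+
    then show ?thesis using K(2) False by (simp add: s_def)
  qed
  have lim: "(\<lambda>n. s n x) \<longlonglongrightarrow> g' x b" for x
  proof -
    have lin: "linear (g' x)" using has_derivative_linear[OF der] .
    have "((\<lambda>r. x + r *\<^sub>R b) has_derivative (\<lambda>r. r *\<^sub>R b)) (at 0)"
      by (auto intro!: derivative_eq_intros)
    moreover have "(g has_derivative g' x) (at (x + 0 *\<^sub>R b))" using der by simp
    ultimately have "((\<lambda>r. g (x + r *\<^sub>R b)) has_derivative (\<lambda>r. g' x (r *\<^sub>R b))) (at 0)"
      by (rule has_derivative_compose)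
    then have "((\<lambda>r. g (x + r *\<^sub>R b)) has_field_derivative g' x b) (at 0)"
      by (auto simp: has_field_derivative_def linear_scale[OF lin] fun_eq_iff mult.commute elim!: back_subst[where P = "\<lambda>D. (_ has_derivative D) _"])
    then have "((\<lambda>r. (g (x + r *\<^sub>R b) - g x) / r) \<longlongrightarrow> g' x b) (at 0)"
      using DERIV_D by fastforce
    moreover have "filterlim t (at 0) sequentially"
      unfolding filterlim_at t_def[abs_def] using LIMSEQ_inverse_real_of_nat by auto
    ultimately show ?thesis unfolding s_def by (rule filterlim_compose)
  qed
  have dom: "integrable lborel (\<lambda>x::'a. indicator (cball 0 (R + norm b)) x *\<^sub>R (B * norm b))"
    using emeasure_bounded_finite[OF bounded_cball[of "0::'a" "R + norm b"]]
    by (intro integrable_scaleR_left integrable_real_indicator) auto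
  have [measurable]: "s n \<in> borel_measurable lborel" for n unfolding s_def[abs_def] by simp
  have [measurable]: "(\<lambda>x. g' x b) \<in> borel_measurable lborel"
    by (rule borel_measurable_LIMSEQ_real[OF lim]) auto
  show "integrable lborel (\<lambda>x. g' x b)"
    by (rule integrable_dominated_convergence[OF _ _ dom, where s = s]) (use lim sB in auto)
  have "(\<lambda>n. \<integral>x. s n x \<partial>lborel) \<longlonglongrightarrow> (\<integral>x. g' x b \<partial>lborel)"
    by (rule integral_dominated_convergence[OF _ _ dom]) (use lim sB in auto)
  then show "(\<integral>x. g' x b \<partial>lborel) = 0" unfolding s0 using LIMSEQ_unique tendsto_const by blast
qed

lemma integral_lebesgue_on_supported:
  fixes h :: "'a::euclidean_space \<Rightarrow> 'b::{banach, second_countable_topology}"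
  assumes "S \<in> sets lebesgue" "\<And>x. x \<notin> S \<Longrightarrow> h x = 0"
  shows "(\<integral>x. h x \<partial>lebesgue_on S) = (\<integral>x. h x \<partial>lebesgue)"
proof -
  have "(\<lambda>x. indicator S x *\<^sub>R h x) = h" using assms(2) by (force simp: indicator_def)
  then show ?thesis using assms(1) by (simp add: integral_restrict_space)
qed

lemma C1_supported_derivative:
  fixes T :: "'a::euclidean_space \<Rightarrow> 'b::euclidean_space"
  assumes "compact K" "C1_supported K T"
  obtains T' B where "continuous_on UNIV T'" "\<And>x. (T has_derivative blinfun_apply (T' x)) (at x)"
    "\<And>x. x \<notin> K \<Longrightarrow> T x = 0" "\<And>x. x \<notin> K \<Longrightarrow> T' x = 0"
    "\<And>x. norm (T' x) \<le> B" "\<And>x. norm (T x) \<le> B"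
    "\<And>x. frechet_derivative T (at x) = blinfun_apply (T' x)"
proof -
  obtain T' :: "'a \<Rightarrow> 'a \<Rightarrow>\<^sub>L 'b" where T': "continuous_on UNIV T'" "\<And>x. (T has_derivative blinfun_apply (T' x)) (at x)"
    and z: "\<And>x. x \<notin> K \<Longrightarrow> T x = 0"
    using assms(2) unfolding C1_supported_def by blast
  have z': "T' x = 0" if "x \<notin> K" for x
  proof -
    have "open (- K)" using assms(1) by (simp add: compact_imp_closed open_Compl)
    moreover have "((\<lambda>_. 0) has_derivative (\<lambda>_. 0)) (at x)" by simp
    ultimately have "(T has_derivative (\<lambda>_. 0)) (at x)"
      using has_derivative_transform_within_open[of "\<lambda>_. 0" "\<lambda>_. 0" x UNIV "- K" T] that z by simp
    then have "blinfun_apply (T' x) = (\<lambda>_. 0)" using T'(2) has_derivative_unique by blast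
    then show ?thesis by (intro blinfun_eqI) auto
  qed
  have cT: "continuous_on UNIV T"
    using T'(2) by (meson has_derivative_continuous continuous_at_imp_continuous_on)
  have "bounded (T' ` K)" "bounded (T ` K)"
    using assms(1) T'(1) cT by (auto intro!: compact_imp_bounded compact_continuous_image intro: continuous_on_subset)
  then obtain B1 B2 where "B1 > 0" "\<And>x. x \<in> K \<Longrightarrow> norm (T' x) \<le> B1" "B2 > 0" "\<And>x. x \<in> K \<Longrightarrow> norm (T x) \<le> B2"
    by (auto simp: bounded_pos)
  then have B: "norm (T' x) \<le> max B1 B2" "norm (T x) \<le> max B1 B2" for x
    using z[of x] z'[of x] by (cases "x \<in> K"; simp add: le_max_iff_disj less_imp_le)+
  show thesis
    by (rule that[OF T' z z' B]) (auto simp: frechet_derivative_at[OF T'(2), symmetric])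
qed

lemma weak_gradient_against_kernel:
  fixes f :: "'a::euclidean_space \<Rightarrow> real"
  assumes w: "has_weak_gradient \<Omega> f g"
    and mol: "mollifier e \<eta> \<eta>' B C" and x: "cball x e \<subseteq> \<Omega>" and b: "b \<in> Basis"
  shows "(\<integral>y. f y * (\<eta>' (y - x) \<bullet> b) \<partial>lebesgue_on \<Omega>) = - (\<integral>y. (g y \<bullet> b) * \<eta> (y - x) \<partial>lebesgue_on \<Omega>)"
proof -
  note c = mollifierD(2)[OF mol] and der = mollifierD(6)[OF mol] and supp = mollifierD(8)[OF mol]
  let ?\<phi> = "\<lambda>y. \<eta> (y - x)"
  have d: "(?\<phi> has_derivative (\<lambda>h. \<eta>' (y - x) \<bullet> h)) (at y)" for y
    by (rule has_derivative_compose[of "\<lambda>y. y - x", OF _ der]) (auto intro!: derivative_eq_intros)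
  have "C1_test \<Omega> ?\<phi>"
    unfolding C1_test_def C1_supported_def
  proof (intro exI[of _ "cball x e"] conjI exI[of _ "\<lambda>y. blinfun_inner_right (\<eta>' (y - x))"] allI)
    show "continuous_on UNIV (\<lambda>y. blinfun_inner_right (\<eta>' (y - x)))"
      by (intro bounded_linear.continuous_on[OF bounded_linear_blinfun_inner_right] continuous_on_compose2[OF c] continuous_intros) auto
    show "(?\<phi> has_derivative blinfun_apply (blinfun_inner_right (\<eta>' (y - x)))) (at y)" for y
      using d by simp
    show "y \<notin> cball x e \<longrightarrow> \<eta> (y - x) = 0" for y
      using supp[of "y - x"] by (auto simp: dist_norm norm_minus_commute)
  qed (use x in auto)
  moreover have "frechet_derivative ?\<phi> (at y) b = \<eta>' (y - x) \<bullet> b" for y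
    using frechet_derivative_at[OF d[of y]] by metis
  ultimately show ?thesis using w b unfolding has_weak_gradient_def by fastforce
qed

lemma integrable_vec_iff:
  fixes f :: "'a \<Rightarrow> real^'n"
  shows "integrable M f \<longleftrightarrow> (\<forall>i. integrable M (\<lambda>x. f x $ i))"
proof
  assume "integrable M f"
  then show "\<forall>i. integrable M (\<lambda>x. f x $ i)"
    using integrable_bounded_linear[OF bounded_linear_vec_nth] by blast
next
  assume *: "\<forall>i. integrable M (\<lambda>x. f x $ i)"
  have "f x = (\<Sum>i\<in>UNIV. f x $ i *\<^sub>R axis i 1)" for x
    using basis_expansion[of "f x"] by (simp add: scalar_mult_eq_scaleR)
  then have "f = (\<lambda>x. \<Sum>i\<in>UNIV. f x $ i *\<^sub>R axis i 1)" by auto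
  moreover have "integrable M (\<lambda>x. \<Sum>i\<in>UNIV. f x $ i *\<^sub>R axis i (1::real))"
    using * by (intro Bochner_Integration.integrable_sum integrable_scaleR_left) auto
  ultimately show "integrable M f" by simp
qed

lemma integrable_bounded_scaleR:
  fixes F :: "'a \<Rightarrow> 'b::{banach, second_countable_topology}"
  assumes F: "integrable M F" and [measurable]: "w \<in> borel_measurable M" and B: "\<And>x. x \<in> space M \<Longrightarrow> \<bar>w x\<bar> \<le> B"
  shows "integrable M (\<lambda>x. w x *\<^sub>R F x)"
proof (rule Bochner_Integration.integrable_bound)
  show "integrable M (\<lambda>x. B * norm (F x))" using F by simp
  have "\<bar>w x\<bar> * norm (F x) \<le> \<bar>B\<bar> * norm (F x)" if "x \<in> space M" for x
    using B[OF that] by (intro mult_right_mono) auto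
  then show "AE x in M. norm (w x *\<^sub>R F x) \<le> norm (B * norm (F x))"
    by (simp add: abs_mult)
qed (use F in measurable)

text \<open>The translated kernel is itself a test function, so the gradient of the mollified
  function is the mollified weak gradient wherever the kernel stays inside
  \<open>K'\<close>.\<close>

lemma mollified_weak_derivative:
  fixes f :: "'a::euclidean_space \<Rightarrow> real^'n"
  assumes \<Omega>: "open \<Omega>" and w: "\<And>i. has_weak_gradient \<Omega> (\<lambda>x. f x $ i) (g i)"
    and K': "K' \<in> sets lebesgue" "cball x e \<subseteq> K'" "K' \<subseteq> \<Omega>"
    and F: "integrable lebesgue (\<lambda>x. indicator K' x *\<^sub>R f x)"
    and G: "integrable lebesgue (\<lambda>x. indicator K' x *\<^sub>R (\<chi> i. g i x \<bullet> b))"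
    and mol: "mollifier e \<eta> \<eta>' B C" and b: "b \<in> Basis"
  shows "- (\<integral>y. (\<eta>' (y - x) \<bullet> b) *\<^sub>R (indicator K' y *\<^sub>R f y) \<partial>lebesgue) = mollify \<eta> (\<lambda>y. indicator K' y *\<^sub>R (\<chi> i. g i y \<bullet> b)) x"
proof -
  note c = mollifierD(1,2)[OF mol] and bd = mollifierD(4,5)[OF mol] and supp = mollifierD(8,9)[OF mol]
  have m1[measurable]: "(\<lambda>y. \<eta> (y - x)) \<in> borel_measurable lebesgue"
    by (rule measurable_completion, simp) (intro borel_measurable_continuous_onI continuous_on_compose2[OF c(1)] continuous_intros, auto)
  have m2[measurable]: "(\<lambda>y. \<eta>' (y - x) \<bullet> b) \<in> borel_measurable lebesgue"
    by (rule measurable_completion, simp) (intro borel_measurable_continuous_onI continuous_intros continuous_on_compose2[OF c(2)], auto)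
  have zero: "\<eta> (y - x) = 0" "\<eta>' (y - x) = 0" if "y \<notin> K'" for y
  proof -
    have "y \<notin> cball x e" using that K'(2) by blast
    then have "norm (y - x) \<ge> e" by (simp add: dist_norm norm_minus_commute)
    then show "\<eta> (y - x) = 0" "\<eta>' (y - x) = 0" using supp by auto
  qed
  have zero': "\<eta> (y - x) = 0" "\<eta>' (y - x) = 0" if "y \<notin> \<Omega>" for y
    using that K'(3) zero[of y] by blast+
  have ip: "\<bar>\<eta>' (y - x) \<bullet> b\<bar> \<le> B" for y
    using Cauchy_Schwarz_ineq2[of "\<eta>' (y - x)" b] bd(2)[of "y - x"] b by simp
  have [measurable]: "(\<lambda>x. indicator K' x *\<^sub>R f x) \<in> borel_measurable lebesgue"
    "(\<lambda>x. indicator K' x *\<^sub>R (\<chi> i. g i x \<bullet> b)) \<in> borel_measurable lebesgue"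
    using F G by (auto dest: borel_measurable_integrable)
  have i1: "integrable lebesgue (\<lambda>y. (\<eta>' (y - x) \<bullet> b) *\<^sub>R (indicator K' y *\<^sub>R f y))"
    by (rule integrable_bounded_scaleR[OF F m2 ip])
  have i2: "integrable lebesgue (\<lambda>y. \<eta> (y - x) *\<^sub>R (indicator K' y *\<^sub>R (\<chi> i. g i y \<bullet> b)))"
    by (rule integrable_bounded_scaleR[OF G m1 bd(1)])
  have \<Omega>s: "\<Omega> \<in> sets lebesgue" using \<Omega> by simp
  show ?thesis
  proof (rule vec_eq_iff[THEN iffD2], rule allI)
    fix i
    have "(- (\<integral>y. (\<eta>' (y - x) \<bullet> b) *\<^sub>R (indicator K' y *\<^sub>R f y) \<partial>lebesgue)) $ i =
      - (\<integral>y. ((\<eta>' (y - x) \<bullet> b) *\<^sub>R (indicator K' y *\<^sub>R f y)) $ i \<partial>lebesgue)"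
      using integral_bounded_linear[OF bounded_linear_vec_nth i1] by simp
    also have "\<dots> = - (\<integral>y. f y $ i * (\<eta>' (y - x) \<bullet> b) \<partial>lebesgue)"
      using zero by (intro arg_cong[where f = uminus] Bochner_Integration.integral_cong) (auto simp: indicator_def)
    also have "\<dots> = - (\<integral>y. f y $ i * (\<eta>' (y - x) \<bullet> b) \<partial>lebesgue_on \<Omega>)"
      using zero' by (subst integral_lebesgue_on_supported[OF \<Omega>s]) auto
    also have "\<dots> = (\<integral>y. (g i y \<bullet> b) * \<eta> (y - x) \<partial>lebesgue_on \<Omega>)"
      by (subst weak_gradient_against_kernel[OF w mol _ b]) (use K' in auto)
    also have "\<dots> = (\<integral>y. (g i y \<bullet> b) * \<eta> (y - x) \<partial>lebesgue)"
      using zero' by (subst integral_lebesgue_on_supported[OF \<Omega>s]) auto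
    also have "\<dots> = (\<integral>y. (\<eta> (y - x) *\<^sub>R (indicator K' y *\<^sub>R (\<chi> i. g i y \<bullet> b))) $ i \<partial>lebesgue)"
      using zero by (intro Bochner_Integration.integral_cong) (auto simp: indicator_def)
    also have "\<dots> = mollify \<eta> (\<lambda>y. indicator K' y *\<^sub>R (\<chi> i. g i y \<bullet> b)) x $ i"
      unfolding mollify_def using integral_bounded_linear[OF bounded_linear_vec_nth i2] by simp
    finally show "(- (\<integral>y. (\<eta>' (y - x) \<bullet> b) *\<^sub>R (indicator K' y *\<^sub>R f y) \<partial>lebesgue)) $ i =
      mollify \<eta> (\<lambda>y. indicator K' y *\<^sub>R (\<chi> i. g i y \<bullet> b)) x $ i" .
  qed
qed

text \<open>The identity holds for the mollified functions, because there it is the vanishing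
  integral of a derivative. In the limit all terms converge in \<open>L\<^sup>1\<close>, except that
  \<open>\<Phi>'\<close> of the mollified function only converges almost everywhere along a
  subsequence; this factor is bounded and multiplies an integrable function, so dominated
  convergence applies.\<close>

lemma weak_chain_rule_test:
  fixes f :: "'a::euclidean_space \<Rightarrow> real^'n" and \<Phi> :: "real^'n \<Rightarrow> real"
  assumes \<Omega>: "open \<Omega>" and w: "\<And>i. has_weak_gradient \<Omega> (\<lambda>x. f x $ i) (g i)"
    and \<Phi>: "\<And>y. (\<Phi> has_derivative (\<lambda>h. \<Phi>' y \<bullet> h)) (at y)" "continuous_on UNIV \<Phi>'" "\<And>y. norm (\<Phi>' y) \<le> L"
    and \<phi>: "C1_test \<Omega> \<phi>" and b: "b \<in> Basis"
  shows "(\<integral>x. \<Phi> (f x) * frechet_derivative \<phi> (at x) b \<partial>lebesgue_on \<Omega>) =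
    - (\<integral>x. ((\<Sum>i\<in>UNIV. \<Phi>' (f x) $ i *\<^sub>R g i x) \<bullet> b) * \<phi> x \<partial>lebesgue_on \<Omega>)"
proof -
  obtain K where K: "compact K" "K \<subseteq> \<Omega>" "C1_supported K \<phi>" using \<phi> unfolding C1_test_def by blast
  obtain \<phi>' B where \<phi>': "continuous_on UNIV \<phi>'" "\<And>x. (\<phi> has_derivative blinfun_apply (\<phi>' x)) (at x)"
    "\<And>x. x \<notin> K \<Longrightarrow> \<phi> x = 0" "\<And>x. x \<notin> K \<Longrightarrow> \<phi>' x = 0"
    and B: "\<And>x. norm (\<phi>' x) \<le> B" "\<And>x. norm (\<phi> x) \<le> B"
    and fr: "\<And>x. frechet_derivative \<phi> (at x) = blinfun_apply (\<phi>' x)"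
    using C1_supported_derivative[OF K(1,3)] by metis
  have B0: "B \<ge> 0" using B(1)[of 0] norm_ge_zero order_trans by blast
  have L0: "L \<ge> 0" using \<Phi>(3)[of 0] norm_ge_zero order_trans by blast
  obtain e0 where e0: "e0 > 0" "(\<Union>x\<in>K. cball x e0) \<subseteq> \<Omega>"
    using compact_subset_open_imp_cball_epsilon_subset[OF K(1) \<Omega> K(2)] by metis
  define K' where "K' = (\<Union>x\<in>K. \<Union>y\<in>cball 0 e0. {x + y})"
  have K'_eq: "K' = (\<Union>x\<in>K. cball x e0)"
  proof -
    have "(\<Union>y\<in>cball 0 e0. {x + y}) = cball x e0" for x :: 'a
      by (auto simp: dist_norm) (metis add_diff_cancel_left' diff_add_cancel dist_commute dist_norm mem_cball_0 norm_minus_commute add.commute)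
    then show ?thesis unfolding K'_def by simp
  qed
  have K': "compact K'"
    unfolding K'_def using compact_sums'[OF K(1) compact_cball[of 0 e0]] by simp
  have K'm: "K' \<in> sets lebesgue" using K' by (simp add: compact_imp_closed)
  have K'sub: "K' \<subseteq> \<Omega>" using e0 K'_eq by simp
  \<comment> \<open>cut off outside of a compact neighbourhood of the support: a kernel of width at most e0 centred in K
    does not see the cut\<close>
  define F where "F = (\<lambda>x. indicator K' x *\<^sub>R f x)"
  define G where "G = (\<lambda>x. indicator K' x *\<^sub>R (\<chi> i. g i x \<bullet> b))"
  have "integrable (lebesgue_on K') (\<lambda>x. f x $ i)" "integrable (lebesgue_on K') (g i)" for i
    using w[of i] K' K'sub unfolding has_weak_gradient_def locally_integrable_def by blast+
  then have "integrable (lebesgue_on K') f" "integrable (lebesgue_on K') (\<lambda>x. \<chi> i. g i x \<bullet> b)"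
    by (auto simp: integrable_vec_iff)
  then have F: "integrable lebesgue F" and G: "integrable lebesgue G"
    using K'm by (auto simp: integrable_restrict_space F_def G_def)
  note [measurable] = borel_measurable_integrable[OF F] borel_measurable_integrable[OF G]
  have c\<Phi>: "continuous_on UNIV \<Phi>"
    using \<Phi>(1) by (meson has_derivative_continuous continuous_at_imp_continuous_on)
  have \<Phi>'L: "\<bar>\<Phi>' y \<bullet> h\<bar> \<le> L * norm h" for y h
    by (rule order_trans[OF Cauchy_Schwarz_ineq2 mult_right_mono[OF \<Phi>(3) norm_ge_zero]])
  have lip: "\<bar>\<Phi> y - \<Phi> z\<bar> \<le> L * norm (y - z)" for y z
  proof -
    have "onorm (\<lambda>h. \<Phi>' y \<bullet> h) \<le> L" for y
      using \<Phi>'L L0 by (intro onorm_bound) auto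
    then show ?thesis
      using differentiable_bound[of UNIV \<Phi> "\<lambda>y h. \<Phi>' y \<bullet> h" L y z] \<Phi>(1) by auto
  qed
  define \<psi> where "\<psi> x = blinfun_apply (\<phi>' x) b" for x
  have \<psi>B: "\<bar>\<psi> x\<bar> \<le> B" for x
    using norm_blinfun[of "\<phi>' x" b] B(1)[of x] b by (simp add: \<psi>_def)
  have c\<psi>: "continuous_on UNIV \<psi>" unfolding \<psi>_def by (intro continuous_intros \<phi>')
  have c\<phi>: "continuous_on UNIV \<phi>"
    using \<phi>'(2) by (meson has_derivative_continuous continuous_at_imp_continuous_on)
  have [measurable]: "\<psi> \<in> borel_measurable lebesgue" "\<phi> \<in> borel_measurable lebesgue"
    by (rule measurable_completion, simp, intro borel_measurable_continuous_onI c\<psi> c\<phi>)+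
  have [measurable]: "\<Phi> \<in> borel_measurable borel" "\<Phi>' \<in> borel_measurable borel"
    by (intro borel_measurable_continuous_onI c\<Phi> \<Phi>)+
  define e where "e n = e0 / real (Suc n)" for n
  have e: "e n > 0" "e n \<le> e0" for n using e0 by (auto simp: e_def field_simps)
  have e_lim: "e \<longlonglongrightarrow> 0" unfolding e_def by (rule LIMSEQ_Suc) (rule lim_const_over_n)
  obtain \<eta> \<eta>' Bn Cn where mol: "\<And>n. mollifier (e n) (\<eta> n :: 'a \<Rightarrow> real) (\<eta>' n) (Bn n) (Cn n)"
    using mollifier_exists[OF e(1), where 'a = 'a] by metis
  define Fn where "Fn n = mollify (\<eta> n) F" for n
  define Gn where "Gn n = mollify (\<eta> n) G" for n
  define D where "D n x h = - (\<integral>y. (\<eta>' n (y - x) \<bullet> h) *\<^sub>R F y \<partial>lebesgue)" for n x h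
  have Fn_der: "(Fn n has_derivative D n x) (at x)" for n x
    unfolding Fn_def D_def by (rule mollify_has_derivative(1)[OF F mol])
  have D_bd: "norm (D n x h) \<le> Bn n * (\<integral>y. norm (F y) \<partial>lebesgue) * norm h" for n x h
    unfolding D_def norm_minus_cancel by (rule mollify_has_derivative(2)[OF F mol])
  have Gn_der: "(Gn n has_derivative (\<lambda>h. - (\<integral>y. (\<eta>' n (y - x) \<bullet> h) *\<^sub>R G y \<partial>lebesgue))) (at x)" for n x
    unfolding Gn_def by (rule mollify_has_derivative(1)[OF G mol])
  have D_eq: "D n x b = Gn n x" if "x \<in> K" for n x
  proof -
    have "cball x (e n) \<subseteq> K'" using that e(2)[of n] unfolding K'_eq by force
    then show ?thesis
      unfolding D_def Gn_def F_def G_def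
      by (rule mollified_weak_derivative[OF \<Omega> w K'm _ K'sub F[unfolded F_def] G[unfolded G_def] mol b])
  qed
  have cFn: "continuous_on UNIV (Fn n)" and cGn: "continuous_on UNIV (Gn n)" for n
    using Fn_der Gn_der by (meson has_derivative_continuous continuous_at_imp_continuous_on)+
  have [measurable]: "Fn n \<in> borel_measurable lebesgue" "Gn n \<in> borel_measurable lebesgue" for n
    by (rule measurable_completion, simp, intro borel_measurable_continuous_onI cFn cGn)+
  \<comment> \<open>the integrand of the identity to be proved, for functions F with gradients G in direction b\<close>
  define H where "H F G x = \<Phi> (F x) * \<psi> x + (\<Phi>' (F x) \<bullet> G x) * \<phi> x" for F G x
  have zero: "\<psi> x = 0" "\<phi> x = 0" if "x \<notin> K" for x using that \<phi>' by (auto simp: \<psi>_def)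
  have Hn: "integrable lebesgue (H (Fn n) (Gn n)) \<and> (\<integral>x. H (Fn n) (Gn n) x \<partial>lebesgue) = 0" for n
  proof -
    define g' where "g' x h = \<Phi> (Fn n x) * blinfun_apply (\<phi>' x) h + (\<Phi>' (Fn n x) \<bullet> D n x h) * \<phi> x" for x h
    have der: "((\<lambda>x. \<Phi> (Fn n x) * \<phi> x) has_derivative g' x) (at x)" for x
      using has_derivative_mult[OF has_derivative_compose[OF Fn_der \<Phi>(1)] \<phi>'(2)]
      unfolding g'_def by simp
    have "bounded ((\<lambda>x. \<Phi> (Fn n x)) ` K)"
      by (intro compact_imp_bounded compact_continuous_image continuous_on_compose2[OF c\<Phi>] continuous_on_subset[OF cFn] K) auto
    then obtain b1 where b1: "\<And>x. x \<in> K \<Longrightarrow> \<bar>\<Phi> (Fn n x)\<bar> \<le> b1" by (auto simp: bounded_iff)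
    define b2 where "b2 = \<bar>b1\<bar> * B + L * \<bar>Bn n * (\<integral>y. norm (F y) \<partial>lebesgue)\<bar> * B"
    have bd: "\<bar>g' x h\<bar> \<le> b2 * norm h" for x h
    proof (cases "x \<in> K")
      case True
      have "\<bar>\<Phi> (Fn n x) * blinfun_apply (\<phi>' x) h\<bar> \<le> \<bar>b1\<bar> * (B * norm h)"
        unfolding abs_mult using b1[OF True] norm_blinfun[of "\<phi>' x" h] mult_right_mono[OF B(1)[of x], of "norm h"]
        by (intro mult_mono) auto
      moreover have "\<bar>(\<Phi>' (Fn n x) \<bullet> D n x h) * \<phi> x\<bar> \<le> (L * (\<bar>Bn n * (\<integral>y. norm (F y) \<partial>lebesgue)\<bar> * norm h)) * B"
        unfolding abs_mult[of "_ \<bullet> _"]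
      proof (intro mult_mono)
        have "\<bar>\<Phi>' (Fn n x) \<bullet> D n x h\<bar> \<le> L * norm (D n x h)" by (rule \<Phi>'L)
        also have "\<dots> \<le> L * (\<bar>Bn n * (\<integral>y. norm (F y) \<partial>lebesgue)\<bar> * norm h)"
          using L0 by (intro mult_left_mono order_trans[OF D_bd mult_right_mono]) auto
        finally show "\<bar>\<Phi>' (Fn n x) \<bullet> D n x h\<bar> \<le> L * (\<bar>Bn n * (\<integral>y. norm (F y) \<partial>lebesgue)\<bar> * norm h)" .
      qed (use B(2)[of x] L0 in auto)
      ultimately show ?thesis unfolding g'_def b2_def by (simp add: algebra_simps)
    next
      case False
      then show ?thesis using \<phi>'(3,4) B0 L0 by (simp add: g'_def b2_def)
    qed
    note int0 = integral_derivative_eq_0[OF der bd K(1), of b]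
    have eq: "(\<lambda>x. g' x b) = H (Fn n) (Gn n)"
    proof
      fix x show "g' x b = H (Fn n) (Gn n) x"
        using D_eq[of x n] zero[of x] by (cases "x \<in> K") (auto simp: g'_def H_def \<psi>_def)
    qed
    have "integrable lborel (H (Fn n) (Gn n))" "(\<integral>x. H (Fn n) (Gn n) x \<partial>lborel) = 0"
      using int0 \<phi>'(3) unfolding eq by auto
    then show ?thesis using borel_measurable_integrable integrable_completion integral_completion by metis
  qed
  \<comment> \<open>the first two terms tend to 0 in L1; the third needs pointwise convergence of Fn\<close>
  have HB: "\<bar>H (Fn n) (Gn n) x - H F G x\<bar> \<le> B * L * norm (Fn n x - F x) + B * L * norm (Gn n x - G x) +
      B * (norm (\<Phi>' (Fn n x) - \<Phi>' (F x)) * norm (G x)) * indicator K x" for n x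
  proof (cases "x \<in> K")
    case True
    have eq: "H (Fn n) (Gn n) x - H F G x = (\<Phi> (Fn n x) - \<Phi> (F x)) * \<psi> x + (\<Phi>' (Fn n x) \<bullet> (Gn n x - G x)) * \<phi> x
      + ((\<Phi>' (Fn n x) - \<Phi>' (F x)) \<bullet> G x) * \<phi> x"
      unfolding H_def inner_diff_left inner_diff_right by (simp add: left_diff_distrib)
    have "\<bar>H (Fn n) (Gn n) x - H F G x\<bar> \<le> \<bar>(\<Phi> (Fn n x) - \<Phi> (F x)) * \<psi> x\<bar> + \<bar>(\<Phi>' (Fn n x) \<bullet> (Gn n x - G x)) * \<phi> x\<bar>
      + \<bar>((\<Phi>' (Fn n x) - \<Phi>' (F x)) \<bullet> G x) * \<phi> x\<bar>"
      unfolding eq by (rule order_trans[OF abs_triangle_ineq add_right_mono[OF abs_triangle_ineq]])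
    also have "\<dots> \<le> (L * norm (Fn n x - F x)) * B + (L * norm (Gn n x - G x)) * B
      + (norm (\<Phi>' (Fn n x) - \<Phi>' (F x)) * norm (G x)) * B"
    proof (intro add_mono)
      show "\<bar>(\<Phi> (Fn n x) - \<Phi> (F x)) * \<psi> x\<bar> \<le> (L * norm (Fn n x - F x)) * B"
        unfolding abs_mult using lip \<psi>B L0 by (intro mult_mono) auto
      show "\<bar>(\<Phi>' (Fn n x) \<bullet> (Gn n x - G x)) * \<phi> x\<bar> \<le> (L * norm (Gn n x - G x)) * B"
        unfolding abs_mult using \<Phi>'L B(2)[of x] L0 by (intro mult_mono) auto
      show "\<bar>((\<Phi>' (Fn n x) - \<Phi>' (F x)) \<bullet> G x) * \<phi> x\<bar> \<le> (norm (\<Phi>' (Fn n x) - \<Phi>' (F x)) * norm (G x)) * B"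
        unfolding abs_mult using Cauchy_Schwarz_ineq2 B(2)[of x] by (intro mult_mono) auto
    qed
    finally show ?thesis using True by (simp add: mult_ac)
  next
    case False
    then show ?thesis using zero B0 L0 by (simp add: H_def)
  qed
  have F_lim: "(\<lambda>n. \<integral>\<^sup>+x. norm (Fn n x - F x) \<partial>lebesgue) \<longlonglongrightarrow> 0" and G_lim: "(\<lambda>n. \<integral>\<^sup>+x. norm (Gn n x - G x) \<partial>lebesgue) \<longlonglongrightarrow> 0"
    unfolding Fn_def Gn_def
    by (rule mollify_tendsto_L1[OF _ mol e_lim, OF F] mollify_tendsto_L1[OF _ mol e_lim, OF G])+
  have Km: "K \<in> sets lebesgue" using K(1) by (simp add: compact_imp_closed)
  define u where "u n x = indicator K x *\<^sub>R (Fn n x - F x)" for n x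
  have ui: "integrable lebesgue (u n)" for n
  proof -
    have "integrable lborel (\<lambda>x. indicator K x *\<^sub>R Fn n x)"
      using K(1) by (rule borel_integrable_compact) (rule continuous_on_subset[OF cFn], simp)
    then have "integrable lebesgue (\<lambda>x. indicator K x *\<^sub>R Fn n x)"
      using borel_measurable_integrable integrable_completion by blast
    moreover have "integrable lebesgue (\<lambda>x. indicator K x *\<^sub>R F x)"
      using F Km by (rule integrable_mult_indicator[rotated])
    ultimately show ?thesis unfolding u_def scaleR_diff_right by (rule Bochner_Integration.integrable_diff)
  qed
  have "(\<lambda>n. ennreal (\<integral>x. norm (u n x) \<partial>lebesgue)) \<longlonglongrightarrow> 0"
  proof (rule tendsto_sandwich[OF _ _ tendsto_const F_lim])
    show "\<forall>\<^sub>F n in sequentially. ennreal (\<integral>x. norm (u n x) \<partial>lebesgue) \<le> (\<integral>\<^sup>+x. norm (Fn n x - F x) \<partial>lebesgue)"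
    proof (rule always_eventually, rule allI)
      fix n
      have "ennreal (\<integral>x. norm (u n x) \<partial>lebesgue) = (\<integral>\<^sup>+x. norm (u n x) \<partial>lebesgue)"
        using nn_integral_eq_integral[OF integrable_norm[OF ui[of n]]] by simp
      also have "\<dots> \<le> (\<integral>\<^sup>+x. norm (Fn n x - F x) \<partial>lebesgue)"
        by (intro nn_integral_mono) (auto simp: u_def indicator_def)
      finally show "ennreal (\<integral>x. norm (u n x) \<partial>lebesgue) \<le> (\<integral>\<^sup>+x. norm (Fn n x - F x) \<partial>lebesgue)" .
    qed
  qed auto
  then have "(\<lambda>n. \<integral>x. norm (u n x) \<partial>lebesgue) \<longlonglongrightarrow> 0"
    by (subst (asm) ennreal_0[symmetric], subst (asm) tendsto_ennreal_iff) auto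
  then obtain r :: "nat \<Rightarrow> nat" where r: "strict_mono r" "AE x in lebesgue. (\<lambda>n. u (r n) x) \<longlonglongrightarrow> 0"
    using tendsto_L1_AE_subseq[of lebesgue u, OF ui] by blast
  define v where "v n x = indicator K x *\<^sub>R (norm (\<Phi>' (Fn n x) - \<Phi>' (F x)) *\<^sub>R G x)" for n x
  have v_lim: "(\<lambda>n. \<integral>\<^sup>+x. norm (0 - v (r n) x) \<partial>lebesgue) \<longlonglongrightarrow> 0"
  proof (rule nn_integral_dominated_convergence_norm[where w = "\<lambda>x. 2 * L * norm (G x)"])
    show "AE x in lebesgue. norm (v (r n) x) \<le> 2 * L * norm (G x)" for n
    proof (rule AE_I2)
      fix x
      have "norm (\<Phi>' (Fn (r n) x) - \<Phi>' (F x)) \<le> 2 * L"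
        using norm_triangle_ineq4[of "\<Phi>' (Fn (r n) x)" "\<Phi>' (F x)"] \<Phi>(3)[of "Fn (r n) x"] \<Phi>(3)[of "F x"] by linarith
      then show "norm (v (r n) x) \<le> 2 * L * norm (G x)"
        using L0 by (auto simp: v_def indicator_def intro!: mult_right_mono)
    qed
    have "integrable lebesgue (\<lambda>x. 2 * L * norm (G x))" using G by simp
    then show "(\<integral>\<^sup>+ x. ennreal (2 * L * norm (G x)) \<partial>lebesgue) < \<infinity>"
      using L0 by (subst nn_integral_eq_integral) auto
    show "AE x in lebesgue. (\<lambda>n. v (r n) x) \<longlonglongrightarrow> 0"
      using r(2)
    proof eventually_elim
      case (elim x)
      show ?case
      proof (cases "x \<in> K")
        case True
        then have "(\<lambda>n. Fn (r n) x) \<longlonglongrightarrow> F x" using elim by (simp add: u_def LIM_zero_iff)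
        then have "(\<lambda>n. \<Phi>' (Fn (r n) x)) \<longlonglongrightarrow> \<Phi>' (F x)"
          using \<Phi>(2) by (metis UNIV_I continuous_on_eq_continuous_at isCont_tendsto_compose open_UNIV)
        then have "(\<lambda>n. norm (\<Phi>' (Fn (r n) x) - \<Phi>' (F x)) *\<^sub>R G x) \<longlonglongrightarrow> 0 *\<^sub>R G x"
          by (intro tendsto_scaleR tendsto_norm_zero LIM_zero tendsto_const)
        then show ?thesis using True by (simp add: v_def)
      qed (simp add: v_def)
    qed
    show "v (r n) \<in> borel_measurable lebesgue" for n unfolding v_def[abs_def] using Km by measurable
  qed measurable
  have lim_r: "(\<lambda>n. X (r n)) \<longlonglongrightarrow> l" if "X \<longlonglongrightarrow> l" for X and l :: ennreal
    using LIMSEQ_subseq_LIMSEQ[OF that r(1)] by (simp add: o_def)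
  let ?R = "\<lambda>n. ennreal (B * L) * (\<integral>\<^sup>+x. norm (Fn (r n) x - F x) \<partial>lebesgue) +
    ennreal (B * L) * (\<integral>\<^sup>+x. norm (Gn (r n) x - G x) \<partial>lebesgue) + ennreal B * (\<integral>\<^sup>+x. norm (0 - v (r n) x) \<partial>lebesgue)"
  have "?R \<longlonglongrightarrow> ennreal (B * L) * 0 + ennreal (B * L) * 0 + ennreal B * 0"
    by (intro tendsto_add ennreal_tendsto_cmult v_lim lim_r[OF F_lim] lim_r[OF G_lim]) auto
  then have lim0: "?R \<longlonglongrightarrow> 0" by simp
  have [measurable]: "H F G \<in> borel_measurable lebesgue" unfolding H_def[abs_def] by measurable
  have [measurable]: "indicator K \<in> borel_measurable lebesgue" using Km by simp
  have HL1: "(\<lambda>n. \<integral>\<^sup>+x. norm (H (Fn (r n)) (Gn (r n)) x - H F G x) \<partial>lebesgue) \<longlonglongrightarrow> 0"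
  proof (rule tendsto_sandwich[OF _ _ tendsto_const lim0])
    have "(\<integral>\<^sup>+x. norm (H (Fn (r n)) (Gn (r n)) x - H F G x) \<partial>lebesgue) \<le> ?R n" for n
    proof -
      have "(\<integral>\<^sup>+x. norm (H (Fn (r n)) (Gn (r n)) x - H F G x) \<partial>lebesgue) \<le>
        (\<integral>\<^sup>+x. ennreal (B * L) * norm (Fn (r n) x - F x) + ennreal (B * L) * norm (Gn (r n) x - G x)
          + ennreal B * norm (0 - v (r n) x) \<partial>lebesgue)"
        using HB[of "r n"] B0 L0 unfolding v_def
        by (intro nn_integral_mono) (auto simp flip: ennreal_plus ennreal_mult simp: mult_ac intro!: ennreal_leI)
      also have "\<dots> = ?R n"
        unfolding v_def by (subst nn_integral_add; simp add: nn_integral_cmult nn_integral_add)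
      finally show ?thesis .
    qed
    then show "\<forall>\<^sub>F n in sequentially. (\<integral>\<^sup>+x. norm (H (Fn (r n)) (Gn (r n)) x - H F G x) \<partial>lebesgue) \<le> ?R n"
      by (intro always_eventually allI)
  qed auto
  have i1: "integrable lebesgue (\<lambda>x. \<Phi> (F x) * \<psi> x)"
  proof (rule Bochner_Integration.integrable_bound)
    show "integrable lebesgue (\<lambda>x. B * (L * norm (F x) + indicator K x * \<bar>\<Phi> 0\<bar>))"
      using F K(1) lmeasurable_compact[OF K(1)] by (auto simp: fmeasurable_def)
    have "\<bar>\<Phi> (F x) * \<psi> x\<bar> \<le> B * (L * norm (F x) + indicator K x * \<bar>\<Phi> 0\<bar>)" for x
    proof (cases "x \<in> K")
      case True
      have "\<bar>\<Phi> (F x) * \<psi> x\<bar> \<le> (L * norm (F x) + \<bar>\<Phi> 0\<bar>) * B"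
        unfolding abs_mult using lip[of "F x" 0] \<psi>B[of x] L0 by (intro mult_mono) auto
      then show ?thesis using True by (simp add: mult_ac)
    qed (use zero B0 L0 in auto)
    then show "AE x in lebesgue. norm (\<Phi> (F x) * \<psi> x) \<le> norm (B * (L * norm (F x) + indicator K x * \<bar>\<Phi> 0\<bar>))"
      by (intro AE_I2) (use order_trans[OF _ abs_ge_self] in auto)
  qed measurable
  have i2: "integrable lebesgue (\<lambda>x. (\<Phi>' (F x) \<bullet> G x) * \<phi> x)"
  proof (rule Bochner_Integration.integrable_bound)
    show "integrable lebesgue (\<lambda>x. (L * B) * norm (G x))" using G by simp
    have "\<bar>(\<Phi>' (F x) \<bullet> G x) * \<phi> x\<bar> \<le> (L * norm (G x)) * B" for x
      unfolding abs_mult using B(2)[of x] L0 \<Phi>'L by (intro mult_mono) auto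
    then show "AE x in lebesgue. norm ((\<Phi>' (F x) \<bullet> G x) * \<phi> x) \<le> norm ((L * B) * norm (G x))"
      using L0 B0 by (intro AE_I2) (simp add: abs_mult mult_ac)
  qed measurable
  have Hi: "integrable lebesgue (H F G)" unfolding H_def[abs_def] using i1 i2 by simp
  have "(\<lambda>n. \<integral>x. H (Fn (r n)) (Gn (r n)) x \<partial>lebesgue) \<longlonglongrightarrow> (\<integral>x. H F G x \<partial>lebesgue)"
    by (rule tendsto_L1_int[OF _ Hi HL1]) (use Hn in blast)
  then have "(\<integral>x. H F G x \<partial>lebesgue) = 0" using Hn by (simp add: LIMSEQ_const_iff)
  then have main: "(\<integral>x. \<Phi> (F x) * \<psi> x \<partial>lebesgue) = - (\<integral>x. (\<Phi>' (F x) \<bullet> G x) * \<phi> x \<partial>lebesgue)"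
    unfolding H_def using i1 i2 by simp
  have KK': "K \<subseteq> K'" using e0 unfolding K'_eq by force
  have "(\<integral>x. \<Phi> (f x) * frechet_derivative \<phi> (at x) b \<partial>lebesgue_on \<Omega>) = (\<integral>x. \<Phi> (f x) * \<psi> x \<partial>lebesgue)"
    unfolding fr \<psi>_def[symmetric]
    by (rule integral_lebesgue_on_supported) (use \<Omega> zero K(2) in auto)
  also have "\<dots> = (\<integral>x. \<Phi> (F x) * \<psi> x \<partial>lebesgue)"
    using zero KK' by (intro Bochner_Integration.integral_cong refl) (force simp: F_def indicator_def)
  also have "\<dots> = - (\<integral>x. (\<Phi>' (F x) \<bullet> G x) * \<phi> x \<partial>lebesgue)" by (rule main)
  also have "(\<integral>x. (\<Phi>' (F x) \<bullet> G x) * \<phi> x \<partial>lebesgue) = (\<integral>x. ((\<Sum>i\<in>UNIV. \<Phi>' (f x) $ i *\<^sub>R g i x) \<bullet> b) * \<phi> x \<partial>lebesgue)"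
  proof (intro Bochner_Integration.integral_cong refl)
    fix x
    show "(\<Phi>' (F x) \<bullet> G x) * \<phi> x = ((\<Sum>i\<in>UNIV. \<Phi>' (f x) $ i *\<^sub>R g i x) \<bullet> b) * \<phi> x"
      using zero[of x] KK' by (cases "x \<in> K") (auto simp: F_def G_def subset_iff inner_vec_def inner_sum_left)
  qed
  also have "\<dots> = (\<integral>x. ((\<Sum>i\<in>UNIV. \<Phi>' (f x) $ i *\<^sub>R g i x) \<bullet> b) * \<phi> x \<partial>lebesgue_on \<Omega>)"
    by (rule integral_lebesgue_on_supported[symmetric]) (use \<Omega> zero K(2) in auto)
  finally show ?thesis .
qed

lemma continuous_on_compact_measurable:
  fixes w :: "'a::euclidean_space \<Rightarrow> 'b::euclidean_space"
  assumes "compact K" "continuous_on K w"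
  shows "w \<in> borel_measurable (lebesgue_on K)"
  using assms by (intro continuous_imp_measurable_on_sets_lebesgue) (auto simp: compact_imp_closed)

lemma locally_integrable_scaleR_continuous:
  fixes f :: "'a::euclidean_space \<Rightarrow> 'b::euclidean_space"
  assumes f: "locally_integrable \<Omega> f" and w: "continuous_on \<Omega> w"
  shows "locally_integrable \<Omega> (\<lambda>x. w x *\<^sub>R f x)"
  unfolding locally_integrable_def
proof safe
  fix K assume K: "compact K" "K \<subseteq> \<Omega>"
  have c: "continuous_on K w" using w K continuous_on_subset by blast
  then obtain B where B: "\<And>x. x \<in> K \<Longrightarrow> \<bar>w x\<bar> \<le> B"
    using compact_imp_bounded[OF compact_continuous_image[OF c K(1)]] by (auto simp: bounded_iff)
  show "integrable (lebesgue_on K) (\<lambda>x. w x *\<^sub>R f x)"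
    using f K B continuous_on_compact_measurable[OF K(1) c]
    by (intro integrable_bounded_scaleR[where B = B]) (auto simp: locally_integrable_def)
qed

lemma locally_integrable_add:
  "locally_integrable \<Omega> f \<Longrightarrow> locally_integrable \<Omega> g \<Longrightarrow> locally_integrable \<Omega> (\<lambda>x. f x + g x)"
  unfolding locally_integrable_def by auto

lemma locally_integrable_continuous:
  fixes f :: "'a::euclidean_space \<Rightarrow> 'b::euclidean_space"
  assumes "continuous_on \<Omega> f" shows "locally_integrable \<Omega> f"
  unfolding locally_integrable_def
proof safe
  fix K assume K: "compact K" "K \<subseteq> \<Omega>"
  then have "continuous_on K f" using assms continuous_on_subset by blast
  then have "integrable lborel (\<lambda>x. indicator K x *\<^sub>R f x)"
    using K(1) by (intro borel_integrable_compact)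
  then have "integrable lebesgue (\<lambda>x. indicator K x *\<^sub>R f x)"
    using borel_measurable_integrable integrable_completion by blast
  then show "integrable (lebesgue_on K) f"
    using K(1) by (simp add: integrable_restrict_space compact_imp_closed)
qed

lemma integrable_compactly_supported:
  fixes f :: "'a::euclidean_space \<Rightarrow> 'b::euclidean_space"
  assumes \<Omega>: "\<Omega> \<in> sets lebesgue" and K: "compact K" "K \<subseteq> \<Omega>"
    and f: "integrable (lebesgue_on K) f" and z: "\<And>x. x \<notin> K \<Longrightarrow> f x = 0"
  shows "integrable (lebesgue_on \<Omega>) f"
proof -
  have "(\<lambda>x. indicator K x *\<^sub>R f x) = f" using z by (force simp: indicator_def)
  moreover have "(\<lambda>x. indicator \<Omega> x *\<^sub>R f x) = f" using z K(2) by (force simp: indicator_def)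
  ultimately show ?thesis
    using f \<Omega> K by (simp add: integrable_restrict_space compact_imp_closed)
qed

lemma integrable_times_test:
  fixes f :: "'a::euclidean_space \<Rightarrow> 'b::euclidean_space"
  assumes \<Omega>: "\<Omega> \<in> sets lebesgue" and f: "locally_integrable \<Omega> f" and w: "continuous_on UNIV w"
    and K: "compact K" "K \<subseteq> \<Omega>" "\<And>x. x \<notin> K \<Longrightarrow> w x = 0"
  shows "integrable (lebesgue_on \<Omega>) (\<lambda>x. w x *\<^sub>R f x)"
proof (rule integrable_compactly_supported[OF \<Omega> K(1,2)])
  have "locally_integrable \<Omega> (\<lambda>x. w x *\<^sub>R f x)"
    by (rule locally_integrable_scaleR_continuous[OF f continuous_on_subset[OF w subset_UNIV]])
  then show "integrable (lebesgue_on K) (\<lambda>x. w x *\<^sub>R f x)"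
    using K by (auto simp: locally_integrable_def)
qed (use K in auto)

lemma integrable_test_pairings:
  fixes f :: "'a::euclidean_space \<Rightarrow> real" and \<phi> :: "'a \<Rightarrow> real"
  assumes \<Omega>: "\<Omega> \<in> sets lebesgue" and f: "locally_integrable \<Omega> f" and g: "locally_integrable \<Omega> g"
    and \<phi>: "C1_test \<Omega> \<phi>"
  shows "integrable (lebesgue_on \<Omega>) (\<lambda>x. f x * frechet_derivative \<phi> (at x) b)"
    "integrable (lebesgue_on \<Omega>) (\<lambda>x. (g x \<bullet> b) * \<phi> x)"
proof -
  obtain K where K: "compact K" "K \<subseteq> \<Omega>" "C1_supported K \<phi>" using \<phi> unfolding C1_test_def by blast
  obtain \<phi>' B where \<phi>': "continuous_on UNIV \<phi>'" "\<And>x. (\<phi> has_derivative blinfun_apply (\<phi>' x)) (at x)"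
    "\<And>x. x \<notin> K \<Longrightarrow> \<phi> x = 0" "\<And>x. x \<notin> K \<Longrightarrow> \<phi>' x = 0"
    and B: "\<And>x. norm (\<phi>' x) \<le> B" "\<And>x. norm (\<phi> x) \<le> B"
    and fr: "\<And>x. frechet_derivative \<phi> (at x) = blinfun_apply (\<phi>' x)"
    using C1_supported_derivative[OF K(1,3)] by metis
  have "continuous_on UNIV \<phi>"
    using \<phi>'(2) by (meson has_derivative_continuous continuous_at_imp_continuous_on)
  then have "integrable (lebesgue_on \<Omega>) (\<lambda>x. \<phi> x *\<^sub>R g x)"
    by (rule integrable_times_test[OF \<Omega> g _ K(1,2) \<phi>'(3)])
  then have "integrable (lebesgue_on \<Omega>) (\<lambda>x. (\<phi> x *\<^sub>R g x) \<bullet> b)"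
    by (rule integrable_inner_left)
  then show "integrable (lebesgue_on \<Omega>) (\<lambda>x. (g x \<bullet> b) * \<phi> x)" by (simp add: mult.commute)
  have "integrable (lebesgue_on \<Omega>) (\<lambda>x. blinfun_apply (\<phi>' x) b *\<^sub>R f x)"
    by (rule integrable_times_test[OF \<Omega> f _ K(1,2)]) (use \<phi>' in \<open>auto intro!: continuous_intros\<close>)
  then show "integrable (lebesgue_on \<Omega>) (\<lambda>x. f x * frechet_derivative \<phi> (at x) b)"
    unfolding fr by (simp add: mult.commute)
qed

lemma has_weak_gradient_add:
  assumes \<Omega>: "\<Omega> \<in> sets lebesgue" and 1: "has_weak_gradient \<Omega> f1 g1" and 2: "has_weak_gradient \<Omega> f2 g2"
  shows "has_weak_gradient \<Omega> (\<lambda>x. f1 x + f2 x) (\<lambda>x. g1 x + g2 x)"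
  unfolding has_weak_gradient_def
proof (intro conjI allI impI ballI)
  have l: "locally_integrable \<Omega> f1" "locally_integrable \<Omega> f2" "locally_integrable \<Omega> g1" "locally_integrable \<Omega> g2"
    using 1 2 by (auto simp: has_weak_gradient_def)
  then show "locally_integrable \<Omega> (\<lambda>x. f1 x + f2 x)" "locally_integrable \<Omega> (\<lambda>x. g1 x + g2 x)"
    by (auto intro: locally_integrable_add)
  fix \<phi> :: "'a \<Rightarrow> real" and b :: 'a assume t: "C1_test \<Omega> \<phi>" "b \<in> Basis"
  show "(\<integral>x. (f1 x + f2 x) * frechet_derivative \<phi> (at x) b \<partial>lebesgue_on \<Omega>) =
        - (\<integral>x. ((g1 x + g2 x) \<bullet> b) * \<phi> x \<partial>lebesgue_on \<Omega>)"
    using 1 2 t integrable_test_pairings[OF \<Omega> l(1,3) t(1), of b] integrable_test_pairings[OF \<Omega> l(2,4) t(1), of b]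
    by (simp add: distrib_right inner_add_left has_weak_gradient_def)
qed

lemma has_weak_gradient_const:
  assumes \<Omega>: "\<Omega> \<in> sets lebesgue"
  shows "has_weak_gradient \<Omega> (\<lambda>_. c) (\<lambda>_. 0)"
  unfolding has_weak_gradient_def
proof (intro conjI allI impI ballI)
  show "locally_integrable \<Omega> (\<lambda>_. c)" "locally_integrable \<Omega> (\<lambda>_. 0)"
    by (auto intro!: locally_integrable_continuous)
  fix \<phi> :: "'a \<Rightarrow> real" and b :: 'a assume t: "C1_test \<Omega> \<phi>" "b \<in> Basis"
  obtain K where K: "compact K" "K \<subseteq> \<Omega>" "C1_supported K \<phi>" using t unfolding C1_test_def by blast
  obtain \<phi>' B where \<phi>': "continuous_on UNIV \<phi>'" "\<And>x. (\<phi> has_derivative blinfun_apply (\<phi>' x)) (at x)"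
    "\<And>x. x \<notin> K \<Longrightarrow> \<phi> x = 0" "\<And>x. x \<notin> K \<Longrightarrow> \<phi>' x = 0"
    and B: "\<And>x. norm (\<phi>' x) \<le> B" "\<And>x. norm (\<phi> x) \<le> B"
    and fr: "\<And>x. frechet_derivative \<phi> (at x) = blinfun_apply (\<phi>' x)"
    using C1_supported_derivative[OF K(1,3)] by metis
  have "\<bar>blinfun_apply (\<phi>' x) h\<bar> \<le> B * norm h" for x h
    using norm_blinfun[of "\<phi>' x" h] mult_right_mono[OF B(1)[of x], of "norm h"] by simp
  note i = integral_derivative_eq_0[OF \<phi>'(2) this K(1) \<phi>'(3), of b]
  have "(\<integral>x. c * frechet_derivative \<phi> (at x) b \<partial>lebesgue_on \<Omega>) = (\<integral>x. c * blinfun_apply (\<phi>' x) b \<partial>lebesgue)"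
  proof (unfold fr, rule integral_lebesgue_on_supported[OF \<Omega>])
    fix x assume "x \<notin> \<Omega>"
    then have "\<phi>' x = 0" using \<phi>'(4) K(2) by blast
    then show "c * blinfun_apply (\<phi>' x) b = 0" by simp
  qed
  also have "\<dots> = (\<integral>x. c * blinfun_apply (\<phi>' x) b \<partial>lborel)"
    using borel_measurable_integrable[OF i(1)] by (intro integral_completion) auto
  finally show "(\<integral>x. c * frechet_derivative \<phi> (at x) b \<partial>lebesgue_on \<Omega>) = - (\<integral>x. (0 \<bullet> b) * \<phi> x \<partial>lebesgue_on \<Omega>)"
    using i by simp
qed

lemma C1_test_mult:
  fixes a \<phi> :: "'a::euclidean_space \<Rightarrow> real"
  assumes \<Omega>: "open \<Omega>" and a: "continuous_on \<Omega> a'" "\<And>x. x \<in> \<Omega> \<Longrightarrow> (a has_derivative blinfun_apply (a' x)) (at x)"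
    and \<phi>: "C1_test \<Omega> \<phi>"
  shows "C1_test \<Omega> (\<lambda>x. a x * \<phi> x)"
    "\<And>x b. x \<in> \<Omega> \<Longrightarrow> frechet_derivative (\<lambda>x. a x * \<phi> x) (at x) b = a x * frechet_derivative \<phi> (at x) b + blinfun_apply (a' x) b * \<phi> x"
proof -
  obtain K where K: "compact K" "K \<subseteq> \<Omega>" "C1_supported K \<phi>" using \<phi> unfolding C1_test_def by blast
  obtain \<phi>' B where \<phi>': "continuous_on UNIV \<phi>'" "\<And>x. (\<phi> has_derivative blinfun_apply (\<phi>' x)) (at x)"
    "\<And>x. x \<notin> K \<Longrightarrow> \<phi> x = 0" "\<And>x. x \<notin> K \<Longrightarrow> \<phi>' x = 0"
    and B: "\<And>x. norm (\<phi>' x) \<le> B" "\<And>x. norm (\<phi> x) \<le> B"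
    and fr: "\<And>x. frechet_derivative \<phi> (at x) = blinfun_apply (\<phi>' x)"
    using C1_supported_derivative[OF K(1,3)] by metis
  define D where "D x = (if x \<in> \<Omega> then a x *\<^sub>R \<phi>' x + \<phi> x *\<^sub>R a' x else 0)" for x
  have oK: "open (- K)" using K(1) by (simp add: compact_imp_closed open_Compl)
  have D1: "((\<lambda>x. a x * \<phi> x) has_derivative blinfun_apply (D x)) (at x)" if "x \<in> \<Omega>" for x
    using has_derivative_mult[OF a(2)[OF that] \<phi>'(2)[of x]] that
    by (simp add: D_def plus_blinfun.rep_eq scaleR_blinfun.rep_eq mult.commute)
  have D2: "((\<lambda>x. a x * \<phi> x) has_derivative blinfun_apply (D x)) (at x)" if "x \<notin> K" for x
    using has_derivative_transform_within_open[of "\<lambda>_. 0" "\<lambda>_. 0" x UNIV "- K" "\<lambda>x. a x * \<phi> x"] oK that \<phi>'(3,4)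
    by (simp add: D_def zero_blinfun.rep_eq)
  have ca: "continuous_on \<Omega> a"
    using a(2) by (meson has_derivative_continuous continuous_at_imp_continuous_on)
  have c\<phi>: "continuous_on UNIV \<phi>"
    using \<phi>'(2) by (meson has_derivative_continuous continuous_at_imp_continuous_on)
  have "continuous_on \<Omega> (\<lambda>x. a x *\<^sub>R \<phi>' x + \<phi> x *\<^sub>R a' x)"
    by (intro continuous_intros ca a continuous_on_subset[OF c\<phi>] continuous_on_subset[OF \<phi>'(1)]) auto
  then have 1: "continuous_on \<Omega> D" by (rule continuous_on_eq) (simp add: D_def)
  have "continuous_on (- K) (\<lambda>_. 0 :: 'a \<Rightarrow>\<^sub>L real)" by simp
  then have 2: "continuous_on (- K) D" by (rule continuous_on_eq) (simp add: D_def \<phi>')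
  have "continuous_on (\<Omega> \<union> - K) D" by (rule continuous_on_open_Un[OF \<Omega> oK 1 2])
  moreover have "\<Omega> \<union> - K = UNIV" using K(2) by auto
  ultimately have "continuous_on UNIV D" by simp
  moreover have "((\<lambda>x. a x * \<phi> x) has_derivative blinfun_apply (D x)) (at x)" for x
    using D1 D2 K(2) by blast
  ultimately have "C1_supported K (\<lambda>x. a x * \<phi> x)"
    unfolding C1_supported_def using \<phi>'(3) by auto
  then show "C1_test \<Omega> (\<lambda>x. a x * \<phi> x)"
    unfolding C1_test_def using K(1,2) by blast
  show "frechet_derivative (\<lambda>x. a x * \<phi> x) (at x) b = a x * frechet_derivative \<phi> (at x) b + blinfun_apply (a' x) b * \<phi> x"
    if "x \<in> \<Omega>" for x b
    unfolding frechet_derivative_at[OF D1[OF that], symmetric] using that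
    by (simp add: fr D_def plus_blinfun.rep_eq scaleR_blinfun.rep_eq mult.commute)
qed

text \<open>The product of the coefficient with a test function is again a test function, and the
  product rule for it moves the gradient of the coefficient to the other side.\<close>

lemma has_weak_gradient_mult_C1:
  fixes a f :: "'a::euclidean_space \<Rightarrow> real"
  assumes \<Omega>: "open \<Omega>" and w: "has_weak_gradient \<Omega> f g" and a: "C1_closure \<Omega> a"
  shows "\<exists>h. has_weak_gradient \<Omega> (\<lambda>x. a x * f x) h"
proof -
  obtain a' :: "'a \<Rightarrow> 'a \<Rightarrow>\<^sub>L real" where a': "continuous_on \<Omega> a'" "\<And>x. x \<in> \<Omega> \<Longrightarrow> (a has_derivative blinfun_apply (a' x)) (at x)"
    using a unfolding C1_closure_def by (meson closure_subset continuous_on_subset)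
  have ca: "continuous_on \<Omega> a"
    using a unfolding C1_closure_def by (meson closure_subset continuous_on_subset)
  have l: "locally_integrable \<Omega> f" "locally_integrable \<Omega> g" using w by (auto simp: has_weak_gradient_def)
  have \<Omega>s: "\<Omega> \<in> sets lebesgue" using \<Omega> by simp
  define h where "h x = a x *\<^sub>R g x + (\<Sum>b\<in>Basis. (blinfun_apply (a' x) b *\<^sub>R f x) *\<^sub>R b)" for x
  have hb: "h x \<bullet> b = a x * (g x \<bullet> b) + blinfun_apply (a' x) b * f x" if "b \<in> Basis" for x b
  proof -
    have "h x \<bullet> b = a x * (g x \<bullet> b) + (\<Sum>c\<in>Basis. (blinfun_apply (a' x) c * f x) * (c \<bullet> b))"
      by (simp add: h_def inner_add_left inner_sum_left)
    also have "(\<Sum>c\<in>Basis. (blinfun_apply (a' x) c * f x) * (c \<bullet> b)) = (\<Sum>c\<in>Basis. if c = b then blinfun_apply (a' x) b * f x else 0)"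
      using that by (intro sum.cong) (auto simp: inner_Basis)
    finally show ?thesis using that by simp
  qed
  have l2: "locally_integrable \<Omega> (\<lambda>x. blinfun_apply (a' x) b *\<^sub>R f x)" for b
    by (intro locally_integrable_scaleR_continuous l continuous_intros a')
  have "locally_integrable \<Omega> (\<lambda>x. a x * f x)"
    using locally_integrable_scaleR_continuous[OF l(1) ca] by simp
  moreover have lh: "locally_integrable \<Omega> h"
    unfolding h_def using l2
    by (intro locally_integrable_add locally_integrable_scaleR_continuous l ca)
      (auto simp: locally_integrable_def intro!: Bochner_Integration.integrable_sum integrable_scaleR_left)
  moreover have "(\<integral>x. (a x * f x) * frechet_derivative \<phi> (at x) b \<partial>lebesgue_on \<Omega>) = - (\<integral>x. (h x \<bullet> b) * \<phi> x \<partial>lebesgue_on \<Omega>)"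
    if \<phi>: "C1_test \<Omega> \<phi>" and b: "b \<in> Basis" for \<phi> b
  proof -
    note t = C1_test_mult[OF \<Omega> a' \<phi>]
    note i1 = integrable_test_pairings[OF \<Omega>s l t(1), of b] 
    note i2 = integrable_test_pairings[OF \<Omega>s l2 lh \<phi>]
    obtain K where K: "compact K" "K \<subseteq> \<Omega>" "C1_supported K \<phi>" using \<phi> unfolding C1_test_def by blast
    have "continuous_on UNIV \<phi>" using K(3)
      unfolding C1_supported_def by (meson has_derivative_continuous continuous_at_imp_continuous_on)
    moreover have "\<And>x. x \<notin> K \<Longrightarrow> \<phi> x = 0" using K(3) unfolding C1_supported_def by blast
    ultimately have "integrable (lebesgue_on \<Omega>) (\<lambda>x. \<phi> x *\<^sub>R (blinfun_apply (a' x) b *\<^sub>R f x))"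
      by (intro integrable_times_test[OF \<Omega>s l2 _ K(1,2)])
    then have i3: "integrable (lebesgue_on \<Omega>) (\<lambda>x. blinfun_apply (a' x) b * f x * \<phi> x)"
      by (simp add: mult_ac)
    have "(\<integral>x. (a x * f x) * frechet_derivative \<phi> (at x) b \<partial>lebesgue_on \<Omega>) =
      (\<integral>x. f x * frechet_derivative (\<lambda>x. a x * \<phi> x) (at x) b - blinfun_apply (a' x) b * f x * \<phi> x \<partial>lebesgue_on \<Omega>)"
    proof (intro Bochner_Integration.integral_cong refl)
      fix x assume "x \<in> space (lebesgue_on \<Omega>)"
      then show "(a x * f x) * frechet_derivative \<phi> (at x) b =
          f x * frechet_derivative (\<lambda>x. a x * \<phi> x) (at x) b - blinfun_apply (a' x) b * f x * \<phi> x"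
        by (subst t(2)) (auto simp: algebra_simps)
    qed
    also have "\<dots> = (\<integral>x. f x * frechet_derivative (\<lambda>x. a x * \<phi> x) (at x) b \<partial>lebesgue_on \<Omega>)
       - (\<integral>x. blinfun_apply (a' x) b * f x * \<phi> x \<partial>lebesgue_on \<Omega>)"
      by (intro Bochner_Integration.integral_diff i1 i3)
    also have "(\<integral>x. f x * frechet_derivative (\<lambda>x. a x * \<phi> x) (at x) b \<partial>lebesgue_on \<Omega>) = - (\<integral>x. (g x \<bullet> b) * (a x * \<phi> x) \<partial>lebesgue_on \<Omega>)"
      using w t(1) b unfolding has_weak_gradient_def by blast
    also have "- (\<integral>x. (g x \<bullet> b) * (a x * \<phi> x) \<partial>lebesgue_on \<Omega>) - (\<integral>x. blinfun_apply (a' x) b * f x * \<phi> x \<partial>lebesgue_on \<Omega>)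
      = - (\<integral>x. (g x \<bullet> b) * (a x * \<phi> x) + blinfun_apply (a' x) b * f x * \<phi> x \<partial>lebesgue_on \<Omega>)"
      using i1 i3 by simp
    also have "(\<integral>x. (g x \<bullet> b) * (a x * \<phi> x) + blinfun_apply (a' x) b * f x * \<phi> x \<partial>lebesgue_on \<Omega>) = (\<integral>x. (h x \<bullet> b) * \<phi> x \<partial>lebesgue_on \<Omega>)"
      by (intro Bochner_Integration.integral_cong refl) (simp add: hb[OF b] algebra_simps)
    finally show ?thesis .
  qed
  ultimately show ?thesis unfolding has_weak_gradient_def by blast
qed

lemma C1_closure_bounded_linear:
  assumes L: "bounded_linear L" and A: "C1_closure \<Omega> A"
  shows "C1_closure \<Omega> (\<lambda>x. L (A x))"
proof -
  obtain A' where A': "continuous_on (closure \<Omega>) A" "continuous_on (closure \<Omega>) A'"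
    "\<And>x. x \<in> \<Omega> \<Longrightarrow> (A has_derivative blinfun_apply (A' x)) (at x)"
    using A unfolding C1_closure_def by blast
  show ?thesis
    unfolding C1_closure_def
  proof (intro conjI exI[of _ "\<lambda>x. Blinfun L o\<^sub>L A' x"] ballI)
    show "continuous_on (closure \<Omega>) (\<lambda>x. L (A x))"
      by (rule bounded_linear.continuous_on[OF L A'(1)])
    show "continuous_on (closure \<Omega>) (\<lambda>x. Blinfun L o\<^sub>L A' x)"
      by (intro continuous_intros A')
    show "((\<lambda>x. L (A x)) has_derivative blinfun_apply (Blinfun L o\<^sub>L A' x)) (at x)" if "x \<in> \<Omega>" for x
      using bounded_linear.has_derivative[OF L A'(3)[OF that]]
      by (simp add: blinfun_compose.rep_eq bounded_linear_Blinfun_apply[OF L] o_def)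
  qed
qed

text \<open>Since \<open>weak_grad\<close> is a choice, the existence of a weak gradient already
  makes it one.\<close>

lemma residual_has_weak_gradient:
  fixes u m :: "'a::euclidean_space \<Rightarrow> real^'n"
  assumes \<Omega>: "open \<Omega>" and A: "C1_closure \<Omega> A" and m: "C1_closure \<Omega> m"
    and u: "\<And>i. \<exists>g. has_weak_gradient \<Omega> (\<lambda>x. u x $ i) g"
  shows "has_weak_gradient \<Omega> (\<lambda>x. residual A m u x $ i) (weak_grad \<Omega> (\<lambda>x. residual A m u x $ i))"
proof -
  have \<Omega>s: "\<Omega> \<in> sets lebesgue" using \<Omega> by simp
  have a: "C1_closure \<Omega> (\<lambda>x. - (A x $ i $ j))" for j
    by (rule C1_closure_bounded_linear[OF _ A])
      (intro bounded_linear_minus bounded_linear_compose[OF bounded_linear_vec_nth] bounded_linear_vec_nth)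
  have "\<exists>g. has_weak_gradient \<Omega> (\<lambda>x. m x $ i * 1) g"
    by (rule has_weak_gradient_mult_C1[OF \<Omega> has_weak_gradient_const[OF \<Omega>s]])
      (rule C1_closure_bounded_linear[OF bounded_linear_vec_nth m])
  then have m1: "\<exists>g. has_weak_gradient \<Omega> (\<lambda>x. m x $ i) g" by simp
  have "\<exists>g. has_weak_gradient \<Omega> (\<lambda>x. m x $ i + (\<Sum>j\<in>J. - (A x $ i $ j) * u x $ j)) g" if "finite J" for J
    using that
  proof (induction J)
    case (insert j J)
    obtain g1 where g1: "has_weak_gradient \<Omega> (\<lambda>x. m x $ i + (\<Sum>j\<in>J. - (A x $ i $ j) * u x $ j)) g1"
      using insert.IH by blast
    obtain g2 where g2: "has_weak_gradient \<Omega> (\<lambda>x. - (A x $ i $ j) * u x $ j) g2"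
      using has_weak_gradient_mult_C1[OF \<Omega> _ a] u by blast
    show ?case using has_weak_gradient_add[OF \<Omega>s g1 g2] insert.hyps by (auto simp: algebra_simps)
  qed (use m1 in simp)
  from this[of UNIV] have "\<exists>g. has_weak_gradient \<Omega> (\<lambda>x. residual A m u x $ i) g"
    by (simp add: residual_nth sum_negf)
  then show ?thesis unfolding weak_grad_def by (rule someI_ex)
qed

lemma weak_gradient_divergence:
  fixes T :: "'a::euclidean_space \<Rightarrow> 'a"
  assumes \<Omega>: "\<Omega> \<in> sets lebesgue" and w: "has_weak_gradient \<Omega> v g" and T: "C1_test \<Omega> T"
  shows "integrable (lebesgue_on \<Omega>) (\<lambda>x. v x * divergence T x)" "integrable (lebesgue_on \<Omega>) (\<lambda>x. g x \<bullet> T x)"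
    "(\<integral>x. v x * divergence T x \<partial>lebesgue_on \<Omega>) = - (\<integral>x. g x \<bullet> T x \<partial>lebesgue_on \<Omega>)"
proof -
  have l: "locally_integrable \<Omega> v" "locally_integrable \<Omega> g" using w by (auto simp: has_weak_gradient_def)
  obtain K where K: "compact K" "K \<subseteq> \<Omega>" "C1_supported K T" using T unfolding C1_test_def by blast
  obtain T' B where T': "continuous_on UNIV T'" "\<And>x. (T has_derivative blinfun_apply (T' x)) (at x)"
    "\<And>x. x \<notin> K \<Longrightarrow> T x = 0" "\<And>x. x \<notin> K \<Longrightarrow> T' x = 0"
    and B: "\<And>x. norm (T' x) \<le> B" "\<And>x. norm (T x) \<le> B"
    and fr: "\<And>x. frechet_derivative T (at x) = blinfun_apply (T' x)"
    using C1_supported_derivative[OF K(1,3)] by metis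
  have tb: "C1_test \<Omega> (\<lambda>x. T x \<bullet> b)" and fb: "frechet_derivative (\<lambda>x. T x \<bullet> b) (at x) h = frechet_derivative T (at x) h \<bullet> b" for b x h
  proof -
    have d: "((\<lambda>x. T x \<bullet> b) has_derivative blinfun_apply (blinfun_inner_left b o\<^sub>L T' x)) (at x)" for x
      using has_derivative_inner_left[OF T'(2)] by (simp add: blinfun_compose.rep_eq o_def)
    have "continuous_on UNIV (\<lambda>x. blinfun_inner_left b o\<^sub>L T' x)" by (intro continuous_intros T')
    with d have "C1_supported K (\<lambda>x. T x \<bullet> b)"
      unfolding C1_supported_def using T'(3) by auto
    then show "C1_test \<Omega> (\<lambda>x. T x \<bullet> b)"
      unfolding C1_test_def using K(1,2) by blast
    show "frechet_derivative (\<lambda>x. T x \<bullet> b) (at x) h = frechet_derivative T (at x) h \<bullet> b"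
      using frechet_derivative_at[OF d[of x], symmetric] by (simp add: fr blinfun_compose.rep_eq)
  qed
  have e1: "v x * divergence T x = (\<Sum>b\<in>Basis. v x * frechet_derivative (\<lambda>x. T x \<bullet> b) (at x) b)" for x
    unfolding divergence_def fb sum_distrib_left ..
  have e2: "g x \<bullet> T x = (\<Sum>b\<in>Basis. (g x \<bullet> b) * (T x \<bullet> b))" for x
    by (rule euclidean_inner)
  note i = integrable_test_pairings[OF \<Omega> l tb]
  show "integrable (lebesgue_on \<Omega>) (\<lambda>x. v x * divergence T x)" "integrable (lebesgue_on \<Omega>) (\<lambda>x. g x \<bullet> T x)"
    unfolding e1 e2 by (intro Bochner_Integration.integrable_sum i)+
  have "(\<integral>x. v x * divergence T x \<partial>lebesgue_on \<Omega>) = (\<Sum>b\<in>Basis. \<integral>x. v x * frechet_derivative (\<lambda>x. T x \<bullet> b) (at x) b \<partial>lebesgue_on \<Omega>)"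
    unfolding e1 by (intro Bochner_Integration.integral_sum i)
  also have "\<dots> = (\<Sum>b\<in>Basis. - (\<integral>x. (g x \<bullet> b) * (T x \<bullet> b) \<partial>lebesgue_on \<Omega>))"
    using w tb unfolding has_weak_gradient_def by (intro sum.cong refl) blast
  also have "\<dots> = - (\<integral>x. g x \<bullet> T x \<partial>lebesgue_on \<Omega>)"
    unfolding e2 sum_negf by (subst Bochner_Integration.integral_sum) (auto intro: i)
  finally show "(\<integral>x. v x * divergence T x \<partial>lebesgue_on \<Omega>) = - (\<integral>x. g x \<bullet> T x \<partial>lebesgue_on \<Omega>)" .
qed

lemma has_weak_gradient_chain:
  fixes f :: "'a::euclidean_space \<Rightarrow> real^'n" and \<Phi> :: "real^'n \<Rightarrow> real"
  assumes \<Omega>: "open \<Omega>" and w: "\<And>i. has_weak_gradient \<Omega> (\<lambda>x. f x $ i) (g i)"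
    and \<Phi>: "\<And>y. (\<Phi> has_derivative (\<lambda>h. \<Phi>' y \<bullet> h)) (at y)" "continuous_on UNIV \<Phi>'" "\<And>y. norm (\<Phi>' y) \<le> L"
    and bd: "\<And>y. \<bar>\<Phi> y\<bar> \<le> B"
  shows "has_weak_gradient \<Omega> (\<lambda>x. \<Phi> (f x)) (\<lambda>x. \<Sum>i\<in>UNIV. \<Phi>' (f x) $ i *\<^sub>R g i x)"
  unfolding has_weak_gradient_def
proof (intro conjI allI impI ballI)
  have cont: "continuous_on UNIV \<Phi>"
    using \<Phi>(1) by (meson has_derivative_continuous continuous_at_imp_continuous_on)
  then have [measurable]: "\<Phi> \<in> borel_measurable borel" "\<Phi>' \<in> borel_measurable borel"
    by (intro borel_measurable_continuous_onI \<Phi>(2); assumption)+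
  have m: "f \<in> borel_measurable (lebesgue_on K)" and gi: "integrable (lebesgue_on K) (g i)"
    if "compact K" "K \<subseteq> \<Omega>" for K i
  proof -
    have "\<forall>i. integrable (lebesgue_on K) (\<lambda>x. f x $ i)"
      using w that by (auto simp: has_weak_gradient_def locally_integrable_def)
    then show "f \<in> borel_measurable (lebesgue_on K)" by (intro borel_measurable_integrable) (simp add: integrable_vec_iff)
    show "integrable (lebesgue_on K) (g i)"
      using w that by (auto simp: has_weak_gradient_def locally_integrable_def)
  qed
  show "locally_integrable \<Omega> (\<lambda>x. \<Phi> (f x))"
    unfolding locally_integrable_def
  proof safe
    fix K assume K: "compact K" "K \<subseteq> \<Omega>"
    note [measurable] = m[OF K]
    interpret finite_measure "lebesgue_on K" using K lmeasurable_compact finite_measure_lebesgue_on by blast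
    show "integrable (lebesgue_on K) (\<lambda>x. \<Phi> (f x))"
      by (rule integrable_const_bound[where B = B]) (use bd in auto)
  qed
  show "locally_integrable \<Omega> (\<lambda>x. \<Sum>i\<in>UNIV. \<Phi>' (f x) $ i *\<^sub>R g i x)"
    unfolding locally_integrable_def
  proof safe
    fix K assume K: "compact K" "K \<subseteq> \<Omega>"
    note [measurable] = m[OF K]
    have [measurable]: "(\<lambda>x. \<Phi>' (f x) $ i) \<in> borel_measurable (lebesgue_on K)" for i
      by (rule measurable_compose[of f _ borel "\<lambda>y. \<Phi>' y $ i"])
        (simp, intro borel_measurable_continuous_onI continuous_intros \<Phi>(2))
    show "integrable (lebesgue_on K) (\<lambda>x. \<Sum>i\<in>UNIV. \<Phi>' (f x) $ i *\<^sub>R g i x)"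
      using gi[OF K] order_trans[OF component_le_norm_cart \<Phi>(3)]
      by (intro Bochner_Integration.integrable_sum integrable_bounded_scaleR[where B = L]) auto
  qed
  fix \<phi> :: "'a \<Rightarrow> real" and b :: 'a assume t: "C1_test \<Omega> \<phi>" "b \<in> Basis"
  show "(\<integral>x. \<Phi> (f x) * frechet_derivative \<phi> (at x) b \<partial>lebesgue_on \<Omega>) =
    - (\<integral>x. ((\<Sum>i\<in>UNIV. \<Phi>' (f x) $ i *\<^sub>R g i x) \<bullet> b) * \<phi> x \<partial>lebesgue_on \<Omega>)"
    by (rule weak_chain_rule_test[OF \<Omega> w \<Phi> t])
qed

section \<open>Level sets and perimeter\<close>

lemma pos_part_square_derivative: "((\<lambda>r. (max 0 r)\<^sup>2) has_real_derivative 2 * max 0 r) (at r)" for r :: real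
  unfolding has_field_derivative_def
proof (rule has_derivative_quadratic_remainder[where C = 1])
  fix t :: real
  show "norm ((max 0 (r + t))\<^sup>2 - (max 0 r)\<^sup>2 - 2 * max 0 r * t) \<le> 1 * (norm t)\<^sup>2"
    using pos_part_square_remainder[of r t] by simp
qed (rule bounded_linear_mult_right)

text \<open>A \<open>C\<^sup>1\<close> step from \<open>0\<close> at \<open>0\<close> to
  \<open>1\<close> at \<open>1\<close> whose derivative is a tent function of height
  \<open>2\<close>.\<close>

definition smooth_step :: "real \<Rightarrow> real" where
  "smooth_step r = 2 * (max 0 r)\<^sup>2 - 4 * (max 0 (r - 1 / 2))\<^sup>2 + 2 * (max 0 (r - 1))\<^sup>2"

definition smooth_step' :: "real \<Rightarrow> real" where
  "smooth_step' r = 4 * max 0 r - 8 * max 0 (r - 1 / 2) + 4 * max 0 (r - 1)"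

lemma smooth_step_derivative: "(smooth_step has_real_derivative smooth_step' r) (at r)"
proof -
  have "((\<lambda>r. (max 0 (r - c))\<^sup>2) has_real_derivative 2 * max 0 (r - c) * 1) (at r)" for c :: real
    by (rule DERIV_chain2[OF pos_part_square_derivative]) (auto intro!: derivative_eq_intros)
  note d = this
  have "((\<lambda>r. 2 * (max 0 (r - 0))\<^sup>2 - 4 * (max 0 (r - 1 / 2))\<^sup>2 + 2 * (max 0 (r - 1))\<^sup>2) has_real_derivative
      2 * (2 * max 0 (r - 0) * 1) - 4 * (2 * max 0 (r - 1 / 2) * 1) + 2 * (2 * max 0 (r - 1) * 1)) (at r)"
    by (intro DERIV_add DERIV_diff DERIV_cmult d)
  then show ?thesis
    unfolding smooth_step_def[abs_def] smooth_step'_def by simp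
qed

lemma smooth_step_values:
  "r \<le> 0 \<Longrightarrow> smooth_step r = 0" "r \<ge> 1 \<Longrightarrow> smooth_step r = 1"
  "0 \<le> smooth_step r" "smooth_step r \<le> 1"
  "r \<le> 0 \<or> r \<ge> 1 \<Longrightarrow> smooth_step' r = 0" "\<bar>smooth_step' r\<bar> \<le> 2"
proof -
  show "smooth_step r = 0" if "r \<le> 0" using that by (simp add: smooth_step_def)
  show *: "smooth_step r = 1" if "r \<ge> 1"
    using that by (simp add: smooth_step_def power2_eq_square algebra_simps)
  have low: "smooth_step r = 2 * r\<^sup>2" if "0 \<le> r" "r \<le> 1/2" using that by (simp add: smooth_step_def)
  have high: "smooth_step r = 1 - 2 * (1 - r)\<^sup>2" if "1/2 \<le> r" "r \<le> 1"
    using that by (simp add: smooth_step_def power2_eq_square algebra_simps)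
  have sq: "s\<^sup>2 \<le> 1/4" if "0 \<le> s" "s \<le> 1/2" for s :: real
    using power_mono[OF that(2,1), of 2] by (simp add: power2_eq_square)
  consider "r \<le> 0" | "0 \<le> r" "r \<le> 1/2" | "1/2 \<le> r" "r \<le> 1" | "r \<ge> 1" by linarith
  then have "0 \<le> smooth_step r \<and> smooth_step r \<le> 1"
  proof cases
    case 1 then show ?thesis by (simp add: smooth_step_def)
  next
    case 2 then show ?thesis using sq[of r] low by simp
  next
    case 3 then show ?thesis using sq[of "1 - r"] high by simp
  qed (simp add: *)
  then show "0 \<le> smooth_step r" "smooth_step r \<le> 1" by auto
  show "r \<le> 0 \<or> r \<ge> 1 \<Longrightarrow> smooth_step' r = 0" "\<bar>smooth_step' r\<bar> \<le> 2"
    by (auto simp: smooth_step'_def max_def)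
qed

lemma continuous_on_smooth_step'[continuous_intros]:
  "continuous_on S h \<Longrightarrow> continuous_on S (\<lambda>x. smooth_step' (h x))"
  unfolding smooth_step'_def by (intro continuous_intros)

lemma locally_integrable_measurable:
  fixes g :: "'a::euclidean_space \<Rightarrow> 'b::euclidean_space"
  assumes \<Omega>: "open \<Omega>" and g: "locally_integrable \<Omega> g"
  shows "g \<in> borel_measurable (lebesgue_on \<Omega>)"
proof -
  obtain C :: "nat \<Rightarrow> 'a set" where C: "\<And>n. compact (C n)" "\<And>n. C n \<subseteq> \<Omega>" "\<Union>(range C) = \<Omega>"
    using open_Union_compact_subsets[OF \<Omega>] by metis
  show ?thesis
  proof (rule measurable_piecewise_restrict[where C = "range C"])
    fix K assume K: "K \<in> range C"
    then have K': "compact K" "K \<subseteq> \<Omega>" using C by auto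
    have s: "K \<in> sets lebesgue" "\<Omega> \<in> sets lebesgue" using K' \<Omega> by (auto simp: compact_imp_closed)
    then show "K \<inter> space (lebesgue_on \<Omega>) \<in> sets (lebesgue_on \<Omega>)"
      using K' by (simp add: sets_restrict_space_iff Int_absorb2)
    have "restrict_space (lebesgue_on \<Omega>) K = lebesgue_on K"
      using s K' by (subst restrict_restrict_space) (auto simp: Int_absorb1)
    then show "g \<in> borel_measurable (restrict_space (lebesgue_on \<Omega>) K)"
      using g K' by (auto simp: locally_integrable_def dest: borel_measurable_integrable)
  qed (use C in auto)
qed

lemma emeasure_levels_le:
  fixes s e :: real
  assumes "e > 0"
  shows "emeasure lborel {\<tau>. 0 < \<tau> \<and> \<tau> < t \<and> \<tau> < s \<and> s < \<tau> + e} \<le> ennreal e"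
proof -
  have "emeasure lborel {\<tau>. 0 < \<tau> \<and> \<tau> < t \<and> \<tau> < s \<and> s < \<tau> + e} \<le> emeasure lborel {s - e<..<s}"
    by (intro emeasure_mono) auto
  then show ?thesis using assms by simp
qed

lemma gauss_green_eq:
  assumes \<Omega>: "\<Omega> \<in> sets lebesgue" and E: "E \<in> sets lebesgue" "E \<subseteq> \<Omega>"
  shows "gauss_green E T = (\<integral>x. indicator E x * divergence T x \<partial>lebesgue_on \<Omega>)"
proof -
  have "gauss_green E T = (\<integral>x. indicator E x * divergence T x \<partial>lebesgue)"
    unfolding gauss_green_def using E by (simp add: integral_restrict_space)
  also have "\<dots> = (\<integral>x. indicator \<Omega> x *\<^sub>R (indicator E x * divergence T x) \<partial>lebesgue)"
    using E by (intro Bochner_Integration.integral_cong refl) (auto simp: indicator_def)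
  finally show ?thesis using \<Omega> by (simp add: integral_restrict_space)
qed

lemma divergence_integrable:
  assumes \<Omega>: "\<Omega> \<in> sets lebesgue" and T: "C1_test \<Omega> T"
  shows "integrable (lebesgue_on \<Omega>) (divergence T)" "(\<integral>x. divergence T x \<partial>lebesgue_on \<Omega>) = 0"
  using weak_gradient_divergence[OF \<Omega> has_weak_gradient_const[OF \<Omega>, of 1] T] by auto

text \<open>The indicator of the set where all \<open>q\<^sub>k(f\<^sub>k)\<close> exceed
  \<open>\<tau>\<close> is replaced by a product of steps of width \<open>e\<close>. In the gradient
  of the product the term of \<open>f\<^sub>k\<close> lives where
  \<open>q\<^sub>k(f\<^sub>k)\<close> is between \<open>\<tau>\<close> and \<open>\<tau> + e\<close>
  and where the other steps do not vanish.\<close>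

lemma smoothed_level_set_gauss_green:
  fixes f :: "'a::euclidean_space \<Rightarrow> real^'n"
  assumes \<Omega>: "open \<Omega>" and w: "\<And>k. has_weak_gradient \<Omega> (\<lambda>x. f x $ k) (g k)"
    and q: "\<And>k s. (q k has_real_derivative q' k s) (at s)" "\<And>k. continuous_on UNIV (q' k)"
    and L: "\<And>k s. 0 \<le> q k s \<Longrightarrow> q k s \<le> t \<Longrightarrow> \<bar>q' k s\<bar> \<le> L"
    and \<tau>: "\<tau> > 0" "e > 0" "\<tau> + e \<le> t"
    and T: "C1_test \<Omega> T" "\<And>x. norm (T x) \<le> 1"
  shows "ennreal \<bar>\<integral>x. (\<Prod>k\<in>UNIV. smooth_step ((q k (f x $ k) - \<tau>) / e)) * divergence T x \<partial>lebesgue_on \<Omega>\<bar> \<le>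
    ennreal (2 * L) * (\<integral>\<^sup>+x. (\<Sum>k\<in>UNIV. ennreal (1 / e) * indicator {s. \<tau> < s \<and> s < \<tau> + e} (q k (f x $ k)) *
       (indicator {x. \<forall>l. l \<noteq> k \<longrightarrow> q l (f x $ l) > 0} x * ennreal (norm (g k x)))) \<partial>lebesgue_on \<Omega>)"
proof -
  let ?t = "\<lambda>k x. ennreal (1 / e) * indicator {s. \<tau> < s \<and> s < \<tau> + e} (q k (f x $ k)) *
       (indicator {x. \<forall>l. l \<noteq> k \<longrightarrow> q l (f x $ l) > 0} x * ennreal (norm (g k x)))"
  let ?b = "\<lambda>x. \<Sum>k\<in>UNIV. ?t k x"
  let ?s = "\<lambda>k y. smooth_step ((q k (y $ k) - \<tau>) / e)"
  define \<Phi> where "\<Phi> y = (\<Prod>k\<in>UNIV. ?s k y)" for y :: "real^'n"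
  define d where "d k y = smooth_step' ((q k (y $ k) - \<tau>) / e) * (q' k (y $ k) / e)" for k and y :: "real^'n"
  define \<Phi>' where "\<Phi>' y = (\<chi> k. d k y * (\<Prod>l\<in>UNIV - {k}. ?s l y))" for y
  have c: "continuous_on UNIV (q k)" for k
    using q(1) by (meson DERIV_continuous continuous_at_imp_continuous_on)
  have cs: "continuous_on UNIV smooth_step"
    using smooth_step_derivative by (meson DERIV_continuous continuous_at_imp_continuous_on)
  have cq: "continuous_on UNIV (\<lambda>y::real^'n. q k (y $ k))" "continuous_on UNIV (\<lambda>y::real^'n. q' k (y $ k))" for k
    by (rule continuous_on_compose2[OF c] continuous_on_compose2[OF q(2)], auto intro!: continuous_intros)+
  have "((\<lambda>y. ?s k y) has_derivative (\<lambda>h. d k y * h $ k)) (at y)" for k and y :: "real^'n"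
  proof -
    have "((\<lambda>s. smooth_step ((q k s - \<tau>) / e)) has_real_derivative d k y) (at (y $ k))"
      unfolding d_def
      by (rule DERIV_chain2[OF smooth_step_derivative]) (use q(1) \<tau>(2) in \<open>auto intro!: derivative_eq_intros\<close>)
    then have "((\<lambda>s. smooth_step ((q k s - \<tau>) / e)) has_derivative (*) (d k y)) (at (y $ k))"
      by (simp add: has_field_derivative_def)
    from has_derivative_compose[OF bounded_linear_imp_has_derivative[OF bounded_linear_vec_nth] this] show ?thesis .
  qed
  then have "(\<Phi> has_derivative (\<lambda>h. \<Sum>k\<in>UNIV. (d k y * h $ k) * (\<Prod>l\<in>UNIV - {k}. ?s l y))) (at y)" for y
    unfolding \<Phi>_def[abs_def] by (intro has_derivative_prod) auto
  then have \<Phi>: "(\<Phi> has_derivative (\<lambda>h. \<Phi>' y \<bullet> h)) (at y)" for y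
    unfolding \<Phi>'_def inner_vec_def by (simp add: mult_ac)
  have c\<Phi>': "continuous_on UNIV \<Phi>'"
    unfolding \<Phi>'_def d_def
    by (intro continuous_on_vec_lambda continuous_intros cq continuous_on_compose2[OF cs]) (use \<tau> in auto)
  have L0: "\<bar>d k y\<bar> \<le> 2 * \<bar>L\<bar> / e" for k y
  proof (cases "\<tau> < q k (y $ k) \<and> q k (y $ k) < \<tau> + e")
    case True
    then have "\<bar>q' k (y $ k)\<bar> \<le> \<bar>L\<bar>" using L[of k "y $ k"] \<tau> by force
    then have "\<bar>smooth_step' ((q k (y $ k) - \<tau>) / e)\<bar> * (\<bar>q' k (y $ k)\<bar> / e) \<le> 2 * (\<bar>L\<bar> / e)"
      using smooth_step_values(6) \<tau> by (intro mult_mono divide_right_mono) auto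
    then show ?thesis using \<tau> by (simp add: d_def abs_mult)
  next
    case False
    then have "smooth_step' ((q k (y $ k) - \<tau>) / e) = 0"
      using \<tau> by (intro smooth_step_values(5)) (auto simp: divide_le_0_iff)
    then show ?thesis using \<tau> by (simp add: d_def)
  qed
  have \<Phi>'_le: "\<bar>\<Phi>' y $ k\<bar> \<le> 2 * \<bar>L\<bar> / e" for y k
  proof -
    have "\<bar>\<Phi>' y $ k\<bar> = \<bar>d k y\<bar> * (\<Prod>l\<in>UNIV - {k}. ?s l y)"
      by (simp add: \<Phi>'_def abs_mult abs_prod smooth_step_values)
    also have "\<dots> \<le> (2 * \<bar>L\<bar> / e) * 1"
      using L0 \<tau> by (intro mult_mono prod_le_1 prod_nonneg) (auto simp: smooth_step_values)
    finally show ?thesis by simp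
  qed
  have "norm (\<Phi>' y) \<le> (\<Sum>k\<in>(UNIV::'n set). 2 * \<bar>L\<bar> / e)" for y
    by (rule order_trans[OF norm_le_l1_cart sum_mono[OF \<Phi>'_le]])
  moreover have "\<bar>\<Phi> y\<bar> \<le> 1" for y
    unfolding \<Phi>_def abs_prod by (intro prod_le_1) (auto simp: smooth_step_values)
  ultimately have wg: "has_weak_gradient \<Omega> (\<lambda>x. \<Phi> (f x)) (\<lambda>x. \<Sum>i\<in>UNIV. \<Phi>' (f x) $ i *\<^sub>R g i x)"
    by (rule has_weak_gradient_chain[OF \<Omega> w \<Phi> c\<Phi>'])
  have \<Omega>s: "\<Omega> \<in> sets lebesgue" using \<Omega> by simp
  note div = weak_gradient_divergence[OF \<Omega>s wg T(1)]
  have point: "ennreal (norm ((\<Sum>i\<in>UNIV. \<Phi>' (f x) $ i *\<^sub>R g i x) \<bullet> T x)) \<le>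
    ennreal (2 * L) * ?b x" for x
  proof -
    have "norm ((\<Sum>i\<in>UNIV. \<Phi>' (f x) $ i *\<^sub>R g i x) \<bullet> T x) \<le> norm (\<Sum>i\<in>UNIV. \<Phi>' (f x) $ i *\<^sub>R g i x) * norm (T x)"
      using Cauchy_Schwarz_ineq2 by simp
    also have "\<dots> \<le> norm (\<Sum>i\<in>UNIV. \<Phi>' (f x) $ i *\<^sub>R g i x) * 1"
      using T(2) by (intro mult_left_mono) auto
    also have "\<dots> \<le> (\<Sum>i\<in>UNIV. \<bar>\<Phi>' (f x) $ i\<bar> * norm (g i x))"
      using norm_sum[of "\<lambda>i. \<Phi>' (f x) $ i *\<^sub>R g i x" UNIV] by simp
    finally have "ennreal (norm ((\<Sum>i\<in>UNIV. \<Phi>' (f x) $ i *\<^sub>R g i x) \<bullet> T x)) \<le> (\<Sum>i\<in>UNIV. ennreal (\<bar>\<Phi>' (f x) $ i\<bar> * norm (g i x)))"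
      by (subst sum_ennreal) (auto intro: ennreal_leI)
    also have "\<dots> \<le> (\<Sum>k\<in>UNIV. ennreal (2 * L) * ?t k x)"
    proof (rule sum_mono)
      fix k
      show "ennreal (\<bar>\<Phi>' (f x) $ k\<bar> * norm (g k x)) \<le> ennreal (2 * L) * ?t k x"
      proof (cases "(\<tau> < q k (f x $ k) \<and> q k (f x $ k) < \<tau> + e) \<and> (\<forall>l. l \<noteq> k \<longrightarrow> q l (f x $ l) > 0)")
        case True
        then have "0 \<le> L" using L[of k "f x $ k"] \<tau> by force
        then show ?thesis
          using True mult_right_mono[OF \<Phi>'_le[of "f x" k] norm_ge_zero[of "g k x"]] \<tau>
          by (auto simp flip: ennreal_mult simp: mult.assoc[symmetric] intro!: ennreal_leI)
      next
        case False
        have "\<Phi>' (f x) $ k = 0"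
        proof (cases "\<tau> < q k (f x $ k) \<and> q k (f x $ k) < \<tau> + e")
          case True
          with False obtain l where l: "l \<noteq> k" "q l (f x $ l) \<le> 0" by (auto simp: not_less)
          then have "?s l (f x) = 0" using \<tau> by (intro smooth_step_values(1)) (auto simp: divide_le_0_iff)
          then have "(\<Prod>l\<in>UNIV - {k}. ?s l (f x)) = 0" using l(1) by (intro prod_zero) auto
          then show ?thesis by (simp add: \<Phi>'_def)
        next
          case False
          then have "smooth_step' ((q k (f x $ k) - \<tau>) / e) = 0"
            using \<tau> by (intro smooth_step_values(5)) (auto simp: divide_le_0_iff)
          then show ?thesis by (simp add: \<Phi>'_def d_def)
        qed
        then show ?thesis by simp
      qed
    qed
    finally show ?thesis by (simp add: sum_distrib_left)
  qed
  have "ennreal \<bar>\<integral>x. \<Phi> (f x) * divergence T x \<partial>lebesgue_on \<Omega>\<bar> = ennreal (norm (\<integral>x. (\<Sum>i\<in>UNIV. \<Phi>' (f x) $ i *\<^sub>R g i x) \<bullet> T x \<partial>lebesgue_on \<Omega>))"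
    by (simp add: div(3))
  also have "\<dots> \<le> (\<integral>\<^sup>+x. norm ((\<Sum>i\<in>UNIV. \<Phi>' (f x) $ i *\<^sub>R g i x) \<bullet> T x) \<partial>lebesgue_on \<Omega>)"
    by (rule integral_norm_bound_ennreal[OF div(2)])
  also have "\<dots> \<le> (\<integral>\<^sup>+x. ennreal (2 * L) * ?b x \<partial>lebesgue_on \<Omega>)"
    by (rule nn_integral_mono[OF point])
  also have "\<dots> = ennreal (2 * L) * (\<integral>\<^sup>+x. ?b x \<partial>lebesgue_on \<Omega>)"
  proof (rule nn_integral_cmult)
    have [measurable]: "(\<lambda>x. f x $ k) \<in> borel_measurable (lebesgue_on \<Omega>)" "g k \<in> borel_measurable (lebesgue_on \<Omega>)" for k
      using w[of k] by (auto simp: has_weak_gradient_def intro!: locally_integrable_measurable \<Omega>)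
    have [measurable]: "q k \<in> borel_measurable borel" for k using c by (rule borel_measurable_continuous_onI)
    show "(\<lambda>x. ?b x) \<in> borel_measurable (lebesgue_on \<Omega>)"
      unfolding indicator_def mem_Collect_eq by measurable
  qed
  finally show ?thesis unfolding \<Phi>_def .
qed

text \<open>A substitute for the coarea formula. Integrated over the levels, the bounds for the
  smoothed sets are at most the gradient integral over the transition layer (Tonelli). By Fatou's
  lemma some level has a small lower limit of these bounds as the width tends to \<open>0\<close>,
  and this limit bounds the perimeter.\<close>

lemma exists_level_of_small_perimeter:
  fixes f :: "'a::euclidean_space \<Rightarrow> real^'n"
  assumes \<Omega>: "open \<Omega>" "bounded \<Omega>" and w: "\<And>k. has_weak_gradient \<Omega> (\<lambda>x. f x $ k) (g k)"
    and q: "\<And>k s. (q k has_real_derivative q' k s) (at s)" "\<And>k. continuous_on UNIV (q' k)"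
    and L: "\<And>k s. 0 \<le> q k s \<Longrightarrow> q k s \<le> t \<Longrightarrow> \<bar>q' k s\<bar> \<le> L" "L > 0" and t: "t > 0"
    and \<beta>: "(\<integral>\<^sup>+x. (\<Sum>k\<in>UNIV. indicator {x. (\<forall>l. q l (f x $ l) > 0) \<and> q k (f x $ k) < t} x * ennreal (norm (g k x))) \<partial>lebesgue_on \<Omega>) \<le> ennreal \<beta>" "\<beta> > 0"
  shows "\<exists>\<tau>. 0 < \<tau> \<and> \<tau> < t \<and> {x\<in>\<Omega>. \<forall>k. q k (f x $ k) > \<tau>} \<in> sets lebesgue \<and>
     perimeter {x\<in>\<Omega>. \<forall>k. q k (f x $ k) > \<tau>} \<Omega> \<le> ereal (4 * L * \<beta> / t)"
proof -
  let ?s = "\<lambda>x. (\<Sum>k\<in>UNIV. indicator {x. (\<forall>l. q l (f x $ l) > 0) \<and> q k (f x $ k) < t} x * ennreal (norm (g k x)))"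
  let ?M = "lebesgue_on \<Omega>"
  have \<Omega>s: "\<Omega> \<in> sets lebesgue" using \<Omega>(1) by simp
  have \<Omega>l: "\<Omega> \<in> lmeasurable" using \<Omega> by (simp add: lmeasurable_open)
  interpret M: finite_measure ?M using \<Omega>l by (rule finite_measure_lebesgue_on)
  interpret P: pair_sigma_finite lborel ?M ..
  have fm[measurable]: "(\<lambda>x. f x $ k) \<in> borel_measurable ?M" and gm[measurable]: "g k \<in> borel_measurable ?M" for k
    using w[of k] by (auto simp: has_weak_gradient_def intro!: locally_integrable_measurable \<Omega>)
  have cq: "continuous_on UNIV (q k)" for k
    using q(1) by (meson DERIV_continuous continuous_at_imp_continuous_on)
  have [measurable]: "q k \<in> borel_measurable borel" for k using cq by (rule borel_measurable_continuous_onI)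
  define h where "h k x = indicator {x. \<forall>l. l \<noteq> k \<longrightarrow> q l (f x $ l) > 0} x * ennreal (norm (g k x))" for k x
  have hm[measurable]: "h k \<in> borel_measurable ?M" for k
    unfolding h_def indicator_def mem_Collect_eq by measurable
  define e where "e n = 1 / real (Suc n)" for n
  have e: "e n > 0" for n by (simp add: e_def)
  define V where "V n \<tau> x = (\<Sum>k\<in>UNIV. ennreal (1 / e n) * indicator {s. \<tau> < s \<and> s < \<tau> + e n} (q k (f x $ k)) * h k x)" for n \<tau> x
  define W where "W n \<tau> = (\<integral>\<^sup>+x. V n \<tau> x \<partial>?M)" for n \<tau>
  \<comment> \<open>the levels whose layer of width e n stays below t\<close>
  define I where "I n = {\<tau>. 0 < \<tau> \<and> \<tau> + e n < t}" for n
  have Vm[measurable]: "(\<lambda>(\<tau>, x). V n \<tau> x) \<in> borel_measurable (lborel \<Otimes>\<^sub>M ?M)" for n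
    unfolding V_def indicator_def mem_Collect_eq by measurable
  have Im[measurable]: "I n \<in> sets borel" for n unfolding I_def by measurable
  have Wm[measurable]: "W n \<in> borel_measurable lborel" for n
    unfolding W_def[abs_def] by measurable
  have int: "(\<integral>\<^sup>+\<tau>. indicator (I n) \<tau> * W n \<tau> \<partial>lborel) \<le> ennreal \<beta>" for n
  proof -
    have "(\<integral>\<^sup>+\<tau>. indicator (I n) \<tau> * W n \<tau> \<partial>lborel) = (\<integral>\<^sup>+\<tau>. (\<integral>\<^sup>+x. indicator (I n) \<tau> * V n \<tau> x \<partial>?M) \<partial>lborel)"
      unfolding W_def by (intro nn_integral_cong nn_integral_cmult[symmetric]) (simp add: V_def)
    also have "\<dots> = (\<integral>\<^sup>+x. (\<integral>\<^sup>+\<tau>. indicator (I n) \<tau> * V n \<tau> x \<partial>lborel) \<partial>?M)"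
      by (rule P.Fubini'[symmetric]) measurable
    also have "\<dots> \<le> (\<integral>\<^sup>+x. ?s x \<partial>?M)"
    proof (rule nn_integral_mono)
      fix x
      have "(\<integral>\<^sup>+\<tau>. indicator (I n) \<tau> * V n \<tau> x \<partial>lborel) =
        (\<integral>\<^sup>+\<tau>. (\<Sum>k\<in>UNIV. (ennreal (1 / e n) * h k x) * indicator {\<tau>. \<tau> \<in> I n \<and> \<tau> < q k (f x $ k) \<and> q k (f x $ k) < \<tau> + e n} \<tau>) \<partial>lborel)"
        unfolding V_def sum_distrib_left by (intro nn_integral_cong sum.cong) (auto simp: indicator_def)
      also have "\<dots> = (\<Sum>k\<in>UNIV. (ennreal (1 / e n) * h k x) * emeasure lborel {\<tau>. \<tau> \<in> I n \<and> \<tau> < q k (f x $ k) \<and> q k (f x $ k) < \<tau> + e n})"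
        by (subst nn_integral_sum) (auto simp: nn_integral_cmult_indicator)
      also have "\<dots> \<le> ?s x"
      proof (rule sum_mono)
        fix k
        let ?S = "{\<tau>. \<tau> \<in> I n \<and> \<tau> < q k (f x $ k) \<and> q k (f x $ k) < \<tau> + e n}"
        show "(ennreal (1 / e n) * h k x) * emeasure lborel ?S \<le> indicator {x. (\<forall>l. q l (f x $ l) > 0) \<and> q k (f x $ k) < t} x * ennreal (norm (g k x))"
        proof (cases "q k (f x $ k) > 0 \<and> q k (f x $ k) < t \<and> (\<forall>l. l \<noteq> k \<longrightarrow> q l (f x $ l) > 0)")
          case True
          have "emeasure lborel ?S \<le> emeasure lborel {\<tau>. 0 < \<tau> \<and> \<tau> < t \<and> \<tau> < q k (f x $ k) \<and> q k (f x $ k) < \<tau> + e n}"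
            using e[of n] by (intro emeasure_mono) (auto simp: I_def)
          also have "\<dots> \<le> ennreal (e n)" by (rule emeasure_levels_le[OF e])
          finally have "(ennreal (1 / e n) * h k x) * emeasure lborel ?S \<le> (ennreal (1 / e n) * h k x) * ennreal (e n)"
            by (rule mult_left_mono) simp
          also have "\<dots> = h k x * (ennreal (1 / e n) * ennreal (e n))" by (simp add: mult_ac)
          also have "ennreal (1 / e n) * ennreal (e n) = 1" using e[of n] by (simp flip: ennreal_mult)
          finally show ?thesis using True by (auto simp: h_def indicator_def split: if_splits)
        next
          case False
          then have "h k x = 0 \<or> ?S = {}" 
            by (auto simp: h_def I_def indicator_def split: if_splits)
          then have "(ennreal (1 / e n) * h k x) * emeasure lborel ?S = 0"
            by (elim disjE) (simp_all only: emeasure_empty mult_zero_right mult_zero_left)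
          then show ?thesis by (simp only: zero_le)
        qed
      qed
      finally show "(\<integral>\<^sup>+\<tau>. indicator (I n) \<tau> * V n \<tau> x \<partial>lborel) \<le> ?s x" .
    qed
    finally show ?thesis using \<beta>(1) by simp
  qed
  \<comment> \<open>otherwise the integral over the levels would be at least 2 * \<beta>\<close>
  have "\<exists>\<tau>. 0 < \<tau> \<and> \<tau> < t \<and> liminf (\<lambda>n. indicator (I n) \<tau> * W n \<tau>) < ennreal (2 * \<beta> / t)"
  proof (rule ccontr)
    assume neg: "\<not> ?thesis"
    have "ennreal (2 * \<beta>) = ennreal (2 * \<beta> / t) * emeasure lborel {0<..<t}"
      using t \<beta> by (simp flip: ennreal_mult)
    also have "\<dots> = (\<integral>\<^sup>+\<tau>. ennreal (2 * \<beta> / t) * indicator {0<..<t} \<tau> \<partial>lborel)"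
      by (simp add: nn_integral_cmult_indicator)
    also have "\<dots> \<le> (\<integral>\<^sup>+\<tau>. liminf (\<lambda>n. indicator (I n) \<tau> * W n \<tau>) \<partial>lborel)"
    proof (rule nn_integral_mono)
      fix \<tau>
      show "ennreal (2 * \<beta> / t) * indicator {0<..<t} \<tau> \<le> liminf (\<lambda>n. indicator (I n) \<tau> * W n \<tau>)"
      proof (cases "0 < \<tau> \<and> \<tau> < t")
        case True
        with neg have "ennreal (2 * \<beta> / t) \<le> liminf (\<lambda>n. indicator (I n) \<tau> * W n \<tau>)"
          by (meson not_less)
        then show ?thesis using True by simp
      qed auto
    qed
    also have "\<dots> \<le> liminf (\<lambda>n. \<integral>\<^sup>+\<tau>. indicator (I n) \<tau> * W n \<tau> \<partial>lborel)"
      by (rule nn_integral_liminf) measurable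
    also have "\<dots> \<le> liminf (\<lambda>n::nat. ennreal \<beta>)"
      by (intro Liminf_mono always_eventually allI int)
    also have "\<dots> = ennreal \<beta>" by (simp add: Liminf_const)
    finally show False using \<beta>(2) by simp
  qed
  then obtain \<tau> where \<tau>: "0 < \<tau>" "\<tau> < t" and li: "liminf (\<lambda>n. indicator (I n) \<tau> * W n \<tau>) < ennreal (2 * \<beta> / t)" by blast
  let ?E = "{x\<in>\<Omega>. \<forall>k. q k (f x $ k) > \<tau>}"
  have "{x \<in> space ?M. \<forall>k. q k (f x $ k) > \<tau>} \<in> sets ?M" by measurable
  then have Es: "?E \<in> sets lebesgue" using \<Omega>s by (simp add: sets_restrict_space_iff)
  have small: "\<exists>\<^sub>F n in sequentially. indicator (I n) \<tau> * W n \<tau> < ennreal (2 * \<beta> / t)"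
  proof (rule ccontr)
    assume "\<not> ?thesis"
    then have "\<forall>\<^sub>F n in sequentially. ennreal (2 * \<beta> / t) \<le> indicator (I n) \<tau> * W n \<tau>"
      by (simp add: not_frequently not_less)
    then have "ennreal (2 * \<beta> / t) \<le> liminf (\<lambda>n. indicator (I n) \<tau> * W n \<tau>)" by (rule Liminf_bounded)
    with li show False by simp
  qed
  have e_lim: "e \<longlonglongrightarrow> 0" unfolding e_def by (rule LIMSEQ_Suc) (rule lim_const_over_n)
  have inI: "\<forall>\<^sub>F n in sequentially. \<tau> \<in> I n"
    using order_tendstoD(2)[OF e_lim, of "t - \<tau>"] \<tau> by (auto simp: I_def elim!: eventually_mono)
  have cs: "continuous_on UNIV smooth_step"
    using smooth_step_derivative by (meson DERIV_continuous continuous_at_imp_continuous_on)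
  then have [measurable]: "smooth_step \<in> borel_measurable borel" by (rule borel_measurable_continuous_onI)
  have gg: "\<bar>gauss_green ?E T\<bar> \<le> 4 * L * \<beta> / t" if T: "C1_test \<Omega> T" "\<forall>x. norm (T x) \<le> 1" for T
  proof (rule ccontr)
    assume neg: "\<not> \<bar>gauss_green ?E T\<bar> \<le> 4 * L * \<beta> / t"
    define \<Psi> where "\<Psi> n x = (\<Prod>k\<in>UNIV. smooth_step ((q k (f x $ k) - \<tau>) / e n))" for n x
    note di = divergence_integrable[OF \<Omega>s T(1)]
    have [measurable]: "divergence T \<in> borel_measurable ?M" using di by auto
    have lim: "(\<lambda>n. \<integral>x. \<Psi> n x * divergence T x \<partial>?M) \<longlonglongrightarrow> (\<integral>x. indicator ?E x * divergence T x \<partial>?M)"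
    proof (rule integral_dominated_convergence[where w = "\<lambda>x. norm (divergence T x)"])
      show "AE x in ?M. (\<lambda>n. \<Psi> n x * divergence T x) \<longlonglongrightarrow> indicator ?E x * divergence T x"
      proof (rule AE_I2)
        fix x assume x: "x \<in> space ?M"
        have "(\<lambda>n. smooth_step ((q k (f x $ k) - \<tau>) / e n)) \<longlonglongrightarrow> (if q k (f x $ k) > \<tau> then 1 else 0)" for k
        proof (cases "q k (f x $ k) > \<tau>")
          case True
          have "\<forall>\<^sub>F n in sequentially. e n < q k (f x $ k) - \<tau>" using order_tendstoD(2)[OF e_lim] True by auto
          then have "\<forall>\<^sub>F n in sequentially. smooth_step ((q k (f x $ k) - \<tau>) / e n) = 1"
          proof eventually_elim
            case (elim n)
            show ?case using e[of n] elim by (intro smooth_step_values(2)) (simp add: field_simps)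
          qed
          then show ?thesis using True by (simp add: tendsto_eventually)
        next
          case False
          then have "smooth_step ((q k (f x $ k) - \<tau>) / e n) = 0" for n
            using e[of n] by (intro smooth_step_values(1)) (simp add: divide_le_0_iff)
          then show ?thesis using False by simp
        qed
        then have "(\<lambda>n. \<Psi> n x) \<longlonglongrightarrow> (\<Prod>k\<in>UNIV. if q k (f x $ k) > \<tau> then 1 else 0)"
          unfolding \<Psi>_def by (intro tendsto_prod)
        also have "(\<Prod>k\<in>UNIV. if q k (f x $ k) > \<tau> then 1 else (0::real)) = indicator ?E x"
          using x by (auto simp: indicator_def intro!: prod.neutral)
        finally show "(\<lambda>n. \<Psi> n x * divergence T x) \<longlonglongrightarrow> indicator ?E x * divergence T x"
          by (intro tendsto_mult tendsto_const)
      qed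
      have "\<bar>\<Psi> n x\<bar> \<le> 1" for n x
        unfolding \<Psi>_def abs_prod by (intro prod_le_1) (auto simp: smooth_step_values)
      then show "AE x in ?M. norm (\<Psi> n x * divergence T x) \<le> norm (divergence T x)" for n
        by (intro AE_I2) (simp add: abs_mult mult_left_le_one_le)
      have "?E \<in> sets ?M" using Es \<Omega>s by (auto simp: sets_restrict_space_iff)
      then show "(\<lambda>x. indicator ?E x * divergence T x) \<in> borel_measurable ?M" by measurable
      show "(\<lambda>x. \<Psi> n x * divergence T x) \<in> borel_measurable ?M" for n unfolding \<Psi>_def by measurable
    qed (use di in auto)
    have "(\<lambda>n. \<bar>\<integral>x. \<Psi> n x * divergence T x \<partial>?M\<bar>) \<longlonglongrightarrow> \<bar>gauss_green ?E T\<bar>"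
      using tendsto_rabs[OF lim] gauss_green_eq[OF \<Omega>s Es, of T] by auto
    then have "\<forall>\<^sub>F n in sequentially. \<bar>\<integral>x. \<Psi> n x * divergence T x \<partial>?M\<bar> > 4 * L * \<beta> / t"
      using neg by (intro order_tendstoD(1)) auto
    from frequently_eventually_frequently[OF small eventually_conj[OF inI this]]
    obtain n where n: "indicator (I n) \<tau> * W n \<tau> < ennreal (2 * \<beta> / t)" "\<tau> \<in> I n"
      "\<bar>\<integral>x. \<Psi> n x * divergence T x \<partial>?M\<bar> > 4 * L * \<beta> / t" using frequently_ex by blast
    have "ennreal \<bar>\<integral>x. \<Psi> n x * divergence T x \<partial>?M\<bar> \<le> ennreal (2 * L) * W n \<tau>"
      unfolding \<Psi>_def W_def V_def h_def
      by (rule smoothed_level_set_gauss_green[OF \<Omega>(1) w q L(1) \<tau>(1) e _ T(1)])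
        (use n(2) T(2) in \<open>auto simp: I_def\<close>)
    also have "\<dots> \<le> ennreal (2 * L) * ennreal (2 * \<beta> / t)"
      using n(1,2) by (intro mult_left_mono) auto
    also have "\<dots> = ennreal (4 * L * \<beta> / t)"
      using L \<beta> t by (simp flip: ennreal_mult)
    finally have le: "ennreal \<bar>\<integral>x. \<Psi> n x * divergence T x \<partial>?M\<bar> \<le> ennreal (4 * L * \<beta> / t)" .
    have "0 \<le> 4 * L * \<beta> / t" using L(2) \<beta>(2) t by (intro divide_nonneg_pos mult_nonneg_nonneg) auto
    with le n(3) show False by (simp add: ennreal_le_iff)
  qed
  have "perimeter ?E \<Omega> \<le> ereal (4 * L * \<beta> / t)"
    unfolding perimeter_def using gg by (intro Sup_least) (auto simp: abs_le_iff)
  with \<tau> Es show ?thesis by blast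
qed

text \<open>The divergence of a test field integrates to zero over \<open>\<Omega>\<close>.\<close>

lemma perimeter_complement_le:
  fixes \<Omega> :: "'a::euclidean_space set"
  assumes \<Omega>: "\<Omega> \<in> sets lebesgue" and E: "E \<in> sets lebesgue" "E \<subseteq> \<Omega>"
  shows "perimeter (\<Omega> - E) \<Omega> \<le> perimeter E \<Omega>"
  unfolding perimeter_def
proof (rule Sup_mono, safe)
  fix T :: "'a \<Rightarrow> 'a" assume T: "C1_test \<Omega> T" "\<forall>x. norm (T x) \<le> 1"
  note di = divergence_integrable[OF \<Omega> T(1)]
  obtain K where K: "compact K" "K \<subseteq> \<Omega>" "C1_supported K T" using T unfolding C1_test_def by blast
  obtain T' where T': "continuous_on UNIV T'" "\<And>x. (T has_derivative blinfun_apply (T' x)) (at x)"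
    "\<And>x. x \<notin> K \<Longrightarrow> T x = 0" using K(3) unfolding C1_supported_def by blast
  have neg: "((\<lambda>x. - T x) has_derivative blinfun_apply (- T' x)) (at x)" for x
    using has_derivative_minus[OF T'(2)] by (simp add: uminus_blinfun.rep_eq fun_Compl_def)
  have "C1_supported K (\<lambda>x. - T x)"
    unfolding C1_supported_def using neg T' by (intro conjI exI[of _ "\<lambda>x. - T' x"]) (auto intro!: continuous_intros)
  then have T2: "C1_test \<Omega> (\<lambda>x. - T x)" unfolding C1_test_def using K by blast
  have div: "divergence (\<lambda>x. - T x) x = - divergence T x" for x
    unfolding divergence_def
    by (simp add: frechet_derivative_at[OF neg, symmetric] frechet_derivative_at[OF T'(2), symmetric] uminus_blinfun.rep_eq sum_negf)
  have iE: "integrable (lebesgue_on \<Omega>) (\<lambda>x. indicator E x * divergence T x)"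
    using integrable_mult_indicator[of E "lebesgue_on \<Omega>" "divergence T"] di E \<Omega>
    by (auto simp: sets_restrict_space_iff)
  have "gauss_green (\<Omega> - E) T = (\<integral>x. divergence T x - indicator E x * divergence T x \<partial>lebesgue_on \<Omega>)"
    using E \<Omega> by (subst gauss_green_eq[OF \<Omega>]) (auto intro!: Bochner_Integration.integral_cong simp: indicator_def)
  also have "\<dots> = - gauss_green E T"
    using di iE gauss_green_eq[OF \<Omega> E, of T] by simp
  also have "\<dots> = gauss_green E (\<lambda>x. - T x)"
    by (simp add: gauss_green_def div)
  finally show "\<exists>b\<in>{ereal (gauss_green E T) | T. C1_test \<Omega> T \<and> (\<forall>x. norm (T x) \<le> 1)}. ereal (gauss_green (\<Omega> - E) T) \<le> b"
    using T2 T(2) by (intro bexI[of _ "ereal (gauss_green E (\<lambda>x. - T x))"]) auto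
qed

text \<open>Since \<open>|E| \<le> |\<Omega>|\<close>, the power \<open>(d - 1) / d\<close> in the
  isoperimetric inequality may be replaced by \<open>1\<close> at the cost of a constant. If
  \<open>E\<close> has more than half of the measure, the inequality is applied to the
  complement.\<close>

lemma relative_isoperimetric_linear:
  fixes \<Omega> :: "'a::euclidean_space set"
  assumes iso: "relative_isoperimetric \<Omega>" and \<Omega>: "open \<Omega>" "bounded \<Omega>"
  obtains C where "C > 0" "\<And>E P. E \<in> sets lebesgue \<Longrightarrow> E \<subseteq> \<Omega> \<Longrightarrow> perimeter E \<Omega> \<le> ereal P \<Longrightarrow>
    measure lebesgue E \<le> C * P \<or> measure lebesgue (\<Omega> - E) \<le> C * P"
proof -
  have \<Omega>l: "\<Omega> \<in> lmeasurable" using \<Omega> by (simp add: lmeasurable_open)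
  then have \<Omega>s: "\<Omega> \<in> sets lebesgue" by auto
  let ?d = "real DIM('a)" and ?m = "measure lebesgue \<Omega>"
  obtain c where c: "c > 0" "\<And>E. E \<in> sets lebesgue \<Longrightarrow> E \<subseteq> \<Omega> \<Longrightarrow> locally_finite_perimeter E \<Omega> \<Longrightarrow>
    measure lebesgue E \<le> 1 / 2 * ?m \<Longrightarrow> ereal (c * measure lebesgue E powr ((?d - 1) / ?d)) \<le> perimeter E \<Omega>"
    using iso unfolding relative_isoperimetric_def by blast
  define C where "C = (?m + 1) powr (1 / ?d) / c"
  have C: "C > 0" unfolding C_def using c(1) by (intro divide_pos_pos) (auto simp: add_nonneg_pos measure_nonneg intro!: powr_gt_zero[THEN iffD2] less_imp_neq[symmetric])
  have half: "measure lebesgue E \<le> C * P"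
    if E: "E \<in> sets lebesgue" "E \<subseteq> \<Omega>" "perimeter E \<Omega> \<le> ereal P" "measure lebesgue E \<le> 1 / 2 * ?m" for E P
  proof -
    let ?e = "measure lebesgue E"
    have "locally_finite_perimeter E \<Omega>"
      unfolding locally_finite_perimeter_def
    proof safe
      fix K assume K: "compact K" "K \<subseteq> \<Omega>"
      have "Sup {ereal (gauss_green E T) | T. C1_supported K T \<and> (\<forall>x. norm (T x) \<le> 1)} \<le> perimeter E \<Omega>"
        unfolding perimeter_def using K by (intro Sup_subset_mono) (auto simp: C1_test_def)
      also have "\<dots> < \<infinity>" using E(3) by (metis ereal_infty_less(1) le_less_trans less_ereal.simps(4) ereal_less_PInfty)
      finally show "Sup {ereal (gauss_green E T) | T. C1_supported K T \<and> (\<forall>x. norm (T x) \<le> 1)} < \<infinity>" .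
    qed
    then have "ereal (c * ?e powr ((?d - 1) / ?d)) \<le> ereal P" 
      using order_trans[OF c(2)[OF E(1,2) _ E(4)] E(3)] by blast
    then have P: "c * ?e powr ((?d - 1) / ?d) \<le> P" by simp
    show ?thesis
    proof (cases "?e = 0")
      case True
      then have "P \<ge> 0" using P by simp
      then show ?thesis using True C by simp
    next
      case False
      then have e: "?e > 0" using measure_nonneg[of lebesgue E] by linarith
      have "?e \<le> ?m + 1" using E(4) measure_nonneg[of lebesgue \<Omega>] by linarith
      then have "?e powr (1 / ?d) \<le> (?m + 1) powr (1 / ?d)" using e by (intro powr_mono2) auto
      then have "?e powr ((?d - 1) / ?d) * ?e powr (1 / ?d) \<le> ?e powr ((?d - 1) / ?d) * (?m + 1) powr (1 / ?d)"
        by (rule mult_left_mono) simp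
      moreover have "?e powr ((?d - 1) / ?d) * ?e powr (1 / ?d) = ?e"
        using e by (simp add: powr_add[symmetric] add_divide_distrib[symmetric])
      ultimately have "?e \<le> ?e powr ((?d - 1) / ?d) * (?m + 1) powr (1 / ?d)" by simp
      also have "\<dots> = C * (c * ?e powr ((?d - 1) / ?d))" using c(1) by (simp add: C_def)
      also have "\<dots> \<le> C * P" using C P by (intro mult_left_mono) auto
      finally show ?thesis .
    qed
  qed
  show thesis
  proof (rule that[OF C])
    fix E P assume E: "E \<in> sets lebesgue" "E \<subseteq> \<Omega>" "perimeter E \<Omega> \<le> ereal P"
    show "measure lebesgue E \<le> C * P \<or> measure lebesgue (\<Omega> - E) \<le> C * P"
    proof (cases "measure lebesgue E \<le> 1 / 2 * ?m")
      case True then show ?thesis using half E by blast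
    next
      case False
      have "E \<in> lmeasurable" using \<Omega>l E by (meson fmeasurableI2)
      then have "measure lebesgue (\<Omega> - E) = ?m - measure lebesgue E"
        using \<Omega>l E by (intro measure_Diff) (auto simp: fmeasurable_def)
      then have "measure lebesgue (\<Omega> - E) \<le> 1 / 2 * ?m" using False by simp
      moreover have "perimeter (\<Omega> - E) \<Omega> \<le> ereal P"
        using perimeter_complement_le[OF \<Omega>s E(1,2)] E(3) by (rule order_trans)
      ultimately show ?thesis using half[of "\<Omega> - E" P] E \<Omega>s by blast
    qed
  qed
qed

section \<open>One regime dominates\<close>

text \<open>Positivity is what the truncation has to satisfy for a small weight \<open>min u\<^sub>i
  M\<close> to mean a small \<open>u\<^sub>i\<close>; it holds because the solutions
  \<open>u\<^sub>I\<close> have positive components.\<close>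

lemma admissible_bound_pos:
  fixes A :: "real^'n^'n"
  assumes M: "admissible_bound TYPE('n) \<kappa> M" and S: "structural \<kappa> A m" and \<kappa>: "\<kappa> > 0"
  shows "M > 0"
proof -
  fix i :: 'n
  have "ereal 0 < ereal (partial_solution A m {} $ i)"
    using partial_solution_pos[OF S \<kappa>, of i "{}"] by simp
  also have "\<dots> \<le> Sup {ereal (partial_solution A m I $ i) | (A :: real^'n^'n) m I i. structural \<kappa> A m}"
    using S by (intro Sup_upper) blast
  also have "\<dots> < ereal M" using M unfolding admissible_bound_def .
  finally show ?thesis by simp
qed

text \<open>The integrand on the right-hand side at one point; \<open>\<gamma>\<close> stands for
  the norms of the gradients.\<close>

definition weighted_density :: "real \<Rightarrow> real \<Rightarrow> real^'n \<Rightarrow> real^'n \<Rightarrow> ('n \<Rightarrow> real) \<Rightarrow> real" where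
  "weighted_density p M u f \<gamma> = (\<Sum>i\<in>UNIV. min (u $ i) M * (\<bar>f $ i\<bar> powr p + \<gamma> i powr p))"

lemma weighted_density_ge_term:
  assumes "\<And>i. u $ i \<ge> 0" "M > 0"
  shows "min (u $ i) M * (\<bar>f $ i\<bar> powr p + \<gamma> i powr p) \<le> weighted_density p M u f \<gamma>"
  unfolding weighted_density_def
  using assms by (intro member_le_sum mult_nonneg_nonneg) (auto simp: less_imp_le)

lemma weighted_density_nonneg:
  assumes "\<And>i. u $ i \<ge> 0" "M > 0"
  shows "0 \<le> weighted_density p M u f \<gamma>"
  unfolding weighted_density_def using assms by (intro sum_nonneg mult_nonneg_nonneg) (auto simp: less_imp_le)

lemma weighted_density_ge:
  assumes u: "\<And>i. u $ i \<ge> 0" and M: "M > 0" and p: "p \<ge> 1" and a: "a > 0" "u $ i \<ge> a" and b: "b \<ge> 0" "\<bar>f $ i\<bar> \<ge> b"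
  shows "min a M * b powr p \<le> weighted_density p M u f \<gamma>"
proof -
  have "min a M * b powr p \<le> min (u $ i) M * (\<bar>f $ i\<bar> powr p + \<gamma> i powr p)"
    using a b p M powr_mono2[of p b "\<bar>f $ i\<bar>"] by (intro mult_mono add_increasing2) auto
  also have "\<dots> \<le> weighted_density p M u f \<gamma>" by (rule weighted_density_ge_term[OF u M])
  finally show ?thesis .
qed

text \<open>For large \<open>u\<close> the component supplied by \<open>structural_growth\<close>
  makes the weighted density comparable to \<open>|u|\<^sup>p\<close>, and \<open>|f|\<close> grows
  at most linearly in \<open>u\<close>.\<close>

lemma pointwise_growth_estimates:
  assumes \<kappa>: "\<kappa> > 0" and M: "M > 0" and p: "p \<ge> 1"
  obtains K where "K > 0"
    "\<forall>(A :: real^'n^'n) m u \<gamma>. structural \<kappa> A m \<longrightarrow> (\<forall>i. u $ i \<ge> 0) \<longrightarrow>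
       norm u powr p \<le> K * (1 + weighted_density p M u (defect A m u) \<gamma>)"
    "\<forall>(A :: real^'n^'n) m u \<gamma>. structural \<kappa> A m \<longrightarrow> (\<forall>i. u $ i \<ge> 0) \<longrightarrow>
       (\<Sum>i\<in>UNIV. \<bar>defect A m u $ i\<bar> powr p) \<le> K * (1 + weighted_density p M u (defect A m u) \<gamma>)"
proof -
  obtain c R where cR: "c > 0" "R \<ge> 1"
    "\<And>(A :: real^'n^'n) m u. structural \<kappa> A m \<Longrightarrow> (\<And>i. u $ i \<ge> 0) \<Longrightarrow> norm u \<ge> R \<Longrightarrow>
       \<exists>i. u $ i \<ge> 1 \<and> \<bar>defect A m u $ i\<bar> \<ge> c * norm u \<and> defect A m u $ i < -1"
    using structural_growth[OF \<kappa>] by blast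
  let ?N = "real CARD('n)"
  define w where "w = min 1 M * c powr p"
  have w: "w > 0" using M cR by (simp add: w_def)
  define K1 where "K1 = R powr p + 1 / w"
  have R: "R powr p \<ge> 1" using cR(2) p by (simp add: ge_one_powr_ge_zero)
  have "1 / w > 0" using w by simp
  then have K1: "K1 > 1" using R unfolding K1_def by linarith
  have growth: "norm u powr p \<le> K1 * (1 + weighted_density p M u (defect A m u) \<gamma>)"
    if S: "structural \<kappa> A m" and u: "\<And>i. u $ i \<ge> 0" for A :: "real^'n^'n" and m u \<gamma>
  proof -
    let ?W = "weighted_density p M u (defect A m u) \<gamma>"
    have W: "?W \<ge> 0" by (rule weighted_density_nonneg[OF u M])
    show ?thesis
    proof (cases "norm u \<ge> R")
      case True
      then obtain i where i: "u $ i \<ge> 1" "\<bar>defect A m u $ i\<bar> \<ge> c * norm u" using cR(3)[OF S u] by blast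
      have "min 1 M * (c * norm u) powr p \<le> ?W"
        by (rule weighted_density_ge[OF u M p _ i(1) _ i(2)]) (use cR in auto)
      then have "norm u powr p * w \<le> ?W" using cR by (simp add: w_def powr_mult mult_ac)
      then have "norm u powr p \<le> ?W / w" using w by (simp add: pos_le_divide_eq)
      also have "\<dots> \<le> R powr p + R powr p * ?W + (1 / w + ?W / w)"
        using W w by (simp add: add_increasing)
      also have "\<dots> = K1 * (1 + ?W)" by (simp add: K1_def algebra_simps)
      finally show ?thesis .
    next
      case False
      then have "norm u powr p \<le> R powr p" using p by (intro powr_mono2) auto
      also have "\<dots> \<le> K1 * 1" using w by (simp add: K1_def)
      also have "\<dots> \<le> K1 * (1 + ?W)" using K1 W by (intro mult_left_mono) auto
      finally show ?thesis .
    qed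
  qed
  define K2 where "K2 = ?N * ((1 + ?N) / \<kappa>) powr p"
  have K2: "K2 > 0" using \<kappa> by (auto simp: K2_def intro!: mult_pos_pos)
  have bound: "(\<Sum>i\<in>UNIV. \<bar>defect A m u $ i\<bar> powr p) \<le> K2 * (1 + norm u powr p)"
    if S: "structural \<kappa> A m" for A :: "real^'n^'n" and m u
  proof -
    have "\<bar>defect A m u $ i\<bar> powr p \<le> ((1 + ?N) / \<kappa>) powr p * (1 + norm u powr p)" for i
    proof -
      have "\<bar>defect A m u $ i\<bar> \<le> 1 / \<kappa> * (1 + ?N * norm u)" by (rule structural_defect_le[OF S \<kappa>])
      also have "\<dots> \<le> (1 / \<kappa>) * ((1 + ?N) * max 1 (norm u))"
      proof (rule mult_left_mono)
        have "?N * norm u \<le> ?N * max 1 (norm u)" by (intro mult_left_mono) auto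
        then show "1 + ?N * norm u \<le> (1 + ?N) * max 1 (norm u)"
          unfolding distrib_right mult_1 by (intro add_mono) auto
      qed (use \<kappa> in simp)
      finally have "\<bar>defect A m u $ i\<bar> powr p \<le> (((1 + ?N) / \<kappa>) * max 1 (norm u)) powr p"
        using p by (intro powr_mono2) (simp_all add: mult.assoc[symmetric])
      also have "\<dots> = ((1 + ?N) / \<kappa>) powr p * max 1 (norm u) powr p"
        by (rule powr_mult)
      also have "max 1 (norm u) powr p \<le> 1 + norm u powr p" by (simp add: max_def)
      finally show ?thesis by (simp add: mult_left_mono)
    qed
    then have "(\<Sum>i\<in>UNIV. \<bar>defect A m u $ i\<bar> powr p) \<le> (\<Sum>i\<in>(UNIV::'n set). ((1 + ?N) / \<kappa>) powr p * (1 + norm u powr p))"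
      by (intro sum_mono)
    then show ?thesis by (simp add: K2_def mult.assoc)
  qed
  show thesis
  proof (rule that[of "K1 + 2 * K2 * K1"])
    show "K1 + 2 * K2 * K1 > 0" using K1 K2 by (simp add: add_pos_pos)
    have *: "norm u powr p \<le> (K1 + 2 * K2 * K1) * (1 + weighted_density p M u (defect A m u) \<gamma>) \<and>
        (\<Sum>i\<in>UNIV. \<bar>defect A m u $ i\<bar> powr p) \<le> (K1 + 2 * K2 * K1) * (1 + weighted_density p M u (defect A m u) \<gamma>)"
      if S: "structural \<kappa> A m" and u: "\<forall>i. u $ i \<ge> 0" for A :: "real^'n^'n" and m u \<gamma>
    proof -
      let ?W = "weighted_density p M u (defect A m u) \<gamma>"
      have W: "1 + ?W \<ge> 1" using weighted_density_nonneg[of u M] u M by simp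
      have g: "norm u powr p \<le> K1 * (1 + ?W)" using growth[OF S] u by blast
      have KW: "1 \<le> K1 * (1 + ?W)" using K1 W mult_mono[of 1 K1 1 "1 + ?W"] by simp
      have "(\<Sum>i\<in>UNIV. \<bar>defect A m u $ i\<bar> powr p) \<le> K2 * (1 + norm u powr p)" by (rule bound[OF S])
      also have "\<dots> \<le> K2 * (K1 * (1 + ?W) + K1 * (1 + ?W))"
        using g KW K2 by (intro mult_left_mono add_mono) auto
      also have "\<dots> \<le> (K1 + 2 * K2 * K1) * (1 + ?W)"
        using K1 W by (simp add: distrib_right distrib_left algebra_simps)
      finally show ?thesis
        using g K1 K2 W by (simp add: distrib_right add_increasing2)
    qed
    show "\<forall>(A :: real^'n^'n) m u \<gamma>. structural \<kappa> A m \<longrightarrow> (\<forall>i. u $ i \<ge> 0) \<longrightarrow>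
       norm u powr p \<le> (K1 + 2 * K2 * K1) * (1 + weighted_density p M u (defect A m u) \<gamma>)"
      "\<forall>(A :: real^'n^'n) m u \<gamma>. structural \<kappa> A m \<longrightarrow> (\<forall>i. u $ i \<ge> 0) \<longrightarrow>
       (\<Sum>i\<in>UNIV. \<bar>defect A m u $ i\<bar> powr p) \<le> (K1 + 2 * K2 * K1) * (1 + weighted_density p M u (defect A m u) \<gamma>)"
      using * by blast+
  qed
qed

definition competitor :: "'a::euclidean_space set \<Rightarrow> real \<Rightarrow> real \<Rightarrow> ('a \<Rightarrow> real^'n^'n) \<Rightarrow> ('a \<Rightarrow> real^'n) \<Rightarrow> ('a \<Rightarrow> real^'n) \<Rightarrow> bool" where
  "competitor \<Omega> p \<kappa> A m u \<longleftrightarrow> C1_closure \<Omega> A \<and> C1_closure \<Omega> m \<and> W1p \<Omega> p u \<and>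
     (\<forall>x\<in>closure \<Omega>. structural \<kappa> (A x) (m x)) \<and> (AE x in lebesgue_on \<Omega>. \<forall>i. u x $ i \<ge> 0)"

definition energy_density where
  "energy_density \<Omega> p M A m u x = weighted_density p M (u x) (residual A m u x)
     (\<lambda>i. norm (weak_grad \<Omega> (\<lambda>x. residual A m u x $ i) x))"

lemma competitor_measurable:
  fixes u :: "'a::euclidean_space \<Rightarrow> real^'n"
  assumes \<Omega>: "open \<Omega>" and c: "competitor \<Omega> p \<kappa> A m u"
  shows "has_weak_gradient \<Omega> (\<lambda>x. residual A m u x $ k) (weak_grad \<Omega> (\<lambda>x. residual A m u x $ k))"
    "(\<lambda>x. residual A m u x $ k) \<in> borel_measurable (lebesgue_on \<Omega>)"
    "weak_grad \<Omega> (\<lambda>x. residual A m u x $ k) \<in> borel_measurable (lebesgue_on \<Omega>)"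
    "u \<in> borel_measurable (lebesgue_on \<Omega>)" "(\<lambda>x. u x $ k) \<in> borel_measurable (lebesgue_on \<Omega>)"
    "energy_density \<Omega> p M A m u \<in> borel_measurable (lebesgue_on \<Omega>)"
proof -
  have u: "\<exists>g. has_weak_gradient \<Omega> (\<lambda>x. u x $ i) g" for i
    using c by (auto simp: competitor_def W1p_def)
  show w: "has_weak_gradient \<Omega> (\<lambda>x. residual A m u x $ k) (weak_grad \<Omega> (\<lambda>x. residual A m u x $ k))" for k
    using c u by (intro residual_has_weak_gradient \<Omega>) (auto simp: competitor_def)
  show m1[measurable]: "(\<lambda>x. residual A m u x $ k) \<in> borel_measurable (lebesgue_on \<Omega>)" for k
    using w[of k] by (auto simp: has_weak_gradient_def intro!: locally_integrable_measurable \<Omega>)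
  show m2[measurable]: "weak_grad \<Omega> (\<lambda>x. residual A m u x $ k) \<in> borel_measurable (lebesgue_on \<Omega>)" for k
    using w[of k] by (auto simp: has_weak_gradient_def intro!: locally_integrable_measurable \<Omega>)
  show "u \<in> borel_measurable (lebesgue_on \<Omega>)"
    using c by (simp add: competitor_def W1p_def Lp_def)
  show m3[measurable]: "(\<lambda>x. u x $ k) \<in> borel_measurable (lebesgue_on \<Omega>)" for k
  proof -
    obtain g where "has_weak_gradient \<Omega> (\<lambda>x. u x $ k) g" using u by blast
    then show ?thesis by (auto simp: has_weak_gradient_def intro!: locally_integrable_measurable \<Omega>)
  qed
  show "energy_density \<Omega> p M A m u \<in> borel_measurable (lebesgue_on \<Omega>)"
    unfolding energy_density_def[abs_def] weighted_density_def by measurable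
qed

lemma competitor_AE:
  assumes c: "competitor \<Omega> p \<kappa> A m u"
  shows "AE x in lebesgue_on \<Omega>. (\<forall>i. u x $ i \<ge> 0) \<and> structural \<kappa> (A x) (m x) \<and> x \<in> \<Omega>"
proof -
  have "AE x in lebesgue_on \<Omega>. x \<in> \<Omega>" by (rule AE_I2) simp
  moreover have "AE x in lebesgue_on \<Omega>. \<forall>i. u x $ i \<ge> 0" using c by (simp add: competitor_def)
  ultimately show ?thesis
    by eventually_elim (use c closure_subset in \<open>auto simp: competitor_def\<close>)
qed

lemma nn_integral_le_energy:
  assumes \<Omega>: "\<Omega> \<in> lmeasurable" and F: "F \<in> sets lebesgue" "F \<subseteq> \<Omega>" and nn: "a \<ge> 0" "b \<ge> 0" "\<beta> \<ge> 0"
    and W[measurable]: "W \<in> borel_measurable (lebesgue_on \<Omega>)"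
    and D: "(\<integral>\<^sup>+x. ennreal (W x) \<partial>lebesgue_on \<Omega>) \<le> ennreal \<beta>"
    and ae: "AE x in lebesgue_on \<Omega>. 0 \<le> W x \<and> h x \<le> a * indicator F x + b * W x"
  shows "(\<integral>\<^sup>+x. ennreal (h x) \<partial>lebesgue_on \<Omega>) \<le> ennreal (a * measure lebesgue F + b * \<beta>)"
proof -
  have \<Omega>s: "\<Omega> \<in> sets lebesgue" using \<Omega> by auto
  have [measurable]: "F \<in> sets (lebesgue_on \<Omega>)" using F \<Omega>s by (auto simp: sets_restrict_space_iff)
  have "(\<integral>\<^sup>+x. ennreal (h x) \<partial>lebesgue_on \<Omega>) \<le>
    (\<integral>\<^sup>+x. ennreal a * indicator F x + ennreal b * ennreal (W x) \<partial>lebesgue_on \<Omega>)"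
  proof (rule nn_integral_mono_AE)
    show "AE x in lebesgue_on \<Omega>. ennreal (h x) \<le> ennreal a * indicator F x + ennreal b * ennreal (W x)"
      using ae
    proof eventually_elim
      case (elim x)
      then have "ennreal (h x) \<le> ennreal (a * indicator F x + b * W x)" by (intro ennreal_leI) simp
      also have "\<dots> = ennreal a * indicator F x + ennreal b * ennreal (W x)"
        using nn elim by (auto simp: ennreal_plus ennreal_mult' indicator_def)
      finally show ?case .
    qed
  qed
  also have "\<dots> = ennreal a * emeasure lebesgue F + ennreal b * (\<integral>\<^sup>+x. ennreal (W x) \<partial>lebesgue_on \<Omega>)"
    using F \<Omega>s
    by (subst nn_integral_add) (auto simp: nn_integral_cmult nn_integral_cmult_indicator emeasure_restrict_space)
  also have "\<dots> \<le> ennreal a * emeasure lebesgue F + ennreal b * ennreal \<beta>"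
    using D by (intro add_left_mono mult_left_mono) auto
  also have "emeasure lebesgue F = ennreal (measure lebesgue F)"
    using fmeasurableI2[OF \<Omega> F(2,1)] by (rule emeasure_eq_measure2)
  finally show ?thesis using nn by (simp add: ennreal_plus ennreal_mult)
qed

lemma emeasure_le_energy:
  assumes \<Omega>: "\<Omega> \<in> lmeasurable" and F: "F \<in> sets lebesgue" "F \<subseteq> \<Omega>" and S: "{x\<in>\<Omega>. P x} \<in> sets lebesgue"
    and nn: "C \<ge> 0" "\<beta> \<ge> 0" and W: "W \<in> borel_measurable (lebesgue_on \<Omega>)"
    and D: "(\<integral>\<^sup>+x. ennreal (W x) \<partial>lebesgue_on \<Omega>) \<le> ennreal \<beta>"
    and ae: "AE x in lebesgue_on \<Omega>. 0 \<le> W x \<and> (x \<in> \<Omega> - F \<longrightarrow> P x \<longrightarrow> 1 \<le> C * W x)"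
  shows "emeasure lebesgue {x\<in>\<Omega>. P x} \<le> ennreal (measure lebesgue F + C * \<beta>)"
proof -
  have \<Omega>s: "\<Omega> \<in> sets lebesgue" using \<Omega> by auto
  have "emeasure lebesgue {x\<in>\<Omega>. P x} = (\<integral>\<^sup>+x. indicator {x\<in>\<Omega>. P x} x \<partial>lebesgue_on \<Omega>)"
    using S \<Omega>s by (subst nn_integral_indicator) (auto simp: emeasure_restrict_space sets_restrict_space_iff)
  also have "\<dots> = (\<integral>\<^sup>+x. ennreal (indicator {x\<in>\<Omega>. P x} x) \<partial>lebesgue_on \<Omega>)"
    by (simp add: ennreal_indicator)
  also have "\<dots> \<le> ennreal (1 * measure lebesgue F + C * \<beta>)"
  proof (rule nn_integral_le_energy[OF \<Omega> F _ nn W D])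
    show "AE x in lebesgue_on \<Omega>. 0 \<le> W x \<and> indicator {x\<in>\<Omega>. P x} x \<le> 1 * indicator F x + C * W x"
      using ae by eventually_elim (use nn in \<open>auto simp: indicator_def\<close>)
  qed simp
  finally show ?thesis by simp
qed

text \<open>The set where these functions are all larger than \<open>\<tau>\<close> is a
  neighbourhood of the regime \<open>I\<close>: \<open>|f\<^sub>k| < \<surd>(\<delta>\<^sup>2 -
  \<tau>)\<close> off \<open>I\<close> and \<open>f\<^sub>k > \<delta> / 2 + \<tau> /
  \<delta>\<close> on \<open>I\<close>. For \<open>0 < \<tau> < \<delta>\<^sup>2 / 2\<close> both
  thresholds are between \<open>\<delta> / 2\<close> and \<open>\<delta>\<close>. The square gives a
  two-sided condition by one smooth function.\<close>

definition regime_level :: "real \<Rightarrow> 'n set \<Rightarrow> 'n \<Rightarrow> real \<Rightarrow> real" where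
  "regime_level \<delta> I k s = (if k \<in> I then \<delta> * (s - \<delta> / 2) else \<delta>\<^sup>2 - s\<^sup>2)"

text \<open>In the transition layer \<open>|f\<^sub>k|\<close> is between \<open>\<delta> /
  2\<close> and \<open>\<delta>\<close> while all \<open>f\<^sub>l \<ge> - \<delta>\<close>, so the
  weight of index \<open>k\<close> is bounded below. The lower bound for \<open>|f\<^sub>k|\<close>
  absorbs the constant in \<open>g \<le> 1 + g\<^sup>p\<close>.\<close>

lemma transition_layer_bound:
  fixes A :: "real^'n^'n" and f :: "real^'n"
  assumes gap: "complementarity_gap TYPE('n::finite) \<kappa> \<delta>" and \<delta>: "\<delta> > 0" and M: "M > 0" and p: "p \<ge> 1"
    and S: "structural \<kappa> A m" and u: "\<And>i. u $ i \<ge> 0" and f: "f = defect A m u"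
    and pos: "\<And>l. regime_level \<delta> I l (f $ l) > 0" and less: "regime_level \<delta> I k (f $ k) < \<delta>\<^sup>2 / 2" and g: "0 \<le> g"
  shows "g \<le> (1 + (2 / \<delta>) powr p) / min \<delta> M * (min (u $ k) M * (\<bar>f $ k\<bar> powr p + g powr p))"
proof -
  have lower: "f $ l \<ge> - \<delta> \<and> (l \<notin> I \<longrightarrow> \<bar>f $ l\<bar> \<le> \<delta>)" for l
  proof (cases "l \<in> I")
    case True
    then have "f $ l - \<delta> / 2 > 0" using pos[of l] \<delta> by (simp add: regime_level_def zero_less_mult_iff)
    then show ?thesis using True \<delta> by auto
  next
    case False
    then have "(f $ l)\<^sup>2 \<le> \<delta>\<^sup>2" using pos[of l] by (simp add: regime_level_def)
    then have "\<bar>f $ l\<bar> \<le> \<delta>" using \<delta> by (simp add: abs_le_square_iff[symmetric])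
    then show ?thesis by auto
  qed
  have k2: "\<delta> / 2 \<le> \<bar>f $ k\<bar> \<and> \<bar>f $ k\<bar> \<le> \<delta>"
  proof (cases "k \<in> I")
    case True
    then have "\<delta> * (f $ k - \<delta> / 2) > 0" "\<delta> * (f $ k - \<delta> / 2) < \<delta> * (\<delta> / 2)"
      using pos[of k] less by (simp_all add: regime_level_def power2_eq_square)
    then have "f $ k > \<delta> / 2" "f $ k - \<delta> / 2 < \<delta> / 2" using \<delta> by (simp_all add: zero_less_mult_iff)
    then show ?thesis using \<delta> by auto
  next
    case False
    then have "(f $ k)\<^sup>2 > \<delta>\<^sup>2 / 2" using less by (simp add: regime_level_def)
    then have "\<delta>\<^sup>2 \<le> 4 * (f $ k)\<^sup>2" using zero_le_power2[of "f $ k"] by linarith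
    then have "(\<delta> / 2)\<^sup>2 \<le> (f $ k)\<^sup>2" by (simp add: power_divide)
    then have "\<bar>\<delta> / 2\<bar> \<le> \<bar>f $ k\<bar>" by (simp only: abs_le_square_iff)
    then show ?thesis using lower[of k] False \<delta> by auto
  qed
  have "\<forall>i. defect A m u $ i \<ge> - \<delta>" "\<bar>defect A m u $ k\<bar> \<le> \<delta>"
    using lower k2 by (auto simp: f)
  then have uk: "u $ k \<ge> \<delta>"
    using gap S u unfolding complementarity_gap_def by blast
  have "g \<le> 1 + g powr p"
    using p powr_mono[of 1 p g] g by (cases "g \<le> 1") (auto intro: add_increasing2)
  moreover have "1 \<le> (2 / \<delta>) powr p * \<bar>f $ k\<bar> powr p"
  proof -
    have "1 \<le> (2 / \<delta>) * \<bar>f $ k\<bar>" using k2 \<delta> by (simp add: field_simps)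
    then have "1 powr p \<le> ((2 / \<delta>) * \<bar>f $ k\<bar>) powr p" using p by (intro powr_mono2) auto
    then show ?thesis unfolding powr_mult powr_one_eq_one .
  qed
  ultimately have "g \<le> (2 / \<delta>) powr p * \<bar>f $ k\<bar> powr p + g powr p" by linarith
  also have "\<dots> \<le> (1 + (2 / \<delta>) powr p) * (\<bar>f $ k\<bar> powr p + g powr p)"
    by (simp add: algebra_simps)
  also have "\<dots> = (1 + (2 / \<delta>) powr p) / min \<delta> M * (min \<delta> M * (\<bar>f $ k\<bar> powr p + g powr p))"
    using \<delta> M by simp
  also have "\<dots> \<le> (1 + (2 / \<delta>) powr p) / min \<delta> M * (min (u $ k) M * (\<bar>f $ k\<bar> powr p + g powr p))"
    using \<delta> M uk by (intro mult_left_mono mult_right_mono divide_nonneg_pos add_nonneg_nonneg) auto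
  finally show ?thesis .
qed

text \<open>For every \<open>I\<close> there is a level at which the neighbourhood of the regime
  \<open>I\<close> has perimeter of order \<open>\<beta>\<close>, so the neighbourhood or its
  complement has measure of order \<open>\<beta>\<close>. If all neighbourhoods were small,
  \<open>\<Omega>\<close> would have measure of order \<open>\<beta>\<close>, because the points
  outside of all of them have some \<open>u\<^sub>i\<close> and \<open>|f\<^sub>i|\<close> bounded
  below.\<close>

lemma single_regime:
  fixes \<Omega> :: "'a::euclidean_space set" and p \<kappa> M \<delta> \<eta> :: real
  assumes \<Omega>: "open \<Omega>" "bounded \<Omega>" "relative_isoperimetric \<Omega>"
    and M: "M > 0" and p: "p \<ge> 1" and \<delta>: "\<delta> > 0" and \<eta>: "\<eta> > 0"
    and gap: "complementarity_gap TYPE('n::finite) \<kappa> \<delta>"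
    and threshold: "near_equilibria_threshold TYPE('n) \<kappa> \<delta> \<eta>"
  obtains K where "K > 0"
    "\<And>(A :: 'a \<Rightarrow> real^'n^'n) m u \<beta>. competitor \<Omega> p \<kappa> A m u \<Longrightarrow> \<beta> > 0 \<Longrightarrow>
      (\<integral>\<^sup>+x. ennreal (energy_density \<Omega> p M A m u x) \<partial>lebesgue_on \<Omega>) \<le> ennreal \<beta> \<Longrightarrow>
      measure lebesgue \<Omega> \<le> K * \<beta> \<or>
      (\<exists>I E. E \<in> sets lebesgue \<and> E \<subseteq> \<Omega> \<and> measure lebesgue (\<Omega> - E) \<le> K * \<beta> \<and>
         (\<forall>x\<in>E. \<forall>k. if k \<in> I then residual A m u x $ k > \<delta> / 2 else \<bar>residual A m u x $ k\<bar> \<le> \<delta>))"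
proof -
  have \<Omega>l: "\<Omega> \<in> lmeasurable" using \<Omega> by (simp add: lmeasurable_open)
  then have \<Omega>s: "\<Omega> \<in> sets lebesgue" by auto
  obtain c where c: "c > 0" "\<And>E P. E \<in> sets lebesgue \<Longrightarrow> E \<subseteq> \<Omega> \<Longrightarrow> perimeter E \<Omega> \<le> ereal P \<Longrightarrow>
    measure lebesgue E \<le> c * P \<or> measure lebesgue (\<Omega> - E) \<le> c * P"
    using relative_isoperimetric_linear[OF \<Omega>(3,1,2)] by blast
  define q where "q = (regime_level \<delta> :: 'n set \<Rightarrow> 'n \<Rightarrow> real \<Rightarrow> real)"
  have q_eq: "q I k s = regime_level \<delta> I k s" and q_def: "q I k s = (if k \<in> I then \<delta> * (s - \<delta> / 2) else \<delta>\<^sup>2 - s\<^sup>2)" for I k s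
    by (simp_all add: q_def regime_level_def)
  define q' where "q' I k s = (if k \<in> I then \<delta> else - (2 * s))" for I :: "'n set" and k s
  define t where "t = \<delta>\<^sup>2 / 2"
  have t: "t > 0" using \<delta> by (simp add: t_def)
  have q_der: "(q I k has_real_derivative q' I k s) (at s)" for I k s
    unfolding q_def q'_def by (cases "k \<in> I") (auto intro!: derivative_eq_intros)
  have q_cont: "continuous_on UNIV (q' I k)" for I k
    unfolding q'_def[abs_def] by (cases "k \<in> I") (auto intro!: continuous_intros)
  have q_bd: "\<bar>q' I k s\<bar> \<le> 2 * \<delta>" if "0 \<le> q I k s" for I k s
  proof (cases "k \<in> I")
    case False
    then have "s\<^sup>2 \<le> \<delta>\<^sup>2" using that by (simp add: q_def)
    then have "\<bar>s\<bar> \<le> \<delta>" using \<delta> by (simp add: abs_le_square_iff[symmetric])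
    then show ?thesis using False by (simp add: q'_def)
  qed (use \<delta> in \<open>simp add: q'_def\<close>)
  \<comment> \<open>C4 is the constant of the transition layer, K0 that of the isoperimetric alternative, and C3 bounds
    the set of points that are far from all regimes\<close>
  define C4 where "C4 = (1 + (2 / \<delta>) powr p) / min \<delta> M"
  have C4: "C4 > 0" unfolding C4_def using \<delta> M by (intro divide_pos_pos add_pos_nonneg) auto
  define K0 where "K0 = c * (4 * (2 * \<delta>) * C4 / t)"
  have K0: "K0 > 0" using c C4 \<delta> t by (auto simp: K0_def intro!: mult_pos_pos divide_pos_pos)
  define C3 where "C3 = 1 / (min \<eta> M * \<eta> powr p)"
  have C3: "C3 > 0" using \<eta> M by (simp add: C3_def)
  let ?card = "real (card (UNIV :: 'n set set))"
  show thesis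
  proof (rule that[of "K0 + (?card * K0 + C3)"])
    show "K0 + (?card * K0 + C3) > 0" using K0 C3 by (intro add_pos_nonneg add_nonneg_nonneg mult_nonneg_nonneg) auto
    fix A :: "'a \<Rightarrow> real^'n^'n" and m u \<beta>
    assume comp: "competitor \<Omega> p \<kappa> A m u" and \<beta>: "\<beta> > 0"
      and D: "(\<integral>\<^sup>+x. ennreal (energy_density \<Omega> p M A m u x) \<partial>lebesgue_on \<Omega>) \<le> ennreal \<beta>"
    define f where "f x = residual A m u x" for x
    define g where "g k = weak_grad \<Omega> (\<lambda>x. residual A m u x $ k)" for k
    define W where "W = energy_density \<Omega> p M A m u"
    note meas = competitor_measurable[OF \<Omega>(1) comp]
    have fm[measurable]: "(\<lambda>x. f x $ k) \<in> borel_measurable (lebesgue_on \<Omega>)" for k unfolding f_def by (rule meas)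
    have gm[measurable]: "g k \<in> borel_measurable (lebesgue_on \<Omega>)" for k unfolding g_def by (rule meas)
    have Wm[measurable]: "W \<in> borel_measurable (lebesgue_on \<Omega>)" unfolding W_def by (rule meas)
    have um[measurable]: "(\<lambda>x. u x $ k) \<in> borel_measurable (lebesgue_on \<Omega>)" for k by (rule meas)
    have w: "has_weak_gradient \<Omega> (\<lambda>x. f x $ k) (g k)" for k unfolding f_def g_def by (rule meas)
    have f_eq: "f x = defect (A x) (m x) (u x)" for x by (simp add: f_def residual_eq_defect)
    have W_eq: "W x = weighted_density p M (u x) (f x) (\<lambda>i. norm (g i x))" for x
      by (simp add: W_def energy_density_def f_def g_def)
    have D': "(\<integral>\<^sup>+x. ennreal (W x) \<partial>lebesgue_on \<Omega>) \<le> ennreal \<beta>" using D by (simp add: W_def)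
    have grad: "(\<integral>\<^sup>+x. (\<Sum>k\<in>UNIV. indicator {x. (\<forall>l. q I l (f x $ l) > 0) \<and> q I k (f x $ k) < t} x * ennreal (norm (g k x))) \<partial>lebesgue_on \<Omega>) \<le> ennreal (C4 * \<beta>)" for I
    proof -
      let ?s = "\<lambda>x. (\<Sum>k\<in>UNIV. indicator {x. (\<forall>l. q I l (f x $ l) > 0) \<and> q I k (f x $ k) < t} x * ennreal (norm (g k x)))"
      have "(\<integral>\<^sup>+x. ?s x \<partial>lebesgue_on \<Omega>)
        \<le> (\<integral>\<^sup>+x. ennreal C4 * ennreal (W x) \<partial>lebesgue_on \<Omega>)"
      proof (rule nn_integral_mono_AE)
        show "AE x in lebesgue_on \<Omega>. ?s x \<le> ennreal C4 * ennreal (W x)"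
          using competitor_AE[OF comp]
        proof eventually_elim
          case (elim x)
          then have u: "\<And>i. u x $ i \<ge> 0" and S: "structural \<kappa> (A x) (m x)" by auto
          let ?c = "\<lambda>k. (\<forall>l. q I l (f x $ l) > 0) \<and> q I k (f x $ k) < t"
          have le: "(if ?c k then norm (g k x) else 0) \<le> C4 * (min (u x $ k) M * (\<bar>f x $ k\<bar> powr p + norm (g k x) powr p))" for k
          proof (cases "?c k")
            case True
            have "norm (g k x) \<le> (1 + (2 / \<delta>) powr p) / min \<delta> M * (min (u x $ k) M * (\<bar>f x $ k\<bar> powr p + norm (g k x) powr p))"
              by (rule transition_layer_bound[OF gap \<delta> M p S u f_eq]) (use True in \<open>auto simp: q_eq t_def\<close>)
            then show ?thesis using True by (simp add: C4_def)
          qed (use C4 u M in \<open>auto intro!: mult_nonneg_nonneg simp: less_imp_le\<close>)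
          have "?s x
            = (\<Sum>k\<in>UNIV. ennreal (if ?c k then norm (g k x) else 0))"
            by (intro sum.cong) (auto simp: indicator_def)
          also have "\<dots> = ennreal (\<Sum>k\<in>UNIV. if ?c k then norm (g k x) else 0)"
            by (rule sum_ennreal) auto
          also have "\<dots> \<le> ennreal (C4 * W x)"
            unfolding W_eq weighted_density_def sum_distrib_left using le by (intro ennreal_leI sum_mono)
          also have "\<dots> = ennreal C4 * ennreal (W x)" using C4 by (simp add: ennreal_mult')
          finally show ?case .
        qed
      qed
      also have "\<dots> = ennreal C4 * (\<integral>\<^sup>+x. ennreal (W x) \<partial>lebesgue_on \<Omega>)" by (rule nn_integral_cmult) simp
      also have "\<dots> \<le> ennreal C4 * ennreal \<beta>" using D' by (rule mult_left_mono) simp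
      finally show ?thesis using C4 by (simp add: ennreal_mult')
    qed
    define level where "level I \<tau> \<longleftrightarrow> 0 < \<tau> \<and> \<tau> < t \<and> {x\<in>\<Omega>. \<forall>k. q I k (f x $ k) > \<tau>} \<in> sets lebesgue \<and>
       perimeter {x\<in>\<Omega>. \<forall>k. q I k (f x $ k) > \<tau>} \<Omega> \<le> ereal (4 * (2 * \<delta>) * (C4 * \<beta>) / t)" for I \<tau>
    have "\<exists>\<tau>. level I \<tau>" for I
      unfolding level_def
      by (rule exists_level_of_small_perimeter[OF \<Omega>(1,2) w q_der q_cont _ _ t grad])
        (use q_bd \<delta> C4 \<beta> in auto)
    then obtain \<tau> where "\<And>I. level I (\<tau> I)" by metis
    then have \<tau>: "\<And>I. 0 < \<tau> I" "\<And>I. \<tau> I < t"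
      "\<And>I. {x\<in>\<Omega>. \<forall>k. q I k (f x $ k) > \<tau> I} \<in> sets lebesgue"
      "\<And>I. perimeter {x\<in>\<Omega>. \<forall>k. q I k (f x $ k) > \<tau> I} \<Omega> \<le> ereal (4 * (2 * \<delta>) * (C4 * \<beta>) / t)"
      unfolding level_def by blast+
    define E where "E I = {x\<in>\<Omega>. \<forall>k. q I k (f x $ k) > \<tau> I}" for I
    have E: "E I \<in> sets lebesgue" "E I \<subseteq> \<Omega>" for I using \<tau>(3) by (auto simp: E_def)
    have alt: "measure lebesgue (E I) \<le> K0 * \<beta> \<or> measure lebesgue (\<Omega> - E I) \<le> K0 * \<beta>" for I
    proof -
      have "c * (4 * (2 * \<delta>) * (C4 * \<beta>) / t) = K0 * \<beta>" by (simp add: K0_def)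
      then show ?thesis using c(2)[OF E \<tau>(4)[of I, folded E_def]] by simp
    qed
    have mono: "K0 * \<beta> \<le> (K0 + (?card * K0 + C3)) * \<beta>" "(?card * K0 + C3) * \<beta> \<le> (K0 + (?card * K0 + C3)) * \<beta>"
      using K0 C3 \<beta> by (auto intro!: mult_right_mono)
    show "measure lebesgue \<Omega> \<le> (K0 + (?card * K0 + C3)) * \<beta> \<or>
      (\<exists>I E. E \<in> sets lebesgue \<and> E \<subseteq> \<Omega> \<and> measure lebesgue (\<Omega> - E) \<le> (K0 + (?card * K0 + C3)) * \<beta> \<and>
         (\<forall>x\<in>E. \<forall>k. if k \<in> I then residual A m u x $ k > \<delta> / 2 else \<bar>residual A m u x $ k\<bar> \<le> \<delta>))"
    proof (cases "\<exists>I. measure lebesgue (\<Omega> - E I) \<le> K0 * \<beta>")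
      case True
      then obtain I where I: "measure lebesgue (\<Omega> - E I) \<le> K0 * \<beta>" by blast
      have "if k \<in> I then residual A m u x $ k > \<delta> / 2 else \<bar>residual A m u x $ k\<bar> \<le> \<delta>" if "x \<in> E I" for x k
      proof -
        have "q I k (f x $ k) > \<tau> I" using that unfolding E_def by blast
        then have "q I k (f x $ k) > 0" using \<tau>(1)[of I] by linarith
        then show ?thesis
          using \<delta> abs_le_square_iff[of "f x $ k" \<delta>] by (auto simp: q_def f_def zero_less_mult_iff)
      qed
      then show ?thesis using I mono(1) E[of I] by (meson order_trans)
    next
      case False
      then have small: "measure lebesgue (E I) \<le> K0 * \<beta>" for I using alt by blast
      have El: "E I \<in> lmeasurable" for I using fmeasurableI2[OF \<Omega>l E(2,1)] .
      let ?P = "\<lambda>x. \<exists>i. \<eta> \<le> u x $ i \<and> \<eta> \<le> \<bar>f x $ i\<bar>"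
      have "{x \<in> space (lebesgue_on \<Omega>). ?P x} \<in> sets (lebesgue_on \<Omega>)" by measurable
      then have Bs: "{x\<in>\<Omega>. ?P x} \<in> sets lebesgue" using \<Omega>s by (simp add: sets_restrict_space_iff)
      have "emeasure lebesgue {x\<in>\<Omega>. ?P x} \<le> ennreal (measure lebesgue ({} :: 'a set) + C3 * \<beta>)"
      proof (rule emeasure_le_energy[OF \<Omega>l _ _ Bs _ _ Wm D'])
        show "AE x in lebesgue_on \<Omega>. 0 \<le> W x \<and> (x \<in> \<Omega> - {} \<longrightarrow> ?P x \<longrightarrow> 1 \<le> C3 * W x)"
          using competitor_AE[OF comp]
        proof eventually_elim
          case (elim x)
          have "1 \<le> C3 * W x" if P: "?P x"
          proof -
            obtain i where i: "\<eta> \<le> u x $ i" "\<eta> \<le> \<bar>f x $ i\<bar>" using P by blast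
            have "min \<eta> M * \<eta> powr p \<le> W x"
              unfolding W_eq by (rule weighted_density_ge[OF _ M p \<eta> i(1) _ i(2)]) (use elim \<eta> in auto)
            then show ?thesis using \<eta> M by (simp add: C3_def field_simps)
          qed
          then show ?case using weighted_density_nonneg[of "u x" M] elim M by (simp add: W_eq)
        qed
      qed (use C3 \<beta> in auto)
      then have Bm: "emeasure lebesgue {x\<in>\<Omega>. ?P x} \<le> ennreal (C3 * \<beta>)" by simp
      have "AE x in lebesgue_on \<Omega>. x \<in> {x\<in>\<Omega>. ?P x} \<union> (\<Union>I. E I)"
        using competitor_AE[OF comp]
      proof eventually_elim
        case (elim x)
        then have u: "\<And>i. u x $ i \<ge> 0" and S: "structural \<kappa> (A x) (m x)" and x: "x \<in> \<Omega>" by auto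
        show ?case
        proof (cases "?P x")
          case False
          then have "u x $ i < \<eta> \<or> \<bar>defect (A x) (m x) (u x) $ i\<bar> < \<eta>" for i
            by (force simp: f_eq not_le)
          then have n: "\<bar>f x $ k\<bar> < \<delta> / 2 \<or> f x $ k > \<delta>" for k
            using threshold S u unfolding near_equilibria_threshold_def f_eq by blast
          define I where "I = {k. f x $ k > \<delta>}"
          have "q I k (f x $ k) > \<tau> I" for k
          proof (cases "k \<in> I")
            case True
            then have "\<delta> * (f x $ k - \<delta> / 2) > \<delta> * (\<delta> / 2)"
              using \<delta> by (intro mult_strict_left_mono) (auto simp: I_def)
            then show ?thesis using True \<tau>(2)[of I] by (simp add: q_def t_def power2_eq_square)
          next
            case False
            then have "\<bar>f x $ k\<bar> \<le> \<bar>\<delta> / 2\<bar>" using n[of k] by (auto simp: I_def)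
            then have "(f x $ k)\<^sup>2 \<le> (\<delta> / 2)\<^sup>2" by (simp only: abs_le_square_iff)
            then have "4 * (f x $ k)\<^sup>2 \<le> \<delta>\<^sup>2" by (simp add: power_divide)
            then have "\<delta>\<^sup>2 / 2 \<le> \<delta>\<^sup>2 - (f x $ k)\<^sup>2" using zero_le_power2[of "f x $ k"] by linarith
            then show ?thesis using False \<tau>(2)[of I] by (simp add: q_def t_def)
          qed
          then show ?thesis using x by (auto simp: E_def)
        qed (use x in auto)
      qed
      then have "AE x in lebesgue. x \<in> \<Omega> \<longrightarrow> x \<in> {x\<in>\<Omega>. ?P x} \<union> (\<Union>I. E I)"
        using \<Omega>s by (subst (asm) AE_restrict_space_iff) auto
      then have "emeasure lebesgue \<Omega> \<le> emeasure lebesgue ({x\<in>\<Omega>. ?P x} \<union> (\<Union>I. E I))"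
        using Bs E by (intro emeasure_mono_AE) auto
      also have "\<dots> \<le> emeasure lebesgue {x\<in>\<Omega>. ?P x} + emeasure lebesgue (\<Union>I. E I)"
        using Bs E by (intro emeasure_subadditive) auto
      also have "\<dots> \<le> ennreal (C3 * \<beta>) + (\<Sum>I\<in>UNIV. emeasure lebesgue (E I))"
        using E by (intro add_mono Bm emeasure_subadditive_finite) auto
      also have "(\<Sum>I\<in>UNIV. emeasure lebesgue (E I)) \<le> (\<Sum>I\<in>(UNIV :: 'n set set). ennreal (K0 * \<beta>))"
        using small El by (intro sum_mono) (simp add: emeasure_eq_measure2 ennreal_leI)
      also have "\<dots> = ennreal (?card * (K0 * \<beta>))"
        using K0 \<beta> by (simp add: ennreal_mult ennreal_of_nat_eq_real_of_nat)
      also have "ennreal (C3 * \<beta>) + \<dots> = ennreal ((?card * K0 + C3) * \<beta>)"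
        using K0 C3 \<beta> by (subst ennreal_plus[symmetric]) (auto simp: algebra_simps)
      finally have "ennreal (measure lebesgue \<Omega>) \<le> ennreal ((?card * K0 + C3) * \<beta>)"
        using \<Omega>l by (simp add: emeasure_eq_measure2)
      then have "measure lebesgue \<Omega> \<le> (?card * K0 + C3) * \<beta>"
        using K0 C3 \<beta> by (subst (asm) ennreal_le_iff) auto
      then show ?thesis using mono(2) by linarith
    qed
  qed
qed

section \<open>The inequality\<close>

lemma Lp_norm_bound:
  assumes p: "p \<ge> 1" and u: "Lp \<Omega> p u"
    and B: "(\<integral>\<^sup>+x. ennreal (norm (u x) powr p) \<partial>lebesgue_on \<Omega>) \<le> ennreal B" "B \<ge> 0"
  shows "Lp_norm \<Omega> p u \<le> B powr (1 / p)"
proof -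
  have "integrable (lebesgue_on \<Omega>) (\<lambda>x. norm (u x) powr p)" using u by (simp add: Lp_def)
  then have "ennreal (\<integral>x. norm (u x) powr p \<partial>lebesgue_on \<Omega>) \<le> ennreal B"
    using B(1) by (subst nn_integral_eq_integral[symmetric]) auto
  then have "(\<integral>x. norm (u x) powr p \<partial>lebesgue_on \<Omega>) \<le> B" using B(2) by (simp add: ennreal_le_iff)
  then show ?thesis unfolding Lp_norm_def using p by (intro powr_mono2) auto
qed

text \<open>On \<open>E n\<close> the points where \<open>|h n|\<close> is at least
  \<open>\<epsilon>\<close> have density \<open>W n\<close> at least \<open>c \<epsilon>\<close>,
  and outside of \<open>E n\<close> there is little measure.\<close>

lemma regime_tendsto_in_measure:
  fixes h :: "nat \<Rightarrow> 'a::euclidean_space \<Rightarrow> real"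
  assumes \<Omega>: "\<Omega> \<in> lmeasurable"
    and E: "\<And>n. E n \<in> sets lebesgue" "\<And>n. measure lebesgue (\<Omega> - E n) \<le> K * \<beta> n"
    and \<beta>: "\<And>n. \<beta> n \<ge> 0" "\<beta> \<longlonglongrightarrow> 0"
    and W: "\<And>n. W n \<in> borel_measurable (lebesgue_on \<Omega>)"
    and D: "\<And>n. (\<integral>\<^sup>+x. ennreal (W n x) \<partial>lebesgue_on \<Omega>) \<le> ennreal (\<beta> n)"
    and h: "\<And>n. h n \<in> borel_measurable (lebesgue_on \<Omega>)"
    and c: "\<And>\<epsilon>. \<epsilon> > 0 \<Longrightarrow> c \<epsilon> > 0"
    and le: "\<And>\<epsilon> n. \<epsilon> > 0 \<Longrightarrow> AE x in lebesgue_on \<Omega>. 0 \<le> W n x \<and> (x \<in> E n \<longrightarrow> \<epsilon> \<le> \<bar>h n x\<bar> \<longrightarrow> c \<epsilon> \<le> W n x)"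
  shows "tendsto_in_measure (lebesgue_on \<Omega>) h (\<lambda>x. 0)"
  unfolding tendsto_in_measure_def
proof (intro allI impI)
  fix \<epsilon> :: real assume \<epsilon>: "\<epsilon> > 0"
  have \<Omega>s: "\<Omega> \<in> sets lebesgue" using \<Omega> by auto
  let ?S = "\<lambda>n. {x \<in> space (lebesgue_on \<Omega>). \<epsilon> \<le> \<bar>h n x - 0\<bar>}"
  have bound: "emeasure (lebesgue_on \<Omega>) (?S n) \<le> ennreal ((K + 1 / c \<epsilon>) * \<beta> n)" for n
  proof -
    note [measurable] = h[of n]
    have "{x \<in> space (lebesgue_on \<Omega>). \<epsilon> \<le> \<bar>h n x\<bar>} \<in> sets (lebesgue_on \<Omega>)" by measurable
    then have S: "{x\<in>\<Omega>. \<epsilon> \<le> \<bar>h n x\<bar>} \<in> sets lebesgue" using \<Omega>s by (simp add: sets_restrict_space_iff)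
    have "emeasure (lebesgue_on \<Omega>) (?S n) = emeasure lebesgue {x\<in>\<Omega>. \<epsilon> \<le> \<bar>h n x\<bar>}"
      using \<Omega>s by (subst emeasure_restrict_space) auto
    also have "\<dots> \<le> ennreal (measure lebesgue (\<Omega> - E n) + 1 / c \<epsilon> * \<beta> n)"
    proof (rule emeasure_le_energy[OF \<Omega> _ _ S _ \<beta>(1) W D])
      show "AE x in lebesgue_on \<Omega>. 0 \<le> W n x \<and>
          (x \<in> \<Omega> - (\<Omega> - E n) \<longrightarrow> \<epsilon> \<le> \<bar>h n x\<bar> \<longrightarrow> 1 \<le> 1 / c \<epsilon> * W n x)"
        using le[OF \<epsilon>, of n] by eventually_elim (use c[OF \<epsilon>] in \<open>auto simp: field_simps\<close>)
    qed (use E(1)[of n] \<Omega>s c[OF \<epsilon>] in auto)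
    also have "\<dots> \<le> ennreal ((K + 1 / c \<epsilon>) * \<beta> n)"
      using E(2)[of n] by (intro ennreal_leI) (simp add: distrib_right)
    finally show ?thesis .
  qed
  show "(\<lambda>n. emeasure (lebesgue_on \<Omega>) (?S n)) \<longlonglongrightarrow> 0"
  proof (rule tendsto_sandwich[where f = "\<lambda>_. 0" and h = "\<lambda>n. ennreal ((K + 1 / c \<epsilon>) * \<beta> n)"])
    have "(\<lambda>n. (K + 1 / c \<epsilon>) * \<beta> n) \<longlonglongrightarrow> (K + 1 / c \<epsilon>) * 0" by (intro tendsto_mult tendsto_const \<beta>)
    then show "(\<lambda>n. ennreal ((K + 1 / c \<epsilon>) * \<beta> n)) \<longlonglongrightarrow> 0" using tendsto_ennrealI by fastforce
  qed (use bound in \<open>auto intro: always_eventually\<close>)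
qed

theorem theorem2:
  fixes \<Omega> :: "'a::euclidean_space set"
    and p \<kappa> M :: real
    and \<A> :: "(('a \<Rightarrow> real^'n^'n) \<times> ('a \<Rightarrow> real^'n)) set"
    and \<U> :: "('a \<Rightarrow> real^'n) set"
  assumes \<Omega>: "open \<Omega>" "bounded \<Omega>" "connected \<Omega>" "relative_isoperimetric \<Omega>"
    and p: "p \<ge> 1"
    and \<A>_C1: "\<And>A m. (A, m) \<in> \<A> \<Longrightarrow> C1_closure \<Omega> A \<and> C1_closure \<Omega> m"
    and \<U>_W1p: "\<And>u. u \<in> \<U> \<Longrightarrow> W1p \<Omega> p u"
    and \<kappa>: "\<kappa> > 0"
    and \<A>_structural:
      "\<And>A m x. (A, m) \<in> \<A> \<Longrightarrow> x \<in> closure \<Omega> \<Longrightarrow> structural \<kappa> (A x) (m x)"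
    and \<U>_nonneg: "\<And>u. u \<in> \<U> \<Longrightarrow> AE x in lebesgue_on \<Omega>. \<forall>i. u x $ i \<ge> 0"
    and no_degenerate_sequence:
      "\<not> (\<exists>(u :: nat \<Rightarrow> 'a \<Rightarrow> real^'n) A m (I :: 'n set).
            I \<noteq> {} \<and> (\<forall>n. u n \<in> \<U>) \<and> (\<forall>n. (A n, m n) \<in> \<A>) \<and>
            (\<exists>B. \<forall>n. Lp_norm \<Omega> p (u n) \<le> B) \<and>
            (\<forall>i\<in>I. tendsto_in_measure (lebesgue_on \<Omega>) (\<lambda>n x. u n x $ i) (\<lambda>x. 0)) \<and>
            (\<forall>k. k \<notin> I \<longrightarrow>
               tendsto_in_measure (lebesgue_on \<Omega>)
                 (\<lambda>n x. residual (A n) (m n) (u n) x $ k) (\<lambda>x. 0)))"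
    and M: "admissible_bound TYPE('n) \<kappa> M"
  shows "\<exists>C>0. \<forall>u\<in>\<U>. \<forall>(A, m)\<in>\<A>.
    (let f = (\<lambda>i x. residual A m u x $ i) in
      (\<integral>\<^sup>+ x. ennreal (\<Sum>i\<in>UNIV. \<bar>f i x\<bar> powr p) \<partial>(lebesgue_on \<Omega>)) \<le>
      ennreal C * (\<integral>\<^sup>+ x. ennreal (\<Sum>i\<in>UNIV. min (u x $ i) M *
          (\<bar>f i x\<bar> powr p + norm (weak_grad \<Omega> (f i) x) powr p)) \<partial>(lebesgue_on \<Omega>)))"
proof (rule ccontr)
  assume contra: "\<not> ?thesis"
  have \<Omega>l: "\<Omega> \<in> lmeasurable" using \<Omega> by (simp add: lmeasurable_open)
  then have \<Omega>s: "\<Omega> \<in> sets lebesgue" by auto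
  \<comment> \<open>for every n a pair that violates the inequality with the constant n + 1\<close>
  define lhs where "lhs A m u = (\<integral>\<^sup>+ x. ennreal (\<Sum>i\<in>UNIV. \<bar>residual A m u x $ i\<bar> powr p) \<partial>(lebesgue_on \<Omega>))"
    for A :: "'a \<Rightarrow> real^'n^'n" and m u
  define rhs where "rhs A m u = (\<integral>\<^sup>+ x. ennreal (energy_density \<Omega> p M A m u x) \<partial>(lebesgue_on \<Omega>))"
    for A :: "'a \<Rightarrow> real^'n^'n" and m u
  have "\<exists>A m u. u \<in> \<U> \<and> (A, m) \<in> \<A> \<and> lhs A m u > ennreal C * rhs A m u" if "C > 0" for C
    using contra that unfolding lhs_def rhs_def energy_density_def weighted_density_def Let_def by (force simp: not_le)
  then have "\<exists>A m u. u \<in> \<U> \<and> (A, m) \<in> \<A> \<and> lhs A m u > ennreal (real (Suc n)) * rhs A m u" for n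
    by (metis of_nat_0_less_iff zero_less_Suc)
  then obtain A m u where in\<U>: "\<And>n. u n \<in> \<U>" and in\<A>: "\<And>n. (A n, m n) \<in> \<A>"
    and viol: "\<And>n. lhs (A n) (m n) (u n) > ennreal (real (Suc n)) * rhs (A n) (m n) (u n)" by metis
  have comp: "competitor \<Omega> p \<kappa> (A n) (m n) (u n)" for n
    unfolding competitor_def using \<A>_C1[OF in\<A>] \<U>_W1p[OF in\<U>] \<A>_structural[OF in\<A>] \<U>_nonneg[OF in\<U>] by blast
  define f where "f n x = residual (A n) (m n) (u n) x" for n x
  define W where "W n = energy_density \<Omega> p M (A n) (m n) (u n)" for n
  define J where "J n = (\<integral>\<^sup>+ x. ennreal (\<Sum>i\<in>UNIV. \<bar>f n x $ i\<bar> powr p) \<partial>(lebesgue_on \<Omega>))" for n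
  define D where "D n = (\<integral>\<^sup>+ x. ennreal (W n x) \<partial>(lebesgue_on \<Omega>))" for n
  have JD: "J n > ennreal (real (Suc n)) * D n" for n
    using viol[of n] by (simp only: lhs_def rhs_def J_def D_def f_def W_def)
  have "\<Omega> \<noteq> {}"
  proof
    assume "\<Omega> = {}"
    then have "J 0 = 0" by (simp add: J_def nn_integral_empty)
    with JD[of 0] show False by simp
  qed
  then obtain x0 where "x0 \<in> \<Omega>" by blast
  then have "structural \<kappa> (A 0 x0) (m 0 x0)" using \<A>_structural[OF in\<A>] closure_subset by blast
  then have M0: "M > 0" using admissible_bound_pos[OF M _ \<kappa>] by blast
  obtain \<delta> where \<delta>: "\<delta> > 0" "\<delta> \<le> 1" "complementarity_gap TYPE('n) \<kappa> \<delta>"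
    using structural_uniform_complementarity[OF \<kappa>] by blast
  obtain \<eta> where \<eta>: "\<eta> > 0" "near_equilibria_threshold TYPE('n) \<kappa> \<delta> \<eta>"
    using structural_near_equilibria[OF \<kappa> \<delta>] by blast
  obtain G where G: "G > 0"
    "\<forall>(A :: real^'n^'n) m u \<gamma>. structural \<kappa> A m \<longrightarrow> (\<forall>i. u $ i \<ge> 0) \<longrightarrow>
       norm u powr p \<le> G * (1 + weighted_density p M u (defect A m u) \<gamma>)"
    "\<forall>(A :: real^'n^'n) m u \<gamma>. structural \<kappa> A m \<longrightarrow> (\<forall>i. u $ i \<ge> 0) \<longrightarrow>
       (\<Sum>i\<in>UNIV. \<bar>defect A m u $ i\<bar> powr p) \<le> G * (1 + weighted_density p M u (defect A m u) \<gamma>)"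
    using pointwise_growth_estimates[OF \<kappa> M0 p] by blast
  obtain K where K: "K > 0" and regime:
    "\<And>(A :: 'a \<Rightarrow> real^'n^'n) m u \<beta>. competitor \<Omega> p \<kappa> A m u \<Longrightarrow> \<beta> > 0 \<Longrightarrow>
      (\<integral>\<^sup>+x. ennreal (energy_density \<Omega> p M A m u x) \<partial>lebesgue_on \<Omega>) \<le> ennreal \<beta> \<Longrightarrow>
      measure lebesgue \<Omega> \<le> K * \<beta> \<or>
      (\<exists>I E. E \<in> sets lebesgue \<and> E \<subseteq> \<Omega> \<and> measure lebesgue (\<Omega> - E) \<le> K * \<beta> \<and>
         (\<forall>x\<in>E. \<forall>k. if k \<in> I then residual A m u x $ k > \<delta> / 2 else \<bar>residual A m u x $ k\<bar> \<le> \<delta>))"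
    using single_regime[OF \<Omega>(1,2,4) M0 p \<delta>(1) \<eta>(1) \<delta>(3) \<eta>(2)] by metis
  define V where "V = measure lebesgue \<Omega>"
  have V0: "V \<ge> 0" by (simp add: V_def)
  note meas = competitor_measurable[OF \<Omega>(1) comp]
  have Wm: "W n \<in> borel_measurable (lebesgue_on \<Omega>)" for n unfolding W_def by (rule meas)
  define \<gamma> where "\<gamma> n x i = norm (weak_grad \<Omega> (\<lambda>x. residual (A n) (m n) (u n) x $ i) x)" for n x i
  have W_eq: "W n x = weighted_density p M (u n x) (f n x) (\<gamma> n x)" for n x
    by (simp add: W_def energy_density_def f_def \<gamma>_def[abs_def])
  have AE_x: "AE x in lebesgue_on \<Omega>. x \<in> \<Omega> \<and> (\<forall>i. 0 \<le> u n x $ i) \<and> 0 \<le> W n x \<and>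
      norm (u n x) powr p \<le> G * (1 + W n x) \<and> (\<Sum>i\<in>UNIV. \<bar>f n x $ i\<bar> powr p) \<le> G * (1 + W n x) \<and>
      (\<forall>k. (\<forall>i. - \<delta> \<le> f n x $ i) \<longrightarrow> \<bar>f n x $ k\<bar> \<le> \<delta> \<longrightarrow> \<delta> \<le> u n x $ k)" for n
    using competitor_AE[OF comp[of n]]
  proof eventually_elim
    case (elim x)
    have f: "f n x = defect (A n x) (m n x) (u n x)" by (simp add: f_def residual_eq_defect)
    show ?case
      unfolding W_eq f using elim G(2,3) \<delta>(3) weighted_density_nonneg[of "u n x" M] M0
      unfolding complementarity_gap_def by auto
  qed
  have W_ge: "min a M * b powr p \<le> W n x" if "\<forall>i. 0 \<le> u n x $ i" "a > 0" "u n x $ i \<ge> a" "b \<ge> 0" "\<bar>f n x $ i\<bar> \<ge> b"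
    for n x i a b
    unfolding W_eq by (rule weighted_density_ge[OF _ M0 p that(2-)]) (use that(1) in blast)
  \<comment> \<open>both sides are finite, and D n is at most J n / (n + 1)\<close>
  have D_fin: "D n < \<infinity>" for n
  proof (rule ccontr)
    assume "\<not> D n < \<infinity>"
    then have "D n = \<infinity>" by (simp add: less_top[symmetric])
    then have "ennreal (real (Suc n)) * D n = \<infinity>" by (simp add: ennreal_mult_top)
    then show False using JD[of n] by simp
  qed
  define d where "d n = enn2real (D n)" for n
  have Dd: "D n = ennreal (d n)" and d0: "d n \<ge> 0" for n using D_fin[of n] by (simp_all add: d_def)
  have J_le: "J n \<le> ennreal (G * V + G * d n)" for n
    unfolding J_def V_def
  proof (rule nn_integral_le_energy[OF \<Omega>l \<Omega>s order_refl _ _ d0 Wm Dd[unfolded D_def, THEN eq_refl]])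
    show "AE x in lebesgue_on \<Omega>. 0 \<le> W n x \<and> (\<Sum>i\<in>UNIV. \<bar>f n x $ i\<bar> powr p) \<le> G * indicator \<Omega> x + G * W n x"
      using AE_x[of n] by eventually_elim (simp add: distrib_left)
  qed (use G in auto)
  define j where "j n = enn2real (J n)" for n
  have Jj: "J n = ennreal (j n)" for n
    using le_less_trans[OF J_le ennreal_less_top, of n] by (simp add: j_def)
  have dj: "real (Suc n) * d n < j n" for n
  proof -
    have "ennreal (real (Suc n) * d n) < ennreal (j n)"
      using JD[of n] d0[of n] unfolding Dd Jj by (subst ennreal_mult) auto
    then show ?thesis using d0[of n] by (subst (asm) ennreal_less_iff) auto
  qed
  then have j0: "j n > 0" for n using d0[of n] by (smt (verit) mult_nonneg_nonneg of_nat_0_le_iff)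
  define \<beta> where "\<beta> n = j n / real (Suc n)" for n
  have \<beta>0: "\<beta> n > 0" for n using j0[of n] by (simp add: \<beta>_def)
  have d\<beta>: "d n \<le> \<beta> n" for n using dj[of n] by (simp add: \<beta>_def field_simps)
  have D\<beta>: "(\<integral>\<^sup>+ x. ennreal (W n x) \<partial>(lebesgue_on \<Omega>)) \<le> ennreal (\<beta> n)" for n
    using ennreal_leI[OF d\<beta>] Dd[unfolded D_def] by simp
  have j_le: "j n \<le> G * V + G * \<beta> n" for n
  proof -
    have "0 \<le> G * V + G * d n" using G V0 d0[of n] by simp
    then have "j n \<le> G * V + G * d n" using J_le[of n] unfolding Jj by (simp add: ennreal_le_iff)
    then show ?thesis using mult_left_mono[OF d\<beta>, of G n] G(1) by linarith
  qed
  \<comment> \<open>j n stays bounded since G * \<beta> n is at most half of it for large n; hence \<beta> tends to 0\<close>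
  have ev_ge: "\<forall>\<^sub>F n in sequentially. real (Suc n) \<ge> c" for c
    using filterlim_real_sequentially by (rule filterlim_compose[OF _ filterlim_Suc, THEN filterlim_at_top[THEN iffD1], THEN spec])
  have j_bd: "\<forall>\<^sub>F n in sequentially. j n \<le> 2 * G * V"
    using ev_ge[of "2 * G"]
  proof eventually_elim
    case (elim n)
    have "2 * G * j n \<le> real (Suc n) * j n" using elim j0[of n] by (intro mult_right_mono) auto
    then have "G * \<beta> n \<le> j n / 2" by (simp add: \<beta>_def field_simps)
    then show ?case using j_le[of n] by linarith
  qed
  have \<beta>_lim: "\<beta> \<longlonglongrightarrow> 0"
  proof (rule tendsto_sandwich[of "\<lambda>_. 0" _ _ "\<lambda>n. (2 * G * V) / real (Suc n)"])
    show "\<forall>\<^sub>F n in sequentially. \<beta> n \<le> (2 * G * V) / real (Suc n)"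
      using j_bd by eventually_elim (simp add: \<beta>_def divide_right_mono)
    show "(\<lambda>n. (2 * G * V) / real (Suc n)) \<longlonglongrightarrow> 0"
      by (rule LIMSEQ_Suc[OF lim_const_over_n])
  qed (use \<beta>0 less_imp_le in \<open>auto intro!: always_eventually\<close>)
  have V_pos: "V > 0"
  proof (rule ccontr)
    assume "\<not> V > 0"
    with V0 have "V = 0" by simp
    moreover obtain n where "j n \<le> 2 * G * V" using j_bd by (auto simp: eventually_sequentially)
    ultimately show False using j0[of n] by simp
  qed
  have "\<forall>\<^sub>F n in sequentially. \<beta> n < V / K" "\<forall>\<^sub>F n in sequentially. \<beta> n < 1"
    using order_tendstoD(2)[OF \<beta>_lim] V_pos K by auto
  then have "\<forall>\<^sub>F n in sequentially. K * \<beta> n < V \<and> \<beta> n < 1"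
    by eventually_elim (use K in \<open>simp add: field_simps\<close>)
  then obtain n0 where n0: "\<And>n. n \<ge> n0 \<Longrightarrow> K * \<beta> n < V" "\<And>n. n \<ge> n0 \<Longrightarrow> \<beta> n < 1"
    by (auto simp: eventually_sequentially)
  define regime_at where "regime_at n I E \<longleftrightarrow> E \<in> sets lebesgue \<and> E \<subseteq> \<Omega> \<and> measure lebesgue (\<Omega> - E) \<le> K * \<beta> n \<and>
     (\<forall>x\<in>E. \<forall>k. if k \<in> I then f n x $ k > \<delta> / 2 else \<bar>f n x $ k\<bar> \<le> \<delta>)" for n and I :: "'n set" and E
  have "\<exists>I E. regime_at n I E" if "n \<ge> n0" for n
    using regime[OF comp \<beta>0 D\<beta>[unfolded W_def], of n] n0(1)[OF that] unfolding regime_at_def V_def f_def by auto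
  then obtain I E where IE: "\<And>n. n \<ge> n0 \<Longrightarrow> regime_at n (I n) (E n)" by metis
  \<comment> \<open>in the regime I n = {} every component is bounded below on E n, so the inequality holds
    with a constant independent of n\<close>
  define b where "b = G + 1 / min \<delta> M"
  have b: "b \<ge> 0" "b \<ge> 1 / min \<delta> M" "b \<ge> G" using G M0 \<delta>(1) by (auto simp: b_def)
  have full: "real (Suc n) \<le> G * K + b" if n: "n0 \<le> n" "I n = {}" for n
  proof -
    note R = IE[OF n(1), unfolded regime_at_def n(2)]
    have "J n \<le> ennreal (G * measure lebesgue (\<Omega> - E n) + b * \<beta> n)"
      unfolding J_def
    proof (rule nn_integral_le_energy[OF \<Omega>l _ _ _ b(1) _ Wm D\<beta>])
      show "AE x in lebesgue_on \<Omega>. 0 \<le> W n x \<and> (\<Sum>i\<in>UNIV. \<bar>f n x $ i\<bar> powr p) \<le> G * indicator (\<Omega> - E n) x + b * W n x"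
        using AE_x[of n]
      proof eventually_elim
        case (elim x)
        show ?case
        proof (cases "x \<in> E n")
          case True
          then have f: "\<bar>f n x $ k\<bar> \<le> \<delta>" for k using R by auto
          then have "- \<delta> \<le> f n x $ k" for k by (metis abs_le_D2 minus_le_iff)
          then have uk: "u n x $ k \<ge> \<delta>" for k using elim f by blast
          have "min \<delta> M * (\<Sum>i\<in>UNIV. \<bar>f n x $ i\<bar> powr p) \<le> W n x"
            unfolding W_eq weighted_density_def sum_distrib_left
            using elim M0 by (intro sum_mono mult_mono min.mono uk order_refl) (auto simp: less_imp_le)
          then have "(\<Sum>i\<in>UNIV. \<bar>f n x $ i\<bar> powr p) \<le> 1 / min \<delta> M * W n x"
            using M0 \<delta>(1) by (simp add: field_simps)
          then show ?thesis using True elim mult_right_mono[OF b(2), of "W n x"] by simp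
        next
          case False
          then show ?thesis using elim mult_right_mono[OF b(3), of "W n x"] by (simp add: distrib_left)
        qed
      qed
    qed (use G \<beta>0[of n] R \<Omega>s in auto)
    moreover have "0 \<le> G * measure lebesgue (\<Omega> - E n) + b * \<beta> n" using G b(1) \<beta>0[of n] by simp
    ultimately have "j n \<le> G * measure lebesgue (\<Omega> - E n) + b * \<beta> n" unfolding Jj by (simp add: ennreal_le_iff)
    also have "\<dots> \<le> G * (K * \<beta> n) + b * \<beta> n" using R G(1) by (intro add_right_mono mult_left_mono) auto
    also have "\<dots> = (G * K + b) * j n / real (Suc n)" by (simp add: \<beta>_def add_divide_distrib distrib_right)
    finally have "real (Suc n) * j n \<le> (G * K + b) * j n"
      by (subst (asm) pos_le_divide_eq) (simp_all add: mult.commute)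
    then show ?thesis using j0[of n] by (simp del: of_nat_Suc)
  qed
  obtain n1 where n1: "\<And>n. n \<ge> n1 \<Longrightarrow> real (Suc n) \<ge> G * K + b + 1"
    using ev_ge[of "G * K + b + 1"] by (auto simp: eventually_sequentially)
  \<comment> \<open>one index set I0 occurs along a subsequence r; the hypothesis on sequences excludes it\<close>
  have "\<exists>I0. \<exists>\<^sub>F n in sequentially. I n = I0"
  proof (rule ccontr)
    assume "\<not> ?thesis"
    then have "\<forall>I0\<in>UNIV. \<forall>\<^sub>F n in sequentially. I n \<noteq> I0" by (simp add: not_frequently)
    then have "\<forall>\<^sub>F n in sequentially. \<forall>I0\<in>UNIV. I n \<noteq> I0" by (subst eventually_ball_finite_distrib) auto
    then show False by simp
  qed
  then obtain I0 where fr: "\<exists>\<^sub>F n in sequentially. I n = I0" by blast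
  have "infinite {n. n \<ge> max n0 n1 \<and> I n = I0}"
    using frequently_eventually_frequently[OF fr eventually_ge_at_top[of "max n0 n1"]]
    by (simp add: frequently_cofinite[symmetric] cofinite_eq_sequentially conj_commute)
  then obtain r :: "nat \<Rightarrow> nat" where r: "strict_mono r" "\<And>k. r k \<in> {n. n \<ge> max n0 n1 \<and> I n = I0}"
    using infinite_enumerate by blast
  then have r': "n0 \<le> r k" "n1 \<le> r k" "I (r k) = I0" for k by auto
  have I0: "I0 \<noteq> {}"
    using full[OF r'(1)[of 0]] n1[OF r'(2)[of 0]] r'(3)[of 0] by force
  have R: "E (r k) \<in> sets lebesgue" "measure lebesgue (\<Omega> - E (r k)) \<le> K * \<beta> (r k)"
    "\<And>x i. x \<in> E (r k) \<Longrightarrow> if i \<in> I0 then f (r k) x $ i > \<delta> / 2 else \<bar>f (r k) x $ i\<bar> \<le> \<delta>" for k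
    using IE[OF r'(1)[of k]] unfolding regime_at_def r'(3) by blast+
  have \<beta>r: "(\<lambda>k. \<beta> (r k)) \<longlonglongrightarrow> 0" using LIMSEQ_subseq_LIMSEQ[OF \<beta>_lim r(1)] by (simp add: o_def)
  note to_0 = regime_tendsto_in_measure[OF \<Omega>l R(1,2) less_imp_le[OF \<beta>0] \<beta>r Wm D\<beta>]
  have u_to_0: "tendsto_in_measure (lebesgue_on \<Omega>) (\<lambda>k x. u (r k) x $ i) (\<lambda>x. 0)" if i: "i \<in> I0" for i
  proof (rule to_0[where c = "\<lambda>\<epsilon>. min \<epsilon> M * (\<delta> / 2) powr p"])
    show "AE x in lebesgue_on \<Omega>. 0 \<le> W (r k) x \<and> (x \<in> E (r k) \<longrightarrow> \<epsilon> \<le> \<bar>u (r k) x $ i\<bar> \<longrightarrow> min \<epsilon> M * (\<delta> / 2) powr p \<le> W (r k) x)"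
      if "\<epsilon> > 0" for \<epsilon> k
      using AE_x[of "r k"]
    proof eventually_elim
      case (elim x)
      have "min \<epsilon> M * (\<delta> / 2) powr p \<le> W (r k) x" if "x \<in> E (r k)" "\<epsilon> \<le> \<bar>u (r k) x $ i\<bar>"
        by (rule W_ge[where i = i]) (use elim R(3)[OF that(1), of i] i that(2) \<open>\<epsilon> > 0\<close> \<delta>(1) in auto)
      then show ?case using elim by blast
    qed
  qed (use M0 \<delta>(1) meas(5) in auto)
  have f_to_0: "tendsto_in_measure (lebesgue_on \<Omega>) (\<lambda>k x. f (r k) x $ i) (\<lambda>x. 0)" if i: "i \<notin> I0" for i
  proof (rule to_0[where c = "\<lambda>\<epsilon>. min \<delta> M * \<epsilon> powr p"])
    show "AE x in lebesgue_on \<Omega>. 0 \<le> W (r k) x \<and> (x \<in> E (r k) \<longrightarrow> \<epsilon> \<le> \<bar>f (r k) x $ i\<bar> \<longrightarrow> min \<delta> M * \<epsilon> powr p \<le> W (r k) x)"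
      if "\<epsilon> > 0" for \<epsilon> k
      using AE_x[of "r k"]
    proof eventually_elim
      case (elim x)
      have "min \<delta> M * \<epsilon> powr p \<le> W (r k) x" if x: "x \<in> E (r k)" and "\<epsilon> \<le> \<bar>f (r k) x $ i\<bar>"
      proof (rule W_ge[where i = i])
        have "- \<delta> \<le> f (r k) x $ l" for l
          using R(3)[OF x, of l] \<delta>(1) by (auto simp: abs_le_iff split: if_splits)
        moreover have "\<bar>f (r k) x $ i\<bar> \<le> \<delta>" using R(3)[OF x, of i] i by simp
        ultimately show "\<delta> \<le> u (r k) x $ i" using elim by blast
      qed (use elim that \<open>\<epsilon> > 0\<close> \<delta>(1) in auto)
      then show ?case using elim by blast
    qed
  qed (use M0 \<delta>(1) meas(2) in \<open>auto simp: f_def\<close>)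
  have bounded: "Lp_norm \<Omega> p (u (r k)) \<le> (G * V + G) powr (1 / p)" for k
  proof (rule Lp_norm_bound[OF p])
    show "Lp \<Omega> p (u (r k))" using \<U>_W1p[OF in\<U>] by (simp add: W1p_def)
    have "(\<integral>\<^sup>+x. ennreal (norm (u (r k) x) powr p) \<partial>lebesgue_on \<Omega>) \<le> ennreal (G * V + G * \<beta> (r k))"
      unfolding V_def
    proof (rule nn_integral_le_energy[OF \<Omega>l \<Omega>s order_refl _ _ less_imp_le[OF \<beta>0] Wm D\<beta>])
      show "AE x in lebesgue_on \<Omega>. 0 \<le> W (r k) x \<and> norm (u (r k) x) powr p \<le> G * indicator \<Omega> x + G * W (r k) x"
        using AE_x[of "r k"] by eventually_elim (simp add: distrib_left)
    qed (use G in auto)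
    also have "\<dots> \<le> ennreal (G * V + G)"
      using n0(2)[OF r'(1)[of k]] G(1) by (intro ennreal_leI add_left_mono) (simp add: mult_left_le)
    finally show "(\<integral>\<^sup>+x. ennreal (norm (u (r k) x) powr p) \<partial>lebesgue_on \<Omega>) \<le> ennreal (G * V + G)" .
  qed (use G V0 in auto)
  show False
  proof (rule notE[OF no_degenerate_sequence], rule exI[of _ "\<lambda>k. u (r k)"], rule exI[of _ "\<lambda>k. A (r k)"],
      rule exI[of _ "\<lambda>k. m (r k)"], rule exI[of _ I0], intro conjI allI ballI impI)
    show "\<exists>B. \<forall>k. Lp_norm \<Omega> p (u (r k)) \<le> B" using bounded by blast
  qed (use I0 in\<U> in\<A> u_to_0 f_to_0 in \<open>auto simp: f_def\<close>)
qed

end
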